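(* In the setting described in the context, for every $g\ge2$ the holomorphic anomaly equations $$\frac{\partial F_g}{\partial E_2}=-\frac1{24}\Big[\frac{\partial^2F_{g-1}}{\partial\nu^2}+\sum_{h=1}^{g-1}\frac{\partial F_h}{\partial\nu}\frac{\partial F_{g-h}}{\partial\nu}\Big],$$ supplemented with the weak conifold gap condition $$\nu^{2g-2}F_g=\kappa_g+O(q^{d_g}),\qquad d_g=\dim\mathcal M_{14(g-1)},\qquad \kappa_g=\frac{B_{2g}}{4g(g-1)},$$ determine $F_g$ (of the form $F_g=(\xi/E_4)^{2g-2}P_g(E_2,E_4,E_6)$ described in the context) uniquely by recursion in $g$, starting from $F_1=-\frac1{12}\ln(\omega_A^6\Delta)$.
   Context: Weierstrass curve $y^2=4x^3-g_2x-g_3$, $g_2=-2t$, $g_3=-u$, $\Delta=g_2^3-27g_3^2$; symplectic basis $\{A,B\}$, $\omega_A=\oint_Adx/y$, $\omega_B=\oint_Bdx/y$, nome $q=e^{2\pi i\omega_B/\omega_A}$. Eisenstein series $E_{2n}(q)=1-\frac{4n}{B_{2n}}\sum_{k\ge1}\frac{k^{2n-1}q^k}{1-q^k}$, Dedekind eta $\eta(q)=q^{1/24}\prod_{k\ge1}(1-q^k)$. The curve is parametrized by $(\omega_A,q)$ via $g_2=\frac{4\pi^4}{3\omega_A^4}E_4$, $g_3=\frac{8\pi^6}{27\omega_A^6}E_6$, so $\Delta=(2\pi i/\omega_A)^{12}\eta^{24}$, and $\nu:=\frac{1}{2\pi i}\oint_Ay\,dx=\big(\frac{2\pi i}{\omega_A}\big)^5\frac{E_6-E_2E_4}{360}$;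 $\partial/\partial\nu$ denotes the derivative in $\nu$ at fixed $t$ (all quantities being functions of $(t,\nu)$ through $(\omega_A,q)$). Set $\xi=-\frac{1}{2\eta^{24}}\big(\frac{\omega_A}{2\pi i}\big)^5E_4$. For $g\ge2$, $F_g$ is sought in the form $F_g=(\xi/E_4)^{2g-2}P_g(E_2,E_4,E_6)$ with $P_g=\sum_{k=0}^{3(g-1)}\big(\sum_{4a+6b+2k=14(g-1)}C_{a,b,k}E_4^aE_6^b\big)E_2^k$, $C_{a,b,k}\in\mathbb C$; $\partial F_g/\partial E_2$ means $(\xi/E_4)^{2g-2}\,\partial_{E_2}P_g$ (differentiating the polynomial $P_g$ in its first argument). Then $\nu^{2g-2}F_g$ depends only on $q$ and is expanded as a power series in $q$. $\mathcal M_k$ is the space of $\mathrm{SL}_2(\mathbb Z)$ modular forms of weight $k$; $B_{2g}$ are Bernoulli numbers. *)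

theory Defs
  imports "HOL-Analysis.Analysis" "HOL-Library.Landau_Symbols" "HOL-Library.Function_Algebras"
begin

fun bernoulli :: "nat \<Rightarrow> real" where
  "bernoulli n = (if n = 0 then 1
     else - (1 / real (n + 1)) * (\<Sum>k<n. real ((n + 1) choose k) * bernoulli k))"

definition tpi :: complex where "tpi = 2 * of_real pi * \<i>"

definition eis :: "nat \<Rightarrow> complex \<Rightarrow> complex" where
  "eis n q = 1 - of_real (4 * real n / bernoulli (2 * n)) *
     (\<Sum>k. of_nat (Suc k) ^ (2 * n - 1) * q ^ Suc k / (1 - q ^ Suc k))"

abbreviation "E2 \<equiv> eis 1"
abbreviation "E4 \<equiv> eis 2"
abbreviation "E6 \<equiv> eis 3"

text \<open>eta(q)^24 = q prod_{k>=1} (1-q^k)^24 (only the 24th power of eta occurs)\<close>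
definition eta24 :: "complex \<Rightarrow> complex" where
  "eta24 q = q * (\<Prod>k. (1 - q ^ Suc k)) ^ 24"

definition g2 :: "complex \<Rightarrow> complex \<Rightarrow> complex" where
  "g2 w q = 4 * of_real pi ^ 4 / (3 * w ^ 4) * E4 q"

definition g3 :: "complex \<Rightarrow> complex \<Rightarrow> complex" where
  "g3 w q = 8 * of_real pi ^ 6 / (27 * w ^ 6) * E6 q"

definition tt :: "complex \<Rightarrow> complex \<Rightarrow> complex" where
  "tt w q = - g2 w q / 2"

definition Delta :: "complex \<Rightarrow> complex \<Rightarrow> complex" where
  "Delta w q = g2 w q ^ 3 - 27 * g3 w q ^ 2"

definition nu :: "complex \<Rightarrow> complex \<Rightarrow> complex" where
  "nu w q = (tpi / w) ^ 5 * (E6 q - E2 q * E4 q) / 360"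

definition xi :: "complex \<Rightarrow> complex \<Rightarrow> complex" where
  "xi w q = - 1 / (2 * eta24 q) * (w / tpi) ^ 5 * E4 q"

section \<open>Derivative in nu at fixed t (chain rule in the coordinates (omega_A, q))\<close>

definition Dw :: "(complex \<Rightarrow> complex \<Rightarrow> complex) \<Rightarrow> complex \<Rightarrow> complex \<Rightarrow> complex" where
  "Dw G w q = deriv (\<lambda>v. G v q) w"

definition Dq :: "(complex \<Rightarrow> complex \<Rightarrow> complex) \<Rightarrow> complex \<Rightarrow> complex \<Rightarrow> complex" where
  "Dq G w q = deriv (\<lambda>z. G w z) q"

definition jac :: "complex \<Rightarrow> complex \<Rightarrow> complex" where
  "jac w q = Dw nu w q * Dq tt w q - Dq nu w q * Dw tt w q"

definition dnu :: "(complex \<Rightarrow> complex \<Rightarrow> complex) \<Rightarrow> complex \<Rightarrow> complex \<Rightarrow> complex" where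
  "dnu G w q = (Dw G w q * Dq tt w q - Dq G w q * Dw tt w q) / jac w q"

definition idx :: "nat \<Rightarrow> (nat \<times> nat \<times> nat) set" where
  "idx g = {(a, b, k). 4 * a + 6 * b + 2 * k = 14 * (g - 1) \<and> k \<le> 3 * (g - 1)}"

definition Ppoly :: "(nat \<Rightarrow> nat \<Rightarrow> nat \<Rightarrow> complex) \<Rightarrow> nat \<Rightarrow> complex \<Rightarrow> complex \<Rightarrow> complex \<Rightarrow> complex" where
  "Ppoly c g x2 x4 x6 = (\<Sum>(a, b, k)\<in>idx g. c a b k * x4 ^ a * x6 ^ b * x2 ^ k)"

definition dPoly :: "(nat \<Rightarrow> nat \<Rightarrow> nat \<Rightarrow> complex) \<Rightarrow> nat \<Rightarrow> complex \<Rightarrow> complex \<Rightarrow> complex \<Rightarrow> complex" where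
  "dPoly c g x2 x4 x6 = (\<Sum>(a, b, k)\<in>idx g. of_nat k * c a b k * x4 ^ a * x6 ^ b * x2 ^ (k - 1))"

definition Fg :: "(nat \<Rightarrow> nat \<Rightarrow> nat \<Rightarrow> nat \<Rightarrow> complex) \<Rightarrow> nat \<Rightarrow> complex \<Rightarrow> complex \<Rightarrow> complex" where
  "Fg C g w q = (xi w q / E4 q) ^ (2 * g - 2) * Ppoly (C g) g (E2 q) (E4 q) (E6 q)"

definition dFg_dE2 :: "(nat \<Rightarrow> nat \<Rightarrow> nat \<Rightarrow> nat \<Rightarrow> complex) \<Rightarrow> nat \<Rightarrow> complex \<Rightarrow> complex \<Rightarrow> complex" where
  "dFg_dE2 C g w q = (xi w q / E4 q) ^ (2 * g - 2) * dPoly (C g) g (E2 q) (E4 q) (E6 q)"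

definition F1 :: "complex \<Rightarrow> complex \<Rightarrow> complex" where
  "F1 w q = - (1 / 12) * Ln (w ^ 6 * Delta w q)"

definition Fnu :: "(nat \<Rightarrow> nat \<Rightarrow> nat \<Rightarrow> nat \<Rightarrow> complex) \<Rightarrow> nat \<Rightarrow> complex \<Rightarrow> complex \<Rightarrow> complex" where
  "Fnu C h = (if h = 1 then dnu F1 else dnu (Fg C h))"

text \<open>Open region of (omega_A, q) where all quantities are holomorphic, (t,nu) are local
  coordinates, and the principal branch of the logarithm in F_1 is holomorphic.\<close>
definition region :: "(complex \<times> complex) set" where
  "region = {(w, q). w \<noteq> 0 \<and> 0 < norm q \<and> norm q < 1 \<and> E4 q \<noteq> 0 \<and> jac w q \<noteq> 0
      \<and> w ^ 6 * Delta w q \<notin> complex_of_real ` {..0}}"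

definition HAE :: "(nat \<Rightarrow> nat \<Rightarrow> nat \<Rightarrow> nat \<Rightarrow> complex) \<Rightarrow> nat \<Rightarrow> bool" where
  "HAE C g \<longleftrightarrow> (\<forall>(w, q)\<in>region.
     dFg_dE2 C g w q = - (1 / 24) * (dnu (Fnu C (g - 1)) w q
        + (\<Sum>h = 1..g - 1. Fnu C h w q * Fnu C (g - h) w q)))"

text \<open>Modular forms of weight k for SL2(Z), as functions on the upper half plane
  (extended by 0 off it, so that the space is a genuine space of functions).\<close>
definition modforms :: "nat \<Rightarrow> (complex \<Rightarrow> complex) set" where
  "modforms k = {f. f holomorphic_on {z. 0 < Im z}
     \<and> (\<forall>z. Im z \<le> 0 \<longrightarrow> f z = 0)
     \<and> (\<forall>a b c d :: int. a * d - b * c = 1 \<longrightarrow> (\<forall>z. 0 < Im z \<longrightarrow>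
          f ((of_int a * z + of_int b) / (of_int c * z + of_int d))
            = (of_int c * z + of_int d) ^ k * f z))
     \<and> (\<exists>B. \<forall>z. 1 \<le> Im z \<longrightarrow> norm (f z) \<le> B)}"

definition dimM :: "nat \<Rightarrow> nat" where
  "dimM k = Vector_Spaces.vector_space.dim (\<lambda>(c::complex) (f::complex \<Rightarrow> complex). (\<lambda>z. c * f z)) (modforms k)"

definition kappa :: "nat \<Rightarrow> complex" where
  "kappa g = of_real (bernoulli (2 * g) / (4 * real g * (real g - 1)))"

definition gap :: "(nat \<Rightarrow> nat \<Rightarrow> nat \<Rightarrow> nat \<Rightarrow> complex) \<Rightarrow> nat \<Rightarrow> bool" where
  "gap C g \<longleftrightarrow> (\<forall>w. w \<noteq> 0 \<longrightarrow>
     (\<lambda>q. nu w q ^ (2 * g - 2) * Fg C g w q - kappa g) \<in> O[at 0](\<lambda>q. q ^ dimM (14 * (g - 1))))"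

end

theory Submission
  imports Defs "HOL-Complex_Analysis.Complex_Analysis"
begin

text \<open>
  In the coordinates \<open>(w, q)\<close> one finds \<open>\<partial>/\<partial>\<nu> = \<xi> (q \<partial>\<^sub>q + (E2 E4 - E6) / (12 E4) w \<partial>\<^sub>w)\<close>. Applied to
  \<open>(\<xi>/E4)^n R(q)\<close> with \<open>R\<close> a polynomial in \<open>E2, E4, E6\<close> this gives \<open>(\<xi>/E4)^(n+1)\<close> times another
  such polynomial, by Ramanujan's identities, so the anomaly equation is a polynomial identity that
  fixes all of \<open>P\<^sub>g\<close> except its part of degree 0 in \<open>E2\<close>, a modular form of weight \<open>14 (g - 1)\<close>.
  Since \<open>\<nu> \<xi>/E4\<close> is a power series in \<open>q\<close> alone with constant term 1, the gap condition prescribes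
  the first \<open>dim M\<close> Taylor coefficients of that form, and these determine it uniquely: a form
  \<open>F\<close> of weight \<open>k\<close> with a zero of order \<open>N > k/12\<close> at the cusp vanishes because \<open>F^12 / \<eta>^(24 k)\<close> is a
  form of weight 0 that vanishes at the cusp.

  The modularity of \<open>E4, E6, \<eta>^24\<close> and the quasimodularity of \<open>E2\<close> come from lattice sums, via the
  partial fractions of the cotangent.
\<close>

section \<open>Double series and Lambert series\<close>

text \<open>The borderline of the vanishing criterion shapes the proof. In weight 14, the case
  \<open>g = 2\<close>, the dimension is 1, so a single coefficient has to suffice although 14 > 12
  and the bound \<open>N > k/12\<close> fails. The same happens in every weight congruent to 2
  modulo 12; there the question is reduced to the absence of nonzero forms of weight two.

  Each level is solvable because the degrees fit: a derivative in \<nu> adds 6 to the weight and at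
  most 1 to the degree in E2, so the right-hand side has weight 14 (g - 1) - 2 and degree at most 3
  (g - 1) - 1, the same bounds as for the E2-derivative of \<open>P_g\<close>. The equation is
  between functions while the unknowns are coefficients; algebraic independence of E2, E4, E6
  bridges the two.

  The lattice sums of weights 4 and 6 enter only up to scale. Modularity of E4 and E6 in the
  Bernoulli normalisation comes out of Ramanujan's identities, which in turn rest on the
  quasimodularity of E2 and on the vanishing of small-weight forms that vanish at the cusp. The
  maximum modulus principle stands in for the valence formula.\<close>

lemma double_suminf:
  fixes a :: "nat \<Rightarrow> nat \<Rightarrow> complex"
  assumes le: "\<And>m n. norm (a m n) \<le> b m n" and b: "\<And>m. b m sums S m" and S: "summable S"
  shows "summable (\<lambda>m. \<Sum>n. a m n)"
    and "(\<Sum>m. \<Sum>n. a m n) = (\<Sum>n. \<Sum>m. a m n)"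
    and "summable (\<lambda>n. \<Sum>m. a m n)"
proof -
  have b0: "0 \<le> b m n" for m n
    using le[of m n] norm_ge_zero[of "a m n"] by linarith
  have S0: "0 \<le> S m" for m
    using b[of m] b0 by (metis sums_unique suminf_nonneg sums_summable)
  have "(\<lambda>(m, n). b m n) summable_on UNIV \<times> UNIV"
    using b b0 S S0
    by (intro summable_on_SigmaI[where g = S])
       (auto intro!: sums_nonneg_imp_has_sum norm_summable_imp_summable_on)
  then have A: "Infinite_Sum.abs_summable_on (\<lambda>(m, n). a m n) (UNIV \<times> UNIV)"
    by (rule Infinite_Sum.abs_summable_on_comparison_test') (use le in auto)
  then have B: "Infinite_Sum.abs_summable_on (\<lambda>(n, m). a m n) (UNIV \<times> UNIV)"
    using summable_on_swap[of "\<lambda>(m, n). norm (a m n)" UNIV UNIV] by (simp add: case_prod_unfold)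
  have row: "Infinite_Sum.abs_summable_on (a m) UNIV" for m
    using A unfolding Infinite_Sum.abs_summable_on_Sigma_iff by (auto simp del: UNIV_Times_UNIV)
  have col: "Infinite_Sum.abs_summable_on (\<lambda>m. a m n) UNIV" for n
    using B unfolding Infinite_Sum.abs_summable_on_Sigma_iff by (auto simp del: UNIV_Times_UNIV)
  have to_suminf: "infsum f UNIV = suminf f" if "Infinite_Sum.abs_summable_on f UNIV" for f :: "nat \<Rightarrow> complex"
    using that by (metis abs_summable_summable has_sum_imp_sums has_sum_infsum sums_unique)
  have R: "(\<lambda>m. \<Sum>n. a m n) summable_on UNIV"
    using summable_on_Sigma_banach[of a UNIV "\<lambda>_. UNIV"] abs_summable_summable[OF A]
    by (simp add: to_suminf[OF row])
  have C: "(\<lambda>n. \<Sum>m. a m n) summable_on UNIV"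
    using summable_on_Sigma_banach[of "\<lambda>n m. a m n" UNIV "\<lambda>_. UNIV"] abs_summable_summable[OF B]
    by (simp add: to_suminf[OF col])
  show "summable (\<lambda>m. \<Sum>n. a m n)" "summable (\<lambda>n. \<Sum>m. a m n)"
    by (fact summable_on_imp_summable[OF R] summable_on_imp_summable[OF C])+
  have "infsum (\<lambda>m. infsum (\<lambda>n. a m n) UNIV) UNIV = infsum (\<lambda>n. infsum (\<lambda>m. a m n) UNIV) UNIV"
    by (rule infsum_swap_banach[OF abs_summable_summable[OF A]])
  then have "infsum (\<lambda>m. \<Sum>n. a m n) UNIV = infsum (\<lambda>n. \<Sum>m. a m n) UNIV"
    by (simp add: to_suminf[OF row] to_suminf[OF col])
  moreover have "infsum (\<lambda>m. \<Sum>n. a m n) UNIV = (\<Sum>m. \<Sum>n. a m n)"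
    using R by (metis has_sum_imp_sums has_sum_infsum sums_unique)
  moreover have "infsum (\<lambda>n. \<Sum>m. a m n) UNIV = (\<Sum>n. \<Sum>m. a m n)"
    using C by (metis has_sum_imp_sums has_sum_infsum sums_unique)
  ultimately show "(\<Sum>m. \<Sum>n. a m n) = (\<Sum>n. \<Sum>m. a m n)" by simp
qed

lemma summable_nat_power_geometric:
  fixes z :: "'a::{real_normed_field,banach}"
  assumes "norm z < 1"
  shows "summable (\<lambda>n. of_nat n ^ s * z ^ n)"
  using assms
proof (induction s arbitrary: z)
  case 0
  then show ?case by (simp add: summable_geometric)
next
  case (Suc s)
  have "summable (\<lambda>n. diffs (\<lambda>n. of_nat n ^ s) n * z ^ n)"
    by (rule termdiff_converges[OF Suc.prems Suc.IH])
  then have "summable (\<lambda>n. z * (diffs (\<lambda>n. of_nat n ^ s) n * z ^ n))"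
    by (rule summable_mult)
  also have "(\<lambda>n. z * (diffs (\<lambda>n. of_nat n ^ s) n * z ^ n)) = (\<lambda>n. of_nat (Suc n) ^ Suc s * z ^ Suc n)"
    by (simp add: diffs_def mult_ac fun_eq_iff)
  finally show ?case by (subst (asm) summable_Suc_iff)
qed

lemma summable_Suc_power_geometric:
  fixes z :: "'a::{real_normed_field,banach}"
  assumes "norm z < 1"
  shows "summable (\<lambda>n. of_nat (Suc n) ^ s * z ^ n)"
proof (cases "z = 0")
  case True
  have "summable (\<lambda>n. of_nat (Suc n) ^ s * (0::'a) ^ n)"
    by (rule summable_finite[of "{0}"]) auto
  then show ?thesis using True by simp
next
  case False
  have "summable (\<lambda>n. of_nat (Suc n) ^ s * z ^ Suc n)"
    using summable_nat_power_geometric[OF assms, of s] by (subst summable_Suc_iff)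
  then have "summable (\<lambda>n. of_nat (Suc n) ^ s * z ^ Suc n / z)"
    by (rule summable_divide)
  then show ?thesis using False by simp
qed

text \<open>This is the polylogarithm of order \<open>- s\<close>, except that
  \<open>0 ^ 0 = 1\<close> contributes a constant 1 when \<open>s = 0\<close>.\<close>

definition powsum :: "nat \<Rightarrow> complex \<Rightarrow> complex" where
  "powsum s z = (\<Sum>n. of_nat n ^ s * z ^ n)"

lemma has_field_derivative_powsum:
  assumes "norm z < 1" "z \<noteq> 0"
  shows "(powsum s has_field_derivative powsum (Suc s) z / z) (at z)"
proof -
  have D: "(powsum s has_field_derivative (\<Sum>n. diffs (\<lambda>n. of_nat n ^ s) n * z ^ n)) (at z)"
    unfolding powsum_def
    by (rule termdiffs_strong'[of 1]) (use assms summable_nat_power_geometric in auto)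
  have "powsum (Suc s) z = (\<Sum>n. of_nat (Suc n) ^ Suc s * z ^ Suc n)"
    unfolding powsum_def
    by (subst suminf_split_head[OF summable_nat_power_geometric]) (use assms in auto)
  also have "\<dots> = (\<Sum>n. z * (diffs (\<lambda>n. of_nat n ^ s) n * z ^ n))"
    by (simp add: diffs_def mult_ac)
  also have "\<dots> = z * (\<Sum>n. diffs (\<lambda>n. of_nat n ^ s) n * z ^ n)"
    using assms(1) by (intro suminf_mult termdiff_converges[of _ 1])
      (auto intro: summable_nat_power_geometric)
  finally show ?thesis using D assms by simp
qed

lemma powsum_1: assumes "norm z < 1" shows "powsum 1 z = z / (1 - z)\<^sup>2"
proof (cases "z = 0")
  case True
  then show ?thesis
    by (auto simp: powsum_def intro!: sums_unique[symmetric] sums_zero[THEN sums_cong[THEN iffD1, rotated]])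
next
  case False
  have z1: "z \<noteq> 1" using assms by auto
  have "(powsum 0 has_field_derivative powsum 1 z / z) (at z)"
    using has_field_derivative_powsum[OF assms False, of 0] by simp
  moreover have "(powsum 0 has_field_derivative 1 / (1 - z)\<^sup>2) (at z)"
  proof (rule has_field_derivative_transform_within_open[of "\<lambda>z. 1 / (1 - z)" _ _ "ball 0 1"])
    show "((\<lambda>z. 1 / (1 - z)) has_field_derivative 1 / (1 - z)\<^sup>2) (at z)"
      using z1 by (auto intro!: derivative_eq_intros simp: power2_eq_square divide_simps)
  qed (use assms in \<open>auto simp: powsum_def suminf_geometric divide_inverse\<close>)
  ultimately show ?thesis
    using DERIV_unique False by (fastforce simp: field_simps)
qed

text \<open>One factor \<open>q\<close> is split off the usual Lambert series, so that the value at
  0 is 1 and the first two Taylor coefficients of the Eisenstein series can be read off.\<close>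

definition lambert :: "nat \<Rightarrow> complex \<Rightarrow> complex" where
  "lambert s q = (\<Sum>k. of_nat (Suc k) ^ s * q ^ k / (1 - q ^ Suc k))"

lemma norm_one_minus_power_ge:
  fixes q :: complex
  assumes "norm q \<le> r" "r < 1"
  shows "1 - r \<le> norm (1 - q ^ Suc k)"
proof -
  have r0: "0 \<le> r" using assms(1) norm_ge_zero[of q] by linarith
  have "norm (q ^ Suc k) \<le> r ^ Suc k"
    unfolding norm_power by (rule power_mono) (use assms in auto)
  also have "\<dots> \<le> r ^ 1" by (rule power_decreasing) (use assms r0 in auto)
  finally have "1 - r \<le> norm (1::complex) - norm (q ^ Suc k)" by simp
  also have "\<dots> \<le> norm (1 - q ^ Suc k)" by (rule norm_triangle_ineq2)
  finally show ?thesis .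
qed

lemma norm_lambert_term_le:
  fixes q :: complex
  assumes "norm q \<le> r" "r < 1"
  shows "norm (of_nat (Suc k) ^ s * q ^ k / (1 - q ^ Suc k)) \<le> of_nat (Suc k) ^ s * r ^ k / (1 - r)"
proof -
  have "norm q ^ k \<le> r ^ k" by (rule power_mono) (use assms in auto)
  then have "norm (of_nat (Suc k) ^ s * q ^ k) \<le> of_nat (Suc k) ^ s * r ^ k"
    by (simp add: norm_mult norm_power mult_left_mono del: of_nat_Suc)
  then show ?thesis
    unfolding norm_divide
    using norm_one_minus_power_ge[OF assms, of k] assms
    by (intro frac_le) (auto intro: order_trans[OF norm_ge_zero])
qed

lemma summable_lambert_bound:
  assumes "0 \<le> r" "r < 1"
  shows "summable (\<lambda>k. real (Suc k) ^ s * r ^ k / (1 - r))"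
  by (rule summable_divide[OF summable_Suc_power_geometric]) (use assms in auto)

lemma summable_lambert:
  fixes q :: complex
  assumes "norm q < 1"
  shows "summable (\<lambda>k. of_nat (Suc k) ^ s * q ^ k / (1 - q ^ Suc k))"
  by (rule summable_comparison_test'[OF summable_lambert_bound[of "norm q" s]])
     (use assms norm_lambert_term_le[of q "norm q"] in auto)

lemma one_minus_power_nonzero:
  fixes q :: complex
  assumes "norm q < 1"
  shows "1 - q ^ Suc k \<noteq> 0"
  using norm_one_minus_power_ge[OF order_refl assms, of k] assms by auto

lemma cball_in_unit_ball:
  fixes x :: complex
  assumes "x \<in> ball 0 1"
  obtains d r where "0 < d" "cball x d \<subseteq> ball 0 1" "0 \<le> r" "r < 1" "\<And>y. y \<in> cball x d \<Longrightarrow> norm y \<le> r"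
proof
  define d where "d = (1 - norm x) / 2"
  show "0 < d" "0 \<le> norm x + d" "norm x + d < 1" using assms by (auto simp: d_def field_simps)
  show n: "norm y \<le> norm x + d" if "y \<in> cball x d" for y
    using that norm_triangle_ineq[of x "y - x"] by (auto simp: dist_norm norm_minus_commute)
  show "cball x d \<subseteq> ball 0 1" using n \<open>norm x + d < 1\<close> by force
qed

lemma holomorphic_lambert: "lambert s holomorphic_on ball 0 1"
proof (rule holomorphic_uniform_sequence)
  show "(\<lambda>q. \<Sum>k<n. of_nat (Suc k) ^ s * q ^ k / (1 - q ^ Suc k)) holomorphic_on ball 0 1" for n
    by (intro holomorphic_intros) (use one_minus_power_nonzero in auto)
  fix x :: complex assume "x \<in> ball 0 1"
  then obtain d r where dr: "0 < d" "cball x d \<subseteq> ball 0 1" "0 \<le> r" "r < 1"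
    "\<And>y. y \<in> cball x d \<Longrightarrow> norm y \<le> r"
    by (rule cball_in_unit_ball) blast
  have "uniform_limit (cball x d) (\<lambda>n q. \<Sum>k<n. of_nat (Suc k) ^ s * q ^ k / (1 - q ^ Suc k)) (lambert s) sequentially"
    unfolding lambert_def
    by (rule Weierstrass_m_test[where M = "\<lambda>k. real (Suc k) ^ s * r ^ k / (1 - r)"])
       (use dr norm_lambert_term_le[of _ r] summable_lambert_bound in auto)
  then show "\<exists>d>0. cball x d \<subseteq> ball 0 1 \<and> uniform_limit (cball x d)
      (\<lambda>n q. \<Sum>k<n. of_nat (Suc k) ^ s * q ^ k / (1 - q ^ Suc k)) (lambert s) sequentially"
    using dr by blast
qed (rule open_ball)

lemma lambert_0: "lambert s 0 = 1"
proof -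
  have "(\<lambda>k. of_nat (Suc k) ^ s * 0 ^ k / (1 - 0 ^ Suc k)) sums (\<Sum>k\<in>{0}. of_nat (Suc k) ^ s * (0::complex) ^ k / (1 - 0 ^ Suc k))"
    by (rule sums_finite) auto
  then show ?thesis by (simp add: lambert_def sums_iff)
qed

text \<open>Expanding \<open>1 / (1 - q ^ Suc k)\<close> geometrically gives a double series;
  summing over \<open>k\<close> first leaves a polylogarithm at each \<open>q ^ Suc m\<close>, the
  shape in which Lipschitz's formula evaluates the rows of a lattice sum.\<close>

lemma lambert_conv_powsum:
  assumes q: "norm q < 1" and "s > 0"
  shows "q * lambert s q = (\<Sum>m. powsum s (q ^ Suc m))"
    and "summable (\<lambda>m. powsum s (q ^ Suc m))"
proof -
  define a where "a = (\<lambda>k m. of_nat (Suc k) ^ s * (q ^ Suc k) ^ Suc m :: complex)"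
  define b where "b = (\<lambda>k m. real (Suc k) ^ s * (norm q ^ Suc k) ^ Suc m)"
  define S where "S = (\<lambda>k. real (Suc k) ^ s * (norm q ^ Suc k / (1 - norm q ^ Suc k)))"
  have le: "norm (a k m) \<le> b k m" for k m
    by (simp add: a_def b_def norm_mult norm_power del: of_nat_Suc power_Suc)
  have lt: "norm q ^ Suc k < 1" for k
    using q by (metis norm_ge_zero power_Suc_less_one less_eq_real_def power_0_Suc zero_less_one)
  have geo: "(\<lambda>m. x ^ Suc m) sums (x / (1 - x))" if "norm x < 1" for x :: "'a::{real_normed_field,banach}"
    using sums_mult[OF geometric_sums[OF that], of x] by (simp add: field_simps)
  have b: "b k sums S k" for k
    unfolding b_def S_def by (intro sums_mult geo) (use lt[of k] in auto)
  have S: "summable S"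
  proof (rule summable_comparison_test'[OF summable_mult[OF summable_lambert_bound[of "norm q" s], of "norm q"]])
    fix k
    have "1 - norm q \<le> 1 - norm q ^ Suc k"
      using q power_decreasing[of 1 "Suc k" "norm q"] by auto
    then have "norm q ^ Suc k / (1 - norm q ^ Suc k) \<le> norm q ^ Suc k / (1 - norm q)"
      using q by (intro divide_left_mono) auto
    then have "S k \<le> real (Suc k) ^ s * (norm q ^ Suc k / (1 - norm q))"
      unfolding S_def by (rule mult_left_mono) auto
    moreover have "0 \<le> S k" unfolding S_def using lt[of k] by (auto intro!: mult_nonneg_nonneg divide_nonneg_nonneg simp del: power_Suc)
    ultimately show "norm (S k) \<le> norm q * (real (Suc k) ^ s * norm q ^ k / (1 - norm q))"
      by (simp add: field_simps)
  qed (use q in auto)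
  note D = double_suminf[OF le b S]
  have "norm (q ^ Suc k) < 1" for k using lt[of k] by (simp add: norm_power del: power_Suc)
  then have row: "(\<Sum>m. a k m) = of_nat (Suc k) ^ s * (q ^ Suc k / (1 - q ^ Suc k))" for k
    unfolding a_def by (intro sums_unique[symmetric] sums_mult geo)
  have col: "(\<Sum>k. a k m) = powsum s (q ^ Suc m)" for m
  proof -
    have "norm (q ^ Suc m) < 1" using lt[of m] by (simp add: norm_power del: power_Suc)
    then have "powsum s (q ^ Suc m) = (\<Sum>k. of_nat (Suc k) ^ s * (q ^ Suc m) ^ Suc k)"
      unfolding powsum_def using \<open>s > 0\<close>
      by (subst suminf_split_head[OF summable_nat_power_geometric]) (auto simp: zero_power)
    then show ?thesis unfolding a_def
      by (simp only: power_mult[symmetric] mult.commute)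
  qed
  show "summable (\<lambda>m. powsum s (q ^ Suc m))" using D(3) by (simp only: col)
  have "q * lambert s q = (\<Sum>k. q * (of_nat (Suc k) ^ s * q ^ k / (1 - q ^ Suc k)))"
    unfolding lambert_def by (rule suminf_mult[OF summable_lambert[OF q], symmetric])
  also have "\<dots> = (\<Sum>k. \<Sum>m. a k m)"
    by (simp only: row) (simp add: mult_ac)
  also have "\<dots> = (\<Sum>m. powsum s (q ^ Suc m))"
    unfolding D(2) by (simp only: col)
  finally show "q * lambert s q = (\<Sum>m. powsum s (q ^ Suc m))" .
qed

section \<open>The cotangent and Lipschitz formulas\<close>

definition nome :: "complex \<Rightarrow> complex" where
  "nome z = exp (tpi * z)"

lemma tpi_nonzero [simp]: "tpi \<noteq> 0"
  by (simp add: tpi_def)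

lemma norm_nome: "norm (nome z) = exp (- 2 * pi * Im z)"
  by (simp add: nome_def tpi_def norm_exp_eq_Re)

lemma norm_nome_less: "0 < Im z \<Longrightarrow> norm (nome z) < 1"
  by (simp add: norm_nome)

lemma nome_nonzero [simp]: "nome z \<noteq> 0"
  by (simp add: nome_def)

lemma nome_mult_of_nat: "nome (of_nat n * z) = nome z ^ n"
  by (simp add: nome_def exp_of_nat_mult[symmetric] mult_ac)

lemma has_field_derivative_nome: "(nome has_field_derivative tpi * nome z) (at z)"
  unfolding nome_def by (auto intro!: derivative_eq_intros)

lemma upper_not_Ints: "0 < Im z \<Longrightarrow> z \<notin> \<int>"
  using complex_is_Int_iff by force

lemma sin_upper_nonzero:
  assumes "0 < Im z" shows "sin (of_real pi * z) \<noteq> 0"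
proof
  assume "sin (of_real pi * z) = 0"
  then obtain n :: int where "of_real pi * z = of_real (of_int n * pi)"
    by (auto simp: sin_eq_0)
  then have "Im (of_real pi * z) = 0" by (metis Im_complex_of_real)
  then show False using assms by simp
qed

lemma open_upper: "open {z::complex. 0 < Im z}"
  by (rule open_halfspace_Im_gt)

lemma one_plus_minus_upper:
  assumes "0 < Im z"
  shows "1 + z \<notin> \<int>\<^sub>\<le>\<^sub>0" "1 - z \<notin> \<int>\<^sub>\<le>\<^sub>0" "1 + z \<noteq> 0" "1 - z \<noteq> 0" "z \<noteq> 0"
proof -
  have "1 + z \<notin> \<int>" "1 - z \<notin> \<int>"
    using assms by (auto simp: complex_is_Int_iff)
  then show "1 + z \<notin> \<int>\<^sub>\<le>\<^sub>0" "1 - z \<notin> \<int>\<^sub>\<le>\<^sub>0"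
    using nonpos_Ints_subset_Ints by auto
  show "1 + z \<noteq> 0" "1 - z \<noteq> 0" "z \<noteq> 0" using assms by (auto simp: complex_eq_iff)
qed

text \<open>Logarithmic derivative of the reflection formula, taken with \<open>rGamma\<close>,
  which is entire, so that both sides can be differentiated directly.\<close>

lemma Digamma_reflection_upper:
  assumes "0 < Im z"
  shows "Digamma (1 - z) - Digamma z = of_real pi * cot (of_real pi * z)"
proof -
  have z: "z \<notin> \<int>\<^sub>\<le>\<^sub>0" "1 - z \<notin> \<int>\<^sub>\<le>\<^sub>0"
    using upper_not_Ints[of z] one_plus_minus_upper[OF assms] assms nonpos_Ints_subset_Ints by auto
  let ?s = "sin (of_real pi * z)"
  have refl: "rGamma w * rGamma (1 - w) = sin (of_real pi * w) / of_real pi" for w :: complex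
    by (rule rGamma_reflection_complex)
  have "((\<lambda>w. rGamma w * rGamma (1 - w)) has_field_derivative
      rGamma z * rGamma (1 - z) * (Digamma (1 - z) - Digamma z)) (at z)"
    using z by (auto intro!: derivative_eq_intros simp: algebra_simps)
  moreover have "((\<lambda>w. sin (of_real pi * w) / of_real pi) has_field_derivative cos (of_real pi * z)) (at z)"
    by (auto intro!: derivative_eq_intros)
  ultimately have "?s / of_real pi * (Digamma (1 - z) - Digamma z) = cos (of_real pi * z)"
    unfolding refl by (rule DERIV_unique)
  then show ?thesis
    using sin_upper_nonzero[OF assms] by (simp add: cot_def field_simps)
qed

text \<open>The Digamma series at \<open>1 - z\<close> and \<open>1 + z\<close> share the harmonic
  terms and Euler's constant, which cancel in the difference.\<close>

lemma cot_partial_fractions: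
  assumes "0 < Im z"
  shows "(\<lambda>m. 1 / (z + of_nat (Suc m)) + 1 / (z - of_nat (Suc m))) sums (of_real pi * cot (of_real pi * z) - 1 / z)"
proof -
  note nz = one_plus_minus_upper[OF assms]
  have D: "(\<lambda>k. inverse (of_nat (Suc k)) - inverse (w + of_nat k)) sums (Digamma w + euler_mascheroni)"
    if "w \<noteq> 0" for w :: complex
    using summable_sums[OF summable_Digamma[OF that]] by (simp add: Digamma_def)
  have "(\<lambda>k. (inverse (of_nat (Suc k)) - inverse ((1 - z) + of_nat k)) - (inverse (of_nat (Suc k)) - inverse ((1 + z) + of_nat k)))
      sums ((Digamma (1 - z) + euler_mascheroni) - (Digamma (1 + z) + euler_mascheroni))"
    by (intro sums_diff D) (use nz in auto)
  moreover have "Digamma (1 + z) = Digamma z + 1 / z"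
    using Digamma_plus1[of z] nz by (simp add: add.commute)
  then have "(Digamma (1 - z) + euler_mascheroni) - (Digamma (1 + z) + euler_mascheroni) = of_real pi * cot (of_real pi * z) - 1 / z"
    unfolding Digamma_reflection_upper[OF assms, symmetric] by simp
  ultimately have "(\<lambda>k. inverse ((1 + z) + of_nat k) - inverse ((1 - z) + of_nat k)) sums (of_real pi * cot (of_real pi * z) - 1 / z)"
    by simp
  moreover have "inverse ((1 + z) + of_nat k) - inverse ((1 - z) + of_nat k) = 1 / (z + of_nat (Suc k)) + 1 / (z - of_nat (Suc k))" for k
  proof -
    have "inverse ((1 - z) + of_nat k) = - (1 / (z - of_nat (Suc k)))"
    proof -
      have "(1 - z) + of_nat k = - (z - of_nat (Suc k))" by simp
      then show ?thesis by (simp only: divide_minus_right inverse_eq_divide)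
    qed
    then show ?thesis by (simp add: inverse_eq_divide add_ac)
  qed
  ultimately show ?thesis by simp
qed

lemma cot_nome:
  assumes "0 < Im z"
  shows "cot (of_real pi * z) = \<i> * (nome z + 1) / (nome z - 1)"
    and "1 / sin (of_real pi * z) ^ 2 = - 4 * nome z / (1 - nome z)\<^sup>2"
proof -
  define e where "e = exp (\<i> * (of_real pi * z))"
  have e: "e \<noteq> 0" by (simp add: e_def)
  have n: "nome z = e\<^sup>2"
    by (simp add: nome_def e_def tpi_def exp_double[symmetric] mult_ac)
  have s: "sin (of_real pi * z) = - \<i> * (e - 1 / e) / 2"
    by (simp add: sin_exp_eq e_def exp_minus field_simps)
  have c: "cos (of_real pi * z) = (e + 1 / e) / 2"
    by (simp add: cos_exp_eq e_def exp_minus field_simps)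
  have q: "e\<^sup>2 \<noteq> 1"
    using norm_nome_less[OF assms] n by auto
  have sn: "sin (of_real pi * z) = - \<i> * (e\<^sup>2 - 1) / (2 * e)"
    unfolding s using e by (simp add: field_simps power2_eq_square)
  have cn: "cos (of_real pi * z) = (e\<^sup>2 + 1) / (2 * e)"
    unfolding c using e by (simp add: field_simps power2_eq_square)
  show "cot (of_real pi * z) = \<i> * (nome z + 1) / (nome z - 1)"
    unfolding cot_def sn cn n using e q by (simp add: field_simps)
  show "1 / sin (of_real pi * z) ^ 2 = - 4 * nome z / (1 - nome z)\<^sup>2"
  proof -
    have "(- \<i> * (e\<^sup>2 - 1) / (2 * e))\<^sup>2 = - ((1 - e\<^sup>2)\<^sup>2 / (4 * e\<^sup>2))"
      by (simp add: power_divide power_mult_distrib power2_commute)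
    then show ?thesis unfolding sn n by simp
  qed
qed

text \<open>Both sides equal \<open>(-1) ^ n * fact (Suc n)\<close> times the sum of
  \<open>1 / (z + m) ^ (n + 2)\<close> over all integers \<open>m\<close>: the Polygamma values at
  \<open>1 + z\<close> and \<open>1 - z\<close> collect the positive and the negative
  \<open>m\<close>, the last summand is \<open>m = 0\<close>. The induction differentiates once
  more; on the right this raises the index of \<open>powsum\<close> and yields a factor
  \<open>tpi\<close>.\<close>

lemma Polygamma_nome:
  assumes "0 < Im z"
  shows "Polygamma (Suc n) (1 + z) + (-1) ^ n * Polygamma (Suc n) (1 - z) + (-1) ^ n * fact (Suc n) * inverse z ^ (n + 2)
       = tpi ^ (n + 2) * powsum (Suc n) (nome z)"
  using assms
proof (induction n arbitrary: z)
  case 0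
  note nz = one_plus_minus_upper[OF 0]
  have sn: "sin (of_real pi * z) \<noteq> 0" by (rule sin_upper_nonzero[OF 0])
  have "((\<lambda>z. Digamma (1 - z) - Digamma z) has_field_derivative - Polygamma 1 (1 - z) - Polygamma 1 z) (at z)"
    using nz upper_not_Ints[OF 0] nonpos_Ints_subset_Ints by (auto intro!: derivative_eq_intros)
  moreover have "((\<lambda>z. Digamma (1 - z) - Digamma z) has_field_derivative - (of_real pi ^ 2 / sin (of_real pi * z) ^ 2)) (at z)"
  proof (rule has_field_derivative_transform_within_open[OF _ open_upper])
    let ?s = "sin (of_real pi * z)" and ?c = "cos (of_real pi * z)" and ?p = "of_real pi :: complex"
    have "?s * ?s + ?c * ?c = 1"
      using sin_cos_squared_add[of "of_real pi * z"] by (simp add: power2_eq_square)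
    then have "(- ?s * ?p) * ?s - ?c * (?c * ?p) = - ?p"
      by algebra
    then have "?p * (((- ?s * ?p) * ?s - ?c * (?c * ?p)) / (?s * ?s)) = - (?p ^ 2 / ?s ^ 2)"
      by (simp only:) (simp add: power2_eq_square)
    moreover have "((\<lambda>z. ?p * cot (?p * z)) has_field_derivative ?p * (((- ?s * ?p) * ?s - ?c * (?c * ?p)) / (?s * ?s))) (at z)"
      unfolding cot_def by (rule derivative_eq_intros refl sn | simp)+
    ultimately show "((\<lambda>z. ?p * cot (?p * z)) has_field_derivative - (?p ^ 2 / ?s ^ 2)) (at z)"
      by simp
  qed (use 0 Digamma_reflection_upper in auto)
  ultimately have "- Polygamma 1 (1 - z) - Polygamma 1 z = - (of_real pi ^ 2 / sin (of_real pi * z) ^ 2)"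
    by (rule DERIV_unique)
  then have "Polygamma 1 (1 - z) + Polygamma 1 z = of_real pi ^ 2 / sin (of_real pi * z) ^ 2"
    by algebra
  also have "\<dots> = of_real pi ^ 2 * (- 4 * nome z / (1 - nome z)\<^sup>2)"
    unfolding cot_nome(2)[OF 0, symmetric] by simp
  also have "\<dots> = tpi ^ 2 * powsum 1 (nome z)"
    unfolding powsum_1[OF norm_nome_less[OF 0]] by (simp add: tpi_def power_mult_distrib)
  finally have "Polygamma 1 (1 - z) + Polygamma 1 z = tpi ^ 2 * powsum 1 (nome z)" .
  moreover have "Polygamma 1 (1 + z) = Polygamma 1 z - 1 / z ^ 2"
    using Polygamma_plus1[of z 1] nz by (simp add: add.commute power2_eq_square)
  ultimately show ?case by (simp add: power2_eq_square inverse_eq_divide add.commute)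
next
  case (Suc n)
  note nz = one_plus_minus_upper[OF Suc.prems]
  let ?L = "\<lambda>z. Polygamma (Suc n) (1 + z) + (-1) ^ n * Polygamma (Suc n) (1 - z) + (-1) ^ n * fact (Suc n) * inverse z ^ (n + 2)"
  have "(?L has_field_derivative Polygamma (Suc (Suc n)) (1 + z) - (-1) ^ n * Polygamma (Suc (Suc n)) (1 - z)
      - (-1) ^ n * fact (Suc n) * of_nat (n + 2) * inverse z ^ (n + 3)) (at z)"
  proof -
    have P: "(Polygamma (Suc n) has_field_derivative Polygamma (Suc (Suc n)) (1 + z)) (at (1 + z))"
      "(Polygamma (Suc n) has_field_derivative Polygamma (Suc (Suc n)) (1 - z)) (at (1 - z))"
      using nz by (auto intro: has_field_derivative_Polygamma)
    have "((\<lambda>z. Polygamma (Suc n) (1 + z)) has_field_derivative Polygamma (Suc (Suc n)) (1 + z) * 1) (at z)"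
      by (rule DERIV_chain2[where g = "\<lambda>z. 1 + z", OF P(1)]) (auto intro!: derivative_eq_intros)
    moreover have "((\<lambda>z. Polygamma (Suc n) (1 - z)) has_field_derivative Polygamma (Suc (Suc n)) (1 - z) * (- 1)) (at z)"
      by (rule DERIV_chain2[where g = "\<lambda>z. 1 - z", OF P(2)]) (auto intro!: derivative_eq_intros)
    moreover have "((\<lambda>z. inverse z ^ (n + 2)) has_field_derivative - of_nat (n + 2) * inverse z ^ (n + 3)) (at z)"
      using DERIV_power_Suc[OF DERIV_inverse[OF nz(5)], of "n + 1"]
      by (simp add: eval_nat_numeral algebra_simps)
    ultimately have "(?L has_field_derivative Polygamma (Suc (Suc n)) (1 + z) * 1
        + (-1) ^ n * (Polygamma (Suc (Suc n)) (1 - z) * (- 1)) + (-1) ^ n * fact (Suc n) * (- of_nat (n + 2) * inverse z ^ (n + 3))) (at z)"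
      by (intro DERIV_add DERIV_cmult)
    then show ?thesis by (simp only: mult_minus_left mult_minus_right mult.right_neutral mult.assoc add_uminus_conv_diff)
  qed
  moreover have "(?L has_field_derivative tpi ^ (n + 3) * powsum (Suc (Suc n)) (nome z)) (at z)"
  proof (rule has_field_derivative_transform_within_open[OF _ open_upper])
    have "((\<lambda>z. powsum (Suc n) (nome z)) has_field_derivative powsum (Suc (Suc n)) (nome z) / nome z * (tpi * nome z)) (at z)"
      by (rule DERIV_chain2[OF has_field_derivative_powsum has_field_derivative_nome])
         (use norm_nome_less[OF Suc.prems] in auto)
    then show "((\<lambda>z. tpi ^ (n + 2) * powsum (Suc n) (nome z)) has_field_derivative tpi ^ (n + 3) * powsum (Suc (Suc n)) (nome z)) (at z)"
      by (auto intro!: derivative_eq_intros simp: eval_nat_numeral)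
  qed (use Suc in auto)
  ultimately have "Polygamma (Suc (Suc n)) (1 + z) - (-1) ^ n * Polygamma (Suc (Suc n)) (1 - z)
      - (-1) ^ n * fact (Suc n) * of_nat (n + 2) * inverse z ^ (n + 3) = tpi ^ (n + 3) * powsum (Suc (Suc n)) (nome z)"
    by (rule DERIV_unique)
  moreover have "(-1) ^ n * fact (Suc n) * of_nat (n + 2) * inverse z ^ (n + 3) = (-1) ^ n * fact (Suc (Suc n)) * inverse z ^ (Suc n + 2)"
    by (simp add: eval_nat_numeral)
  ultimately show ?case by (simp add: eval_nat_numeral mult_ac)
qed

lemma lipschitz_formula:
  assumes "0 < Im z" "even k" "k \<ge> 2"
  shows "(\<lambda>m. 1 / (z + of_nat (Suc m)) ^ k + 1 / (z - of_nat (Suc m)) ^ k)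
     sums (tpi ^ k / fact (k - 1) * powsum (k - 1) (nome z) - 1 / z ^ k)"
proof -
  obtain n where k: "k = n + 2" using assms(3) by (metis add.commute le_iff_add)
  have n: "even n" using assms k by simp
  note nz = one_plus_minus_upper[OF assms(1)]
  have P: "(\<lambda>j. inverse ((w + of_nat j) ^ k)) sums (Polygamma (Suc n) w / fact (Suc n))" if "w \<noteq> 0" for w :: complex
    using Polygamma_LIMSEQ[OF that, of "Suc n"] n by (simp add: k)
  have "(\<lambda>j. inverse (((1 + z) + of_nat j) ^ k) + inverse (((1 - z) + of_nat j) ^ k))
      sums (Polygamma (Suc n) (1 + z) / fact (Suc n) + Polygamma (Suc n) (1 - z) / fact (Suc n))"
    by (intro sums_add P) (use nz in auto)
  also have "(\<lambda>j. inverse (((1 + z) + of_nat j) ^ k) + inverse (((1 - z) + of_nat j) ^ k)) =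
      (\<lambda>m. 1 / (z + of_nat (Suc m)) ^ k + 1 / (z - of_nat (Suc m)) ^ k)"
  proof
    fix m
    have "((1 - z) + of_nat m) ^ k = (z - of_nat (Suc m)) ^ k"
      using power_minus_even[of k "z - of_nat (Suc m)"] assms(2) by (simp add: algebra_simps)
    then show "inverse (((1 + z) + of_nat m) ^ k) + inverse (((1 - z) + of_nat m) ^ k) =
        1 / (z + of_nat (Suc m)) ^ k + 1 / (z - of_nat (Suc m)) ^ k"
      by (simp add: inverse_eq_divide add_ac)
  qed
  also have "Polygamma (Suc n) (1 + z) / fact (Suc n) + Polygamma (Suc n) (1 - z) / fact (Suc n)
      = (tpi ^ k * powsum (k - 1) (nome z) - fact (Suc n) * inverse z ^ k) / fact (Suc n)"
    using Polygamma_nome[OF assms(1), of n] n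
    by (simp add: k add_divide_distrib[symmetric] algebra_simps del: fact_Suc)
  also have "\<dots> = tpi ^ k / fact (k - 1) * powsum (k - 1) (nome z) - 1 / z ^ k"
    by (simp add: k diff_divide_distrib power_divide inverse_eq_divide del: fact_Suc)
  finally show ?thesis .
qed

section \<open>Lattice sums\<close>

lemma Im_minus_inverse: "0 < Im t \<Longrightarrow> 0 < Im (- 1 / t)"
  by (simp add: Im_divide power2_eq_square[symmetric] divide_pos_pos sum_power2_gt_zero_iff)

text \<open>Equivalence of norms on the plane with an explicit constant: the imaginary part controls
  \<open>x\<close>, and then the triangle inequality controls \<open>y\<close>.\<close>

lemma lattice_lower_bound:
  assumes "0 < Im t"
  obtains c where "0 < c" "\<And>x y :: real. c * (\<bar>x\<bar> + \<bar>y\<bar>) \<le> norm (of_real x * t + of_real y)"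
proof
  define C where "C = 1 / Im t + 1 + norm t / Im t"
  have C: "0 < C" unfolding C_def using assms by (intro add_pos_nonneg add_pos_pos) auto
  then show "0 < 1 / C" by simp
  fix x y :: real
  let ?N = "norm (of_real x * t + of_real y)"
  have "\<bar>x\<bar> * Im t = \<bar>Im (of_real x * t + of_real y)\<bar>" using assms by (simp add: abs_mult)
  also have "\<dots> \<le> ?N" by (rule abs_Im_le_cmod)
  finally have x: "\<bar>x\<bar> \<le> ?N / Im t" using assms by (simp add: field_simps)
  have "\<bar>y\<bar> = norm ((of_real x * t + of_real y) - of_real x * t)" by simp
  also have "\<dots> \<le> ?N + norm (of_real x * t)" by (rule norm_triangle_ineq4)
  also have "\<dots> \<le> ?N + ?N / Im t * norm t" using mult_right_mono[OF x norm_ge_zero[of t]] by (simp add: norm_mult)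
  finally have "\<bar>x\<bar> + \<bar>y\<bar> \<le> ?N * C" using x by (simp add: C_def algebra_simps)
  then show "1 / C * (\<bar>x\<bar> + \<bar>y\<bar>) \<le> ?N" using C by (simp add: field_simps)
qed

text \<open>The exponent 3 of the lattice estimate is split evenly as 3/2 + 3/2 by
  \<open>x * y \<le> (x + y) ^ 2\<close>. The majorant becomes a product, and 3/2 > 1 makes each
  factor summable.\<close>

definition quad :: "nat \<Rightarrow> real" where "quad m = 1 / sqrt (real (Suc m)) ^ 3"

lemma summable_quad: "summable quad"
proof -
  have "sqrt x ^ 3 = x powr (3 / 2)" if "0 < x" for x :: real
    using that powr_power[of x "1 / 2" 3] by (simp add: powr_half_sqrt)
  then have "quad = (\<lambda>m. real (Suc m) powr (- (3/2)))"
    by (simp add: fun_eq_iff quad_def powr_minus_divide)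
  moreover have "summable (\<lambda>m. real (Suc m) powr (- (3/2)))"
    by (subst summable_Suc_iff) (simp add: summable_real_powr_iff)
  ultimately show ?thesis by (simp only:)
qed

lemma quad_bound: "1 / (real (Suc m) + real (Suc n)) ^ 3 \<le> quad m * quad n"
proof -
  define x y where "x = real (Suc m)" and "y = real (Suc n)"
  have xy: "0 < x" "0 < y" by (auto simp: x_def y_def)
  have "x * y \<le> (x + y) ^ 2" using xy by (simp add: power2_eq_square algebra_simps)
  then have "sqrt x * sqrt y \<le> x + y" using xy by (simp add: real_sqrt_mult[symmetric] real_le_lsqrt)
  then have "(sqrt x * sqrt y) ^ 3 \<le> (x + y) ^ 3" using xy by (intro power_mono) auto
  then have "1 / (x + y) ^ 3 \<le> 1 / (sqrt x * sqrt y) ^ 3"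
    using xy by (intro divide_left_mono) auto
  then show ?thesis by (simp add: quad_def x_def y_def power_mult_distrib)
qed

lemma double_suminf_quad:
  fixes a :: "nat \<Rightarrow> nat \<Rightarrow> complex"
  assumes "\<And>m n. norm (a m n) \<le> C / (real (Suc m) + real (Suc n)) ^ 3" "0 \<le> C"
  shows "(\<Sum>m. \<Sum>n. a m n) = (\<Sum>n. \<Sum>m. a m n)"
    and "summable (\<lambda>m. \<Sum>n. a m n)"
    and "summable (\<lambda>n. \<Sum>m. a m n)"
proof -
  have le: "norm (a m n) \<le> C * quad m * quad n" for m n
    using assms(1)[of m n] mult_left_mono[OF quad_bound[of m n] assms(2)]
    by (simp add: mult.assoc del: of_nat_Suc)
  have b: "(\<lambda>n. C * quad m * quad n) sums (C * quad m * suminf quad)" for m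
    by (intro sums_mult summable_sums summable_quad)
  have S: "summable (\<lambda>m. C * quad m * suminf quad)"
    by (intro summable_mult2 summable_mult summable_quad)
  show "(\<Sum>m. \<Sum>n. a m n) = (\<Sum>n. \<Sum>m. a m n)" "summable (\<lambda>m. \<Sum>n. a m n)" "summable (\<lambda>n. \<Sum>m. a m n)"
    by (fact double_suminf[OF le b S])+
qed

text \<open>For even \<open>k\<close> opposite lattice points contribute equally, so one half of the
  lattice is enough. The points on the two axes are kept apart because they sum to zeta
  values.\<close>

definition lterm :: "nat \<Rightarrow> complex \<Rightarrow> nat \<Rightarrow> nat \<Rightarrow> complex" where
  "lterm k t m n = 1 / (of_nat (Suc m) * t + of_nat (Suc n)) ^ k + 1 / (of_nat (Suc m) * t - of_nat (Suc n)) ^ k"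

text \<open>Multiplying the lattice spanned by 1 and \<open>- 1 / t\<close> by \<open>t\<close>
  gives the lattice spanned by \<open>t\<close> and 1, with the two coordinates exchanged; hence the
  swap of \<open>m\<close> and \<open>n\<close>.\<close>

lemma lterm_inversion:
  assumes "0 < Im t" "even k"
  shows "lterm k (- 1 / t) m n = t ^ k * lterm k t n m"
proof -
  have t: "t \<noteq> 0" using assms by auto
  let ?x = "of_nat (Suc m) :: complex" and ?y = "of_nat (Suc n) :: complex"
  have eq: "?x * (- 1 / t) + ?y = (?y * t - ?x) / t" "?x * (- 1 / t) - ?y = - ((?y * t + ?x) / t)"
    using t by (simp_all add: field_simps)
  have "1 / (?x * (- 1 / t) + ?y) ^ k = t ^ k * (1 / (?y * t - ?x) ^ k)"
    by (simp only: eq power_divide) simp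
  moreover have "1 / (?x * (- 1 / t) - ?y) ^ k = t ^ k * (1 / (?y * t + ?x) ^ k)"
    by (simp only: eq power_minus_even[OF assms(2)] power_divide) simp
  ultimately show ?thesis
    by (simp only: lterm_def distrib_left add.commute)
qed

definition eis_scale :: "nat \<Rightarrow> complex" where
  "eis_scale k = tpi ^ k / fact (k - 1)"

definition zeta_sum :: "nat \<Rightarrow> complex" where
  "zeta_sum k = (\<Sum>m. 1 / of_nat (Suc m) ^ k)"

text \<open>For even \<open>k\<close> this is half of the classical \<open>G_k\<close>, the sum of
  \<open>(m * t + n) ^ (- k)\<close> over nonzero lattice points, written in the nome. For
  \<open>k = 2\<close> that sum has to be taken in Eisenstein's order, over \<open>n\<close>
  first.\<close>

definition eis_lattice :: "nat \<Rightarrow> complex \<Rightarrow> complex" where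
  "eis_lattice k q = zeta_sum k + eis_scale k * (q * lambert (k - 1) q)"

lemma summable_zeta_sum: "k \<ge> 2 \<Longrightarrow> summable (\<lambda>m. 1 / of_nat (Suc m) ^ k :: complex)"
  using inverse_power_summable[of k, where ?'a = complex]
  by (subst summable_Suc_iff) (simp add: inverse_eq_divide)

text \<open>Lipschitz's formula evaluates each row. Subtracting \<open>zeta_sum k\<close> removes
  the axis \<open>m = 0\<close>, and subtracting \<open>zeta_sum k / t ^ k\<close> removes the axis
  \<open>n = 0\<close>.\<close>

lemma lterm_rows:
  assumes "0 < Im t" "even k" "k \<ge> 2"
  shows "lterm k t m sums (eis_scale k * powsum (k - 1) (nome t ^ Suc m) - 1 / t ^ k * (1 / of_nat (Suc m) ^ k))"
    and "(\<Sum>m. \<Sum>n. lterm k t m n) = eis_lattice k (nome t) - zeta_sum k - zeta_sum k / t ^ k"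
proof -
  show row: "lterm k t m sums (eis_scale k * powsum (k - 1) (nome t ^ Suc m) - 1 / t ^ k * (1 / of_nat (Suc m) ^ k))" for m
  proof -
    have "0 < Im (of_nat (Suc m) * t)" using assms(1) by (simp del: of_nat_Suc)
    from lipschitz_formula[OF this assms(2,3)] show ?thesis
      by (simp only: lterm_def[abs_def] eis_scale_def nome_mult_of_nat power_mult_distrib) (simp add: mult_ac)
  qed
  note P = lambert_conv_powsum[OF norm_nome_less[OF assms(1)], of "k - 1"]
  have "(\<Sum>m. \<Sum>n. lterm k t m n) = (\<Sum>m. eis_scale k * powsum (k - 1) (nome t ^ Suc m) - 1 / t ^ k * (1 / of_nat (Suc m) ^ k))"
    using row by (simp only: sums_iff)
  also have "\<dots> = (\<Sum>m. eis_scale k * powsum (k - 1) (nome t ^ Suc m)) - (\<Sum>m. 1 / t ^ k * (1 / of_nat (Suc m) ^ k))"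
    by (intro suminf_diff[symmetric] summable_mult summable_zeta_sum P(2)) (use assms(3) in auto)
  also have "(\<Sum>m. eis_scale k * powsum (k - 1) (nome t ^ Suc m)) = eis_scale k * (\<Sum>m. powsum (k - 1) (nome t ^ Suc m))"
    by (intro suminf_mult P(2)) (use assms(3) in auto)
  also have "(\<Sum>m. powsum (k - 1) (nome t ^ Suc m)) = nome t * lambert (k - 1) (nome t)"
    using P(1) assms(3) by auto
  also have "(\<Sum>m. 1 / t ^ k * (1 / of_nat (Suc m) ^ k)) = zeta_sum k / t ^ k"
    unfolding zeta_sum_def by (subst suminf_mult[OF summable_zeta_sum]) (use assms(3) in auto)
  finally show "(\<Sum>m. \<Sum>n. lterm k t m n) = eis_lattice k (nome t) - zeta_sum k - zeta_sum k / t ^ k"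
    by (simp add: eis_lattice_def)
qed

lemma norm_inverse_lattice:
  fixes t :: complex
  assumes c: "0 < c" "\<And>x y :: real. c * (\<bar>x\<bar> + \<bar>y\<bar>) \<le> norm (of_real x * t + of_real y)"
  shows "norm (1 / (of_nat (Suc m) * t + of_nat (Suc n)) ^ k) \<le> (1 / c ^ k) / (real (Suc m) + real (Suc n)) ^ k" (is ?A)
    and "norm (1 / (of_nat (Suc m) * t - of_nat (Suc n)) ^ k) \<le> (1 / c ^ k) / (real (Suc m) + real (Suc n)) ^ k" (is ?B)
proof -
  let ?s = "real (Suc m) + real (Suc n)"
  have s: "0 < ?s" by simp
  have le: "norm (1 / w ^ k) \<le> (1 / c ^ k) / ?s ^ k" if "c * ?s \<le> norm w" for w :: complex
  proof -
    have "(c * ?s) ^ k \<le> norm w ^ k" by (rule power_mono[OF that]) (use c s in auto)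
    moreover have "0 < (c * ?s) ^ k" using c s by simp
    ultimately have "1 / norm w ^ k \<le> 1 / (c * ?s) ^ k" by (intro divide_left_mono) auto
    then show ?thesis by (simp add: norm_divide norm_power power_mult_distrib)
  qed
  show ?A by (rule le) (use c(2)[of "real (Suc m)" "real (Suc n)"] in simp)
  show ?B by (rule le) (use c(2)[of "real (Suc m)" "- real (Suc n)"] in \<open>simp del: of_nat_Suc\<close>)
qed

text \<open>Inversion transposes the double series, and \<open>k \<ge> 4\<close> makes it absolutely
  convergent, so the order of summation is immaterial. The two axis terms change places.\<close>

lemma eis_lattice_inversion:
  assumes t: "0 < Im t" and k: "even k" "k \<ge> 4"
  shows "eis_lattice k (nome (- 1 / t)) = t ^ k * eis_lattice k (nome t)"
proof -
  have t0: "t \<noteq> 0" using t by auto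
  have k2: "k \<ge> 2" using k by simp
  obtain c where c: "0 < c" "\<And>x y :: real. c * (\<bar>x\<bar> + \<bar>y\<bar>) \<le> norm (of_real x * t + of_real y)"
    using lattice_lower_bound[OF t] by blast
  have bnd: "norm (lterm k t m n) \<le> (2 / c ^ k) / (real (Suc m) + real (Suc n)) ^ 3" for m n
  proof -
    have "(real (Suc m) + real (Suc n)) ^ 3 \<le> (real (Suc m) + real (Suc n)) ^ k"
      by (rule power_increasing) (use k in auto)
    then have "(2 / c ^ k) / (real (Suc m) + real (Suc n)) ^ k \<le> (2 / c ^ k) / (real (Suc m) + real (Suc n)) ^ 3"
      using c by (intro divide_left_mono) (auto intro!: mult_pos_pos add_pos_nonneg)
    moreover have "norm (lterm k t m n) \<le> (2 / c ^ k) / (real (Suc m) + real (Suc n)) ^ k"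
      using order_trans[OF norm_triangle_ineq add_mono[OF norm_inverse_lattice[OF c, of m n k]]]
      unfolding lterm_def add_divide_distrib[symmetric] by (simp del: of_nat_Suc)
    ultimately show ?thesis by linarith
  qed
  have "(\<Sum>m. \<Sum>n. lterm k (- 1 / t) m n) = (\<Sum>m. \<Sum>n. t ^ k * lterm k t n m)"
    by (simp only: lterm_inversion[OF t k(1)])
  also have "\<dots> = (\<Sum>n. \<Sum>m. t ^ k * lterm k t n m)"
  proof (rule double_suminf_quad(1)[symmetric])
    show "norm (t ^ k * lterm k t m n) \<le> (norm t ^ k * (2 / c ^ k)) / (real (Suc m) + real (Suc n)) ^ 3" for m n
      unfolding norm_mult norm_power times_divide_eq_right[symmetric, of "norm t ^ k"]
      using mult_left_mono[OF bnd[of m n], of "norm t ^ k"] by (simp add: mult.assoc)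
  qed (use c in auto)
  also have "\<dots> = (\<Sum>n. t ^ k * (\<Sum>m. lterm k t n m))"
    by (simp only: suminf_mult[OF sums_summable[OF lterm_rows(1)[OF t k(1) k2]]])
  also have "\<dots> = t ^ k * (\<Sum>n. \<Sum>m. lterm k t n m)"
    by (rule suminf_mult[OF double_suminf_quad(2)[OF bnd]]) (use c in auto)
  finally have "eis_lattice k (nome (- 1 / t)) - zeta_sum k - zeta_sum k / (- 1 / t) ^ k
      = t ^ k * (eis_lattice k (nome t) - zeta_sum k - zeta_sum k / t ^ k)"
    unfolding lterm_rows(2)[OF t k(1) k2] lterm_rows(2)[OF Im_minus_inverse[OF t] k(1) k2] .
  moreover have "(- 1 / t) ^ k = 1 / t ^ k" using k by (simp add: power_divide)
  ultimately show ?thesis using t0 by (simp add: algebra_simps)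
qed


text \<open>An approximate antidifference of the weight-two terms:
  \<open>eterm t m n - eterm t m (Suc n)\<close> is
  \<open>1 / ((x + n) * (x + n + 1)) + 1 / ((x - n) * (x - n - 1))\<close> with
  \<open>x = of_nat (Suc m) * t\<close>, which agrees with \<open>lterm 2 t m n\<close> up to cubic
  decay.\<close>

definition eterm :: "complex \<Rightarrow> nat \<Rightarrow> nat \<Rightarrow> complex" where
  "eterm t m n = 1 / (of_nat (Suc m) * t + of_nat n) - 1 / (of_nat (Suc m) * t - of_nat n)"

lemma upper_lattice_nonzero:
  assumes "0 < Im t"
  shows "of_nat (Suc m) * t + of_real y \<noteq> 0"
proof
  assume "of_nat (Suc m) * t + of_real y = 0"
  then have "Im (of_nat (Suc m) * t + of_real y) = 0" by simp
  then show False using assms by (simp del: of_nat_Suc)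
qed

lemma eterm_telescopes:
  assumes "0 < Im t"
  shows "(\<lambda>n. eterm t m n - eterm t m (Suc n)) sums 0"
proof -
  have lim: "(\<lambda>n. 1 / (a + of_nat n)) \<longlonglongrightarrow> 0" "(\<lambda>n. 1 / (a - of_nat n)) \<longlonglongrightarrow> 0" for a :: complex
  proof -
    have "filterlim (\<lambda>n. a + of_nat n) at_infinity sequentially"
      by (intro tendsto_add_filterlim_at_infinity[OF tendsto_const] tendsto_of_nat)
    then show "(\<lambda>n. 1 / (a + of_nat n)) \<longlonglongrightarrow> 0"
      by (rule tendsto_divide_0[OF tendsto_const])
    have "filterlim (\<lambda>n. - a + of_nat n) at_infinity sequentially"
      by (intro tendsto_add_filterlim_at_infinity[OF tendsto_const] tendsto_of_nat)
    then have "(\<lambda>n. (- 1) / (- a + of_nat n)) \<longlonglongrightarrow> 0"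
      by (rule tendsto_divide_0[OF tendsto_const])
    moreover have "(- 1) / (- a + of_nat n) = 1 / (a - of_nat n)" for n
      by (metis add.commute minus_diff_eq minus_divide_divide uminus_add_conv_diff minus_minus)
    ultimately show "(\<lambda>n. 1 / (a - of_nat n)) \<longlonglongrightarrow> 0" by simp
  qed
  have "eterm t m \<longlonglongrightarrow> 0 - 0"
    unfolding eterm_def[abs_def] by (intro tendsto_diff lim)
  from telescope_sums'[OF this] show ?thesis by (simp add: eterm_def)
qed

text \<open>By \<open>id1\<close> and \<open>id2\<close> the error consists of products of three
  lattice reciprocals, so it decays cubically and its double series converges absolutely. Replacing
  \<open>Suc n\<close> by \<open>n\<close> in one factor costs at most a factor 2; two such terms
  give the constant 4.\<close>

lemma lterm_minus_eterm:
  assumes "0 < Im t" and c: "0 < c" "\<And>x y :: real. c * (\<bar>x\<bar> + \<bar>y\<bar>) \<le> norm (of_real x * t + of_real y)"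
  shows "norm (lterm 2 t m n - (eterm t m n - eterm t m (Suc n))) \<le> (4 / c ^ 3) / (real (Suc m) + real (Suc n)) ^ 3"
proof -
  let ?x = "of_nat (Suc m) * t" and ?y = "of_nat (Suc n) :: complex" and ?s = "real (Suc m) + real (Suc n)"
  have nz: "?x + of_real y \<noteq> 0" for y by (rule upper_lattice_nonzero[OF assms(1)])
  have nz': "?x + ?y \<noteq> 0" "?x + of_nat n \<noteq> 0" "?x - ?y \<noteq> 0" "?x - of_nat n \<noteq> 0"
    using nz[of "real (Suc n)"] nz[of "real n"] nz[of "- real (Suc n)"] nz[of "- real n"]
    by (auto simp del: of_nat_Suc)
  have id1: "1 / (u + 1) ^ 2 - (1 / u - 1 / (u + 1)) = - (1 / (u + 1) ^ 2 * (1 / u))"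
    if "u \<noteq> 0" "u + 1 \<noteq> 0" for u :: complex
    using that by (simp add: divide_simps) algebra
  have id2: "1 / (u - 1) ^ 2 + (1 / u - 1 / (u - 1)) = 1 / (u - 1) ^ 2 * (1 / u)"
    if "u \<noteq> 0" "u - 1 \<noteq> 0" for u :: complex
    using that by (simp add: divide_simps) algebra
  have comb: "1 / (u + 1) ^ 2 + 1 / (v - 1) ^ 2 - ((1 / u - 1 / v) - (1 / (u + 1) - 1 / (v - 1)))
      = - (1 / (u + 1) ^ 2 * (1 / u)) + 1 / (v - 1) ^ 2 * (1 / v)"
    if "u \<noteq> 0" "u + 1 \<noteq> 0" "v \<noteq> 0" "v - 1 \<noteq> 0" for u v :: complex
    unfolding id1[OF that(1,2), symmetric] id2[OF that(3,4), symmetric] by simp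
  have y: "?x + ?y = (?x + of_nat n) + 1" "?x - ?y = (?x - of_nat n) - 1" by simp_all
  have eq: "lterm 2 t m n - (eterm t m n - eterm t m (Suc n)) =
      - (1 / (?x + ?y) ^ 2 * (1 / (?x + of_nat n))) + 1 / (?x - ?y) ^ 2 * (1 / (?x - of_nat n))"
    unfolding lterm_def eterm_def y by (rule comb) (use nz' in \<open>auto simp: algebra_simps\<close>)
  have u: "norm (1 / (?x + of_nat n)) \<le> 2 / (c * ?s)" "norm (1 / (?x - of_nat n)) \<le> 2 / (c * ?s)"
  proof -
    have half: "norm (1 / w) \<le> 2 / (c * ?s)" if "c * (real (Suc m) + real n) \<le> norm w" for w :: complex
    proof -
      have "c * ?s / 2 \<le> c * (real (Suc m) + real n)" using c(1) by (simp add: field_simps)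
      then have "c * ?s / 2 \<le> norm w" using that by linarith
      moreover have "0 < c * ?s / 2" using c(1) by (simp add: add_pos_pos)
      ultimately have "1 / norm w \<le> 1 / (c * ?s / 2)" by (intro frac_le) auto
      then show ?thesis by (simp add: norm_divide)
    qed
    show "norm (1 / (?x + of_nat n)) \<le> 2 / (c * ?s)"
      by (rule half) (use c(2)[of "real (Suc m)" "real n"] in \<open>simp del: of_nat_Suc\<close>)
    show "norm (1 / (?x - of_nat n)) \<le> 2 / (c * ?s)"
      by (rule half) (use c(2)[of "real (Suc m)" "- real n"] in \<open>simp del: of_nat_Suc\<close>)
  qed
  note v = norm_inverse_lattice[OF c, of m n 2]
  have "norm (- (1 / (?x + ?y) ^ 2 * (1 / (?x + of_nat n)))) \<le> (1 / c ^ 2) / ?s ^ 2 * (2 / (c * ?s))"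
    unfolding norm_minus_cancel norm_mult by (rule mult_mono[OF v(1) u(1)]) (use c in auto)
  moreover have "norm (1 / (?x - ?y) ^ 2 * (1 / (?x - of_nat n))) \<le> (1 / c ^ 2) / ?s ^ 2 * (2 / (c * ?s))"
    unfolding norm_mult by (rule mult_mono[OF v(2) u(2)]) (use c in auto)
  ultimately have "norm (lterm 2 t m n - (eterm t m n - eterm t m (Suc n)))
      \<le> (1 / c ^ 2) / ?s ^ 2 * (2 / (c * ?s)) + (1 / c ^ 2) / ?s ^ 2 * (2 / (c * ?s))"
    unfolding eq by (rule order_trans[OF norm_triangle_ineq add_mono])
  also have "\<dots> = (4 / c ^ 3) / ?s ^ 3"
    by (simp add: power2_eq_square power3_eq_cube del: of_nat_Suc)
  finally show ?thesis .
qed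

text \<open>With the factor \<open>- 1 / t\<close> taken out, the column is the partial fraction
  series of the cotangent at \<open>of_nat (Suc n) * (- 1 / t)\<close>.\<close>

lemma eterm_columns:
  assumes "0 < Im t"
  shows "(\<lambda>m. eterm t m (Suc n)) sums (- (of_real pi * cot (of_real pi * (of_nat (Suc n) * (- 1 / t))) / t + 1 / of_nat (Suc n)))"
proof -
  let ?z = "of_nat (Suc n) * (- 1 / t)"
  have t: "t \<noteq> 0" using assms by auto
  have "Im ?z = real (Suc n) * Im (- 1 / t)"
    by (simp only: times_complex.sel complex_Re_of_nat complex_Im_of_nat mult_zero_left add_0_right)
  then have z: "0 < Im ?z" using Im_minus_inverse[OF assms] by (simp only: mult_pos_pos of_nat_0_less_iff zero_less_Suc)
  have "(\<lambda>m. - (1 / t) * (1 / (?z + of_nat (Suc m)) + 1 / (?z - of_nat (Suc m)))) sums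
      (- (1 / t) * (of_real pi * cot (of_real pi * ?z) - 1 / ?z))"
    by (intro sums_mult cot_partial_fractions z)
  moreover have "- (1 / t) * (1 / (?z + of_nat (Suc m)) + 1 / (?z - of_nat (Suc m))) = eterm t m (Suc n)" for m
  proof -
    let ?x = "of_nat (Suc m) :: complex" and ?y = "of_nat (Suc n) :: complex"
    have e: "?z + ?x = (?x * t - ?y) / t" "?z - ?x = - ((?x * t + ?y) / t)"
      using t by (simp_all add: field_simps del: of_nat_Suc)
    show ?thesis unfolding e eterm_def using t by (simp del: of_nat_Suc add: algebra_simps)
  qed
  moreover have "- (1 / t) * (of_real pi * cot (of_real pi * ?z) - 1 / ?z)
      = - (of_real pi * cot (of_real pi * ?z) / t + 1 / of_nat (Suc n))"
    using t by (simp add: algebra_simps del: of_nat_Suc)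
  ultimately show ?thesis by simp
qed

lemma cot_sequence_limit:
  assumes "0 < Im z"
  shows "(\<lambda>n. cot (of_real pi * (of_nat (Suc n) * z))) \<longlonglongrightarrow> - \<i>"
proof -
  have "(\<lambda>n. nome z ^ Suc n) \<longlonglongrightarrow> 0"
    using LIMSEQ_power_zero[OF norm_nome_less[OF assms]] by (rule LIMSEQ_Suc)
  then have "(\<lambda>n. \<i> * (nome z ^ Suc n + 1) / (nome z ^ Suc n - 1)) \<longlonglongrightarrow> \<i> * (0 + 1) / (0 - 1)"
    by (intro tendsto_intros) auto
  moreover have "cot (of_real pi * (of_nat (Suc n) * z)) = \<i> * (nome z ^ Suc n + 1) / (nome z ^ Suc n - 1)" for n
  proof -
    have "0 < Im (of_nat (Suc n) * z)" using assms by (simp del: of_nat_Suc)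
    then show ?thesis unfolding nome_mult_of_nat[symmetric] by (rule cot_nome)
  qed
  ultimately show ?thesis by simp
qed

text \<open>Eisenstein's argument: the double series for weight two converges only conditionally, and
  the difference of its two iterated sums is that of the telescoping comparison series.\<close>

lemma eis_lattice_2_inversion:
  assumes t: "0 < Im t"
  shows "eis_lattice 2 (nome (- 1 / t)) = t ^ 2 * eis_lattice 2 (nome t) - of_real pi * \<i> * t"
proof -
  have t0: "t \<noteq> 0" using t by auto
  obtain c where c: "0 < c" "\<And>x y :: real. c * (\<bar>x\<bar> + \<bar>y\<bar>) \<le> norm (of_real x * t + of_real y)"
    using lattice_lower_bound[OF t] by blast
  define d where "d = (\<lambda>m n. lterm 2 t m n - (eterm t m n - eterm t m (Suc n)))"
  have bnd: "norm (d m n) \<le> (4 / c ^ 3) / (real (Suc m) + real (Suc n)) ^ 3" for m n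
    unfolding d_def by (rule lterm_minus_eterm[OF t c])
  have D: "(\<Sum>m. \<Sum>n. d m n) = (\<Sum>n. \<Sum>m. d m n)" "summable (\<lambda>n. \<Sum>m. d m n)"
    by (rule double_suminf_quad[OF bnd], use c in simp)+
  have row: "d m sums ((\<Sum>n. lterm 2 t m n) - 0)" for m
    unfolding d_def by (intro sums_diff eterm_telescopes t summable_sums sums_summable[OF lterm_rows(1)]) auto
  define s where "s = (\<lambda>n. \<Sum>m. eterm t m n)"
  define p where "p = (\<lambda>n. - (of_real pi * cot (of_real pi * (of_nat (Suc n) * (- 1 / t))) / t + 1 / of_nat (Suc n)))"
  have s0: "s 0 = 0" by (simp add: s_def eterm_def)
  have sS: "s (Suc n) = p n" for n
    unfolding s_def p_def using eterm_columns[OF t] by (rule sums_unique[symmetric])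
  have es: "(\<lambda>m. eterm t m n) sums s n" for n
  proof (cases n)
    case 0
    then show ?thesis by (simp add: s_def eterm_def)
  next
    case (Suc k)
    then show ?thesis using eterm_columns[OF t, of k] sS[of k] by (simp add: p_def)
  qed
  have "(\<lambda>n. 1 / of_nat (Suc n) :: complex) \<longlonglongrightarrow> 0"
    by (rule LIMSEQ_Suc[OF lim_1_over_n])
  \<comment> \<open>This nonzero limit is the source of the anomaly: each row of the comparison
    series telescopes to 0, whereas its columns add up to
    \<open>- (of_real pi * \<i> / t)\<close>.\<close>
  then have "p \<longlonglongrightarrow> - (of_real pi * (- \<i>) / t + 0)"
    unfolding p_def by (intro tendsto_intros cot_sequence_limit Im_minus_inverse t t0)
  then have "(\<lambda>n. s (Suc n)) \<longlonglongrightarrow> of_real pi * \<i> / t" by (simp add: sS)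
  then have "s \<longlonglongrightarrow> of_real pi * \<i> / t" by (rule LIMSEQ_imp_Suc)
  then have S: "(\<lambda>n. s n - s (Suc n)) sums (- (of_real pi * \<i> / t))"
    using telescope_sums'[of s] s0 by simp
  have inv: "lterm 2 t m n = 1 / t ^ 2 * lterm 2 (- 1 / t) n m" for m n
    using lterm_inversion[OF t, of 2 n m] t0 by simp
  define L where "L = (\<lambda>n. \<Sum>m. lterm 2 (- 1 / t) n m)"
  have Ls: "(\<lambda>m. lterm 2 (- 1 / t) n m) sums L n" for n
    unfolding L_def using lterm_rows(1)[OF Im_minus_inverse[OF t], of 2 n] by (simp add: sums_iff)
  have col: "(\<lambda>m. d m n) sums (1 / t ^ 2 * L n - (s n - s (Suc n)))" for n
    unfolding d_def inv by (intro sums_diff sums_mult Ls es)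
  have sumcol: "summable (\<lambda>n. 1 / t ^ 2 * L n - (s n - s (Suc n)))"
    using D(2) sums_unique[OF col] by simp
  have "summable (\<lambda>n. (1 / t ^ 2 * L n - (s n - s (Suc n))) + (s n - s (Suc n)))"
    by (rule summable_add[OF sumcol sums_summable[OF S]])
  then have sumL: "summable (\<lambda>n. 1 / t ^ 2 * L n)" by simp
  then have "summable (\<lambda>n. t ^ 2 * (1 / t ^ 2 * L n))" by (rule summable_mult)
  then have sumL': "summable L" using t0 by simp
  have "(\<Sum>m. \<Sum>n. lterm 2 t m n) = (\<Sum>m. \<Sum>n. d m n)"
    using sums_unique[OF row] by simp
  also have "\<dots> = (\<Sum>n. 1 / t ^ 2 * L n - (s n - s (Suc n)))"
    unfolding D(1) using sums_unique[OF col] by simp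
  also have "\<dots> = (\<Sum>n. 1 / t ^ 2 * L n) - (\<Sum>n. s n - s (Suc n))"
    by (rule suminf_diff[OF sumL sums_summable[OF S], symmetric])
  also have "\<dots> = 1 / t ^ 2 * (\<Sum>n. L n) + of_real pi * \<i> / t"
    by (simp only: suminf_mult[OF sumL'] sums_unique[OF S, symmetric]) simp
  finally have "eis_lattice 2 (nome t) - zeta_sum 2 - zeta_sum 2 / t ^ 2
     = 1 / t ^ 2 * (eis_lattice 2 (nome (- 1 / t)) - zeta_sum 2 - zeta_sum 2 / (- 1 / t) ^ 2) + of_real pi * \<i> / t"
    unfolding L_def using lterm_rows(2)[OF t, of 2] lterm_rows(2)[OF Im_minus_inverse[OF t], of 2] by simp
  then have "t ^ 2 * (eis_lattice 2 (nome t) - zeta_sum 2 - zeta_sum 2 / t ^ 2) =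
     t ^ 2 * (1 / t ^ 2 * (eis_lattice 2 (nome (- 1 / t)) - zeta_sum 2 - zeta_sum 2 / (- 1 / t) ^ 2) + of_real pi * \<i> / t)"
    by simp
  then show ?thesis
    using t0 by (simp add: power_divide algebra_simps power2_eq_square)
qed

lemma zeta_sum_2: "zeta_sum 2 = of_real pi ^ 2 / 6"
proof -
  have "(\<lambda>n. complex_of_real (1 / (1 + real n)\<^sup>2)) sums complex_of_real (pi\<^sup>2 / 6)"
    using inverse_squares_sums by (simp only: sums_of_real_iff) (simp add: add.commute)
  then show ?thesis unfolding zeta_sum_def by (simp add: sums_iff)
qed

section \<open>Eisenstein series and the eta product on the unit disc\<close>

declare bernoulli.simps [simp del]

lemma bernoulli_values: "bernoulli 2 = 1 / 6" "bernoulli 4 = - (1 / 30)" "bernoulli 6 = 1 / 42"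
proof -
  have b0: "bernoulli 0 = 1" by (subst bernoulli.simps) simp
  have b1: "bernoulli (Suc 0) = - (1 / 2)" by (subst bernoulli.simps) (simp add: b0)
  show b2: "bernoulli 2 = 1 / 6" by (subst bernoulli.simps) (simp add: eval_nat_numeral b0 b1)
  have b3: "bernoulli 3 = 0"
    using b2 by (subst bernoulli.simps) (simp add: eval_nat_numeral b0 b1)
  show b4: "bernoulli 4 = - (1 / 30)"
    using b2 b3 by (subst bernoulli.simps) (simp add: eval_nat_numeral b0 b1)
  have b5: "bernoulli 5 = 0"
    using b2 b3 b4 by (subst bernoulli.simps) (simp add: eval_nat_numeral b0 b1)
  show "bernoulli 6 = 1 / 42"
    using b2 b3 b4 b5 by (subst bernoulli.simps) (simp add: eval_nat_numeral b0 b1)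
qed

lemma eis_conv_lambert:
  assumes "norm q < 1"
  shows "eis n q = 1 - of_real (4 * real n / bernoulli (2 * n)) * (q * lambert (2 * n - 1) q)"
proof -
  have "q * lambert (2 * n - 1) q = (\<Sum>k. q * (of_nat (Suc k) ^ (2 * n - 1) * q ^ k / (1 - q ^ Suc k)))"
    unfolding lambert_def by (rule suminf_mult[OF summable_lambert[OF assms], symmetric])
  then show ?thesis by (simp add: eis_def mult_ac)
qed

text \<open>Separate constants, since the simplifier rewrites \<open>eis 1\<close> to \<open>eis (Suc 0)\<close>.\<close>

definition e2 :: "complex \<Rightarrow> complex" where "e2 = eis 1"
definition e4 :: "complex \<Rightarrow> complex" where "e4 = eis 2"
definition e6 :: "complex \<Rightarrow> complex" where "e6 = eis 3"

lemma e_conv_lambert: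
  assumes "norm q < 1"
  shows "e2 q = 1 - 24 * (q * lambert 1 q)" "e4 q = 1 + 240 * (q * lambert 3 q)" "e6 q = 1 - 504 * (q * lambert 5 q)"
  unfolding e2_def e4_def e6_def eis_conv_lambert[OF assms]
  by (simp_all add: bernoulli_values)

lemma holomorphic_e: "e2 holomorphic_on ball 0 1" "e4 holomorphic_on ball 0 1" "e6 holomorphic_on ball 0 1"
proof -
  have "(\<lambda>q. 1 + c * (q * lambert s q)) holomorphic_on ball 0 1" for c s
    by (intro holomorphic_intros holomorphic_lambert)
  note h = this[THEN holomorphic_transform]
  show "e2 holomorphic_on ball 0 1" by (rule h[of "-24" 1]) (simp add: e_conv_lambert)
  show "e4 holomorphic_on ball 0 1" by (rule h[of 240 3]) (simp add: e_conv_lambert)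
  show "e6 holomorphic_on ball 0 1" by (rule h[of "-504" 5]) (simp add: e_conv_lambert)
qed

lemma e_0 [simp]: "e2 0 = 1" "e4 0 = 1" "e6 0 = 1"
  by (simp_all add: e_conv_lambert)

lemma has_field_derivative_lambert_0:
  "((\<lambda>q. a + c * (q * lambert s q)) has_field_derivative c) (at 0)"
proof -
  have "(lambert s has_field_derivative deriv (lambert s) 0) (at 0)"
    by (rule holomorphic_derivI[OF holomorphic_lambert]) auto
  then show ?thesis
    by (auto intro!: derivative_eq_intros simp: lambert_0)
qed

lemma deriv_e_0: "deriv e2 0 = -24" "deriv e4 0 = 240" "deriv e6 0 = -504"
proof -
  have t: "deriv f 0 = c" if "\<And>q. norm q < 1 \<Longrightarrow> f q = 1 + c * (q * lambert s q)" for f c s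
  proof (rule DERIV_imp_deriv, rule has_field_derivative_transform_within_open[of _ _ _ "ball 0 1"])
    show "((\<lambda>q. 1 + c * (q * lambert s q)) has_field_derivative c) (at 0)"
      by (rule has_field_derivative_lambert_0)
  qed (use that in auto)
  show "deriv e2 0 = -24" by (rule t[of _ _ 1]) (simp add: e_conv_lambert)
  show "deriv e4 0 = 240" by (rule t[of _ _ 3]) (simp add: e_conv_lambert)
  show "deriv e6 0 = -504" by (rule t[of _ _ 5]) (simp add: e_conv_lambert)
qed

lemma e2_inversion:
  assumes "0 < Im t"
  shows "e2 (nome (- 1 / t)) = t ^ 2 * e2 (nome t) + 12 * t / tpi"
proof -
  \<comment> \<open>Since \<open>tpi ^ 2 = - 24 * (of_real pi ^ 2 / 6)\<close>, the lattice sum and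
    the Bernoulli normalisation of \<open>e2\<close> differ only by the factor
    \<open>zeta_sum 2\<close>.\<close>
  have c: "eis_lattice 2 (nome s) = of_real pi ^ 2 / 6 * e2 (nome s)" if "0 < Im s" for s
    using norm_nome_less[OF that]
    by (simp add: eis_lattice_def zeta_sum_2 eis_scale_def e_conv_lambert tpi_def power_mult_distrib algebra_simps)
  have "of_real pi ^ 2 / 6 * e2 (nome (- 1 / t)) = t ^ 2 * (of_real pi ^ 2 / 6 * e2 (nome t)) - of_real pi * \<i> * t"
    using eis_lattice_2_inversion[OF assms] unfolding c[OF assms] c[OF Im_minus_inverse[OF assms]] .
  moreover have "tpi * (- \<i>) = 2 * of_real pi" by (simp add: tpi_def mult_ac)
  then have "1 / tpi = - \<i> / (2 * of_real pi)" by (simp add: field_simps)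
  then have "12 * t / tpi = 12 * t * (- \<i> / (2 * of_real pi))"
    by (metis mult.right_neutral times_divide_eq_right)
  then have "of_real pi ^ 2 / 6 * (12 * t / tpi) = - of_real pi * \<i> * t"
    by (simp add: power2_eq_square)
  ultimately have "of_real pi ^ 2 / 6 * e2 (nome (- 1 / t)) = of_real pi ^ 2 / 6 * (t ^ 2 * e2 (nome t) + 12 * t / tpi)"
    unfolding distrib_left[of "of_real pi ^ 2 / 6"] by simp
  then show ?thesis by simp
qed

section \<open>The Euler product and the inversion law of the 24th power of eta\<close>

definition euler :: "complex \<Rightarrow> complex" where
  "euler q = (\<Prod>k. 1 - q ^ Suc k)"

lemma convergent_euler:
  fixes q :: complex
  assumes "norm q < 1"
  shows "convergent_prod (\<lambda>k. 1 - q ^ Suc k)"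
proof -
  have "convergent_prod (\<lambda>k. 1 + - (q ^ Suc k))"
  proof (rule summable_imp_convergent_prod_complex)
    show "summable (\<lambda>k. norm (- (q ^ Suc k)))"
      using assms by (simp add: norm_mult norm_power summable_mult summable_geometric)
    show "- (q ^ Suc k) \<noteq> - 1" for k
      using one_minus_power_nonzero[OF assms, of k] by auto
  qed
  then show ?thesis by simp
qed

lemma euler_nonzero: "norm q < 1 \<Longrightarrow> euler q \<noteq> 0"
  unfolding euler_def by (intro prodinf_nonzero convergent_euler one_minus_power_nonzero)

lemma euler_uniform_limit:
  assumes "0 \<le> r" "r < 1" "\<And>y. y \<in> cball x d \<Longrightarrow> norm y \<le> r"
  shows "uniform_limit (cball x d) (\<lambda>n q. \<Prod>k<n. 1 - q ^ Suc k) euler sequentially"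
proof -
  have "uniformly_convergent_on (cball x d) (\<lambda>n q. \<Prod>k<n. 1 - q ^ Suc k)"
  proof (rule uniformly_convergent_on_prod')
    show "uniformly_convergent_on (cball x d) (\<lambda>n q. \<Sum>k<n. norm (1 - q ^ Suc k - 1))"
    proof (rule Weierstrass_m_test'[where M = "\<lambda>k. r ^ Suc k"])
      show "norm (norm (1 - y ^ Suc k - 1)) \<le> r ^ Suc k" if "y \<in> cball x d" for k y
        using power_mono[OF assms(3)[OF that], of "Suc k"] by (simp add: norm_power del: power_Suc)
      show "summable (\<lambda>k. r ^ Suc k)"
        using assms by (simp add: summable_mult summable_geometric)
    qed
  qed (auto intro!: continuous_intros)
  then have A: "uniform_limit (cball x d) (\<lambda>n q. \<Prod>k<n. 1 - q ^ Suc k) (\<lambda>q. lim (\<lambda>n. \<Prod>k<n. 1 - q ^ Suc k)) sequentially"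
    by (simp add: uniformly_convergent_uniform_limit_iff)
  have B: "lim (\<lambda>n. \<Prod>k<n. 1 - q ^ Suc k) = euler q" if "q \<in> cball x d" for q
  proof -
    have "norm q < 1" using assms(3)[OF that] assms(2) by linarith
    then show ?thesis
      unfolding euler_def
      by (intro prodinf_eq_lim'[symmetric] convergent_euler one_minus_power_nonzero)
  qed
  show ?thesis
    by (rule iffD1[OF uniform_limit_cong' A]) (simp_all add: B del: power_Suc)
qed

lemma holomorphic_euler: "euler holomorphic_on ball 0 1"
proof (rule holomorphic_uniform_sequence)
  fix x :: complex assume "x \<in> ball 0 1"
  then obtain d r where "0 < d" "cball x d \<subseteq> ball 0 1" "0 \<le> r" "r < 1"
    "\<And>y. y \<in> cball x d \<Longrightarrow> norm y \<le> r"
    by (rule cball_in_unit_ball) blast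
  then show "\<exists>d>0. cball x d \<subseteq> ball 0 1 \<and> uniform_limit (cball x d) (\<lambda>n q. \<Prod>k<n. 1 - q ^ Suc k) euler sequentially"
    using euler_uniform_limit[of r x d] by blast
qed (auto intro!: holomorphic_intros)

lemma logderiv_euler:
  assumes "norm q < 1"
  shows "deriv euler q = - lambert 1 q * euler q"
proof -
  have "q \<in> ball 0 1" using assms by simp
  then obtain d r where dr: "0 < d" "cball q d \<subseteq> ball 0 1" "0 \<le> r" "r < 1"
    "\<And>y. y \<in> cball q d \<Longrightarrow> norm y \<le> r"
    by (rule cball_in_unit_ball) blast
  have "uniform_limit (ball q d) (\<lambda>n q. \<Prod>k<n. 1 - q ^ Suc k) euler sequentially"
    by (rule uniform_limit_on_subset[OF euler_uniform_limit[of r q d]]) (use dr in auto)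
  then have "(\<lambda>k. deriv (\<lambda>q. 1 - q ^ Suc k) q / (1 - q ^ Suc k)) sums (deriv euler q / euler q)"
    by (rule logderiv_prodinf_complex_uniform_limit)
       (use dr euler_nonzero[OF assms] in \<open>auto intro!: holomorphic_intros\<close>)
  moreover have "deriv (\<lambda>q. 1 - q ^ Suc k) q = - (of_nat (Suc k) * q ^ k)" for k :: nat
    by (rule DERIV_imp_deriv) (auto intro!: derivative_eq_intros simp del: power_Suc)
  ultimately have "(\<lambda>k. - (of_nat (Suc k) ^ 1 * q ^ k / (1 - q ^ Suc k))) sums (deriv euler q / euler q)"
    by (simp del: of_nat_Suc power_Suc)
  moreover have "(\<lambda>k. - (of_nat (Suc k) ^ 1 * q ^ k / (1 - q ^ Suc k))) sums (- lambert 1 q)"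
    unfolding lambert_def by (intro sums_minus summable_sums summable_lambert assms)
  ultimately have "deriv euler q / euler q = - lambert 1 q"
    using sums_unique2 by blast
  then show ?thesis using euler_nonzero[OF assms] by (simp add: field_simps)
qed

lemma euler_0 [simp]: "euler 0 = 1"
  by (simp add: euler_def)

lemma eta24_conv_euler: "eta24 q = q * euler q ^ 24"
  by (simp add: eta24_def euler_def)

lemma eta24_nonzero: "norm q < 1 \<Longrightarrow> q \<noteq> 0 \<Longrightarrow> eta24 q \<noteq> 0"
  by (simp add: eta24_conv_euler euler_nonzero)

lemma holomorphic_eta24: "eta24 holomorphic_on ball 0 1"
  unfolding eta24_conv_euler[abs_def] by (intro holomorphic_intros holomorphic_euler)

lemma deriv_eta24:
  assumes "norm q < 1"
  shows "q * deriv eta24 q = e2 q * eta24 q"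
proof -
  have "(euler has_field_derivative deriv euler q) (at q)"
    by (rule holomorphic_derivI[OF holomorphic_euler]) (use assms in auto)
  then have "((\<lambda>q. q * euler q ^ 24) has_field_derivative euler q ^ 24 + q * (24 * deriv euler q * euler q ^ 23)) (at q)"
    by (auto intro!: derivative_eq_intros)
  then have "deriv eta24 q = euler q ^ 24 + q * (24 * deriv euler q * euler q ^ 23)"
    unfolding eta24_conv_euler[abs_def] by (rule DERIV_imp_deriv)
  also have "\<dots> = euler q ^ 24 * e2 q"
    unfolding logderiv_euler[OF assms] e_conv_lambert(1)[OF assms]
    by (simp add: algebra_simps eval_nat_numeral)
  finally show ?thesis by (simp add: eta24_conv_euler)
qed

lemma has_field_derivative_nome_comp:
  assumes "F holomorphic_on ball 0 1" "0 < Im t"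
  shows "((\<lambda>t. F (nome t)) has_field_derivative tpi * (nome t * deriv F (nome t))) (at t)"
proof -
  have "(F has_field_derivative deriv F (nome t)) (at (nome t))"
    by (rule holomorphic_derivI[OF assms(1)]) (use norm_nome_less[OF assms(2)] in auto)
  from DERIV_chain2[OF this has_field_derivative_nome] show ?thesis by (simp add: mult_ac)
qed

lemma has_field_derivative_nome_inversion:
  assumes "F holomorphic_on ball 0 1" "0 < Im t"
  shows "((\<lambda>t. F (nome (- 1 / t))) has_field_derivative tpi * (nome (- 1 / t) * deriv F (nome (- 1 / t))) / t ^ 2) (at t)"
proof -
  have "t \<noteq> 0" using assms(2) by auto
  then have D: "((\<lambda>t. - 1 / t) has_field_derivative 1 / t ^ 2) (at t)"
    by (auto intro!: derivative_eq_intros simp: power2_eq_square)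
  show ?thesis
    using DERIV_chain2[OF has_field_derivative_nome_comp[OF assms(1) Im_minus_inverse[OF assms(2)]] D] by simp
qed

text \<open>\<open>e2\<close> is the logarithmic derivative of \<open>eta24\<close> with respect to
  \<open>q d/dq\<close>, and the term \<open>12 * t / tpi\<close> of \<open>e2_inversion\<close>
  becomes that of \<open>t ^ 12\<close>. So \<open>R\<close> has derivative 0, and its constant
  value is found at the fixed point \<open>\<i>\<close> of the inversion, where
  \<open>\<i> ^ 12 = 1\<close>.\<close>

lemma eta24_inversion:
  assumes "0 < Im t"
  shows "eta24 (nome (- 1 / t)) = t ^ 12 * eta24 (nome t)"
proof -
  define R where "R = (\<lambda>t. eta24 (nome (- 1 / t)) / (t ^ 12 * eta24 (nome t)))"
  have nz: "eta24 (nome s) \<noteq> 0" if "0 < Im s" for s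
    using eta24_nonzero[OF norm_nome_less[OF that]] by simp
  have "(R has_field_derivative 0) (at s)" if s: "0 < Im s" for s
  proof -
    have s0: "s \<noteq> 0" using s by auto
    let ?a = "eta24 (nome (- 1 / s))" and ?b = "eta24 (nome s)" and ?e = "e2 (nome s)"
    have A: "((\<lambda>t. eta24 (nome (- 1 / t))) has_field_derivative (tpi * ?e + 12 / s) * ?a) (at s)"
    proof -
      have "tpi * (nome (- 1 / s) * deriv eta24 (nome (- 1 / s))) / s ^ 2 = tpi * (e2 (nome (- 1 / s)) * ?a) / s ^ 2"
        using deriv_eta24[OF norm_nome_less[OF Im_minus_inverse[OF s]]] by simp
      also have "\<dots> = (tpi * ?e + 12 / s) * ?a"
        unfolding e2_inversion[OF s] using s0 by (simp add: field_simps power2_eq_square)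
      finally show ?thesis
        using has_field_derivative_nome_inversion[OF holomorphic_eta24 s] by simp
    qed
    have B: "((\<lambda>t. eta24 (nome t)) has_field_derivative tpi * (?e * ?b)) (at s)"
      using has_field_derivative_nome_comp[OF holomorphic_eta24 s] deriv_eta24[OF norm_nome_less[OF s]] by simp
    have C: "((\<lambda>t. t ^ 12) has_field_derivative 12 * s ^ 11) (at s)"
      by (auto intro!: derivative_eq_intros)
    have "(R has_field_derivative ((tpi * ?e + 12 / s) * ?a * (s ^ 12 * ?b) - ?a * (s ^ 12 * (tpi * (?e * ?b)) + 12 * s ^ 11 * ?b))
        / ((s ^ 12 * ?b) * (s ^ 12 * ?b))) (at s)"
      unfolding R_def by (rule DERIV_divide[OF A DERIV_mult'[OF C B]]) (use s0 nz[OF s] in auto)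
    moreover have "(tpi * ?e + 12 / s) * ?a * (s ^ 12 * ?b) - ?a * (s ^ 12 * (tpi * (?e * ?b)) + 12 * s ^ 11 * ?b) = 0"
      using s0 by (simp add: eval_nat_numeral field_simps)
    ultimately show ?thesis by (simp only: div_0)
  qed
  then have "\<exists>c. \<forall>s\<in>{z. 0 < Im z}. R s = c"
    by (intro has_field_derivative_zero_constant convex_halfspace_Im_gt) (auto intro: has_field_derivative_at_within)
  then obtain c where c: "\<And>s. 0 < Im s \<Longrightarrow> R s = c" by auto
  have "(\<i>::complex) ^ 12 = 1" by (simp add: eval_nat_numeral)
  then have "R \<i> = 1" unfolding R_def using nz[of \<i>] by simp
  then have "R t = 1" using c[of \<i>] c[OF assms] by simp
  then show ?thesis unfolding R_def using nz[OF assms] assms by (auto simp: divide_simps split: if_splits)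
qed

section \<open>Modular forms as functions of the nome, Ramanujan's identities\<close>

text \<open>As a function of the nome, \<open>F\<close> is invariant under translations by
  construction, and holomorphy at 0 is regularity at the cusp; the inversion is the one condition
  left to state.\<close>

definition modular :: "nat \<Rightarrow> (complex \<Rightarrow> complex) \<Rightarrow> bool" where
  "modular k F \<longleftrightarrow> F holomorphic_on ball 0 1 \<and> (\<forall>t. 0 < Im t \<longrightarrow> F (nome (- 1 / t)) = t ^ k * F (nome t))"

lemma modularI:
  assumes "F holomorphic_on ball 0 1" "\<And>t. 0 < Im t \<Longrightarrow> F (nome (- 1 / t)) = t ^ k * F (nome t)"
  shows "modular k F"
  using assms by (simp add: modular_def)

lemma modularD:
  assumes "modular k F"
  shows "F holomorphic_on ball 0 1" "0 < Im t \<Longrightarrow> F (nome (- 1 / t)) = t ^ k * F (nome t)"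
  using assms by (simp_all add: modular_def)

lemma modular_cong:
  assumes "modular k F" "\<And>q. norm q < 1 \<Longrightarrow> F q = G q"
  shows "modular k G"
proof (rule modularI)
  show "G holomorphic_on ball 0 1"
    by (rule holomorphic_transform[OF modularD(1)[OF assms(1)]]) (use assms in auto)
  show "G (nome (- 1 / t)) = t ^ k * G (nome t)" if "0 < Im t" for t
    using modularD(2)[OF assms(1) that] assms(2) norm_nome_less[OF that] norm_nome_less[OF Im_minus_inverse[OF that]] by simp
qed

lemma modular_add: "modular k F \<Longrightarrow> modular k G \<Longrightarrow> modular k (\<lambda>q. F q + G q)"
  unfolding modular_def by (auto intro!: holomorphic_intros simp: algebra_simps)

lemma modular_diff: "modular k F \<Longrightarrow> modular k G \<Longrightarrow> modular k (\<lambda>q. F q - G q)"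
  unfolding modular_def by (auto intro!: holomorphic_intros simp: algebra_simps)

lemma modular_cmult: "modular k F \<Longrightarrow> modular k (\<lambda>q. c * F q)"
  unfolding modular_def by (auto intro!: holomorphic_intros)

lemma modular_mult: "modular k F \<Longrightarrow> modular l G \<Longrightarrow> m = k + l \<Longrightarrow> modular m (\<lambda>q. F q * G q)"
  unfolding modular_def by (auto intro!: holomorphic_intros simp: power_add)

lemma modular_power: "modular k F \<Longrightarrow> m = k * n \<Longrightarrow> modular m (\<lambda>q. F q ^ n)"
  unfolding modular_def by (auto intro!: holomorphic_intros simp: power_mult_distrib power_mult)

lemma modular_eta24: "modular 12 eta24"
  by (intro modularI holomorphic_eta24 eta24_inversion)

lemma modular_eis_lattice: "even k \<Longrightarrow> k \<ge> 4 \<Longrightarrow> modular k (eis_lattice k)"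
  by (intro modularI eis_lattice_inversion) (auto simp: eis_lattice_def[abs_def] intro!: holomorphic_intros holomorphic_lambert)

lemma nome_add_of_int: "nome (t + of_int m) = nome t"
proof -
  have "exp (tpi * of_int m) = 1"
    by (subst exp_eq_1) (auto simp: tpi_def)
  then show ?thesis by (simp add: nome_def distrib_left exp_add)
qed

section \<open>Vanishing criteria from the order at the cusp\<close>

lemma nome_surj:
  assumes "norm q < 1" "q \<noteq> 0"
  obtains t where "0 < Im t" "nome t = q"
proof
  show "nome (Ln q / tpi) = q" using assms by (simp add: nome_def)
  then have "exp (- 2 * pi * Im (Ln q / tpi)) < 1" using norm_nome assms by metis
  then have "pi * Im (Ln q / tpi) > 0" by simp
  then show "0 < Im (Ln q / tpi)" by (simp add: zero_less_mult_iff)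
qed

text \<open>A point below height 1/2, translated to real part at most 1/2 in absolute value, has
  squared modulus at most 1/2, so inversion at least doubles its height; \<open>n\<close> bounds the
  number of inversions. Height 1/2 is below the optimal sqrt 3 / 2, but makes the doubling
  immediate.\<close>

lemma reduce_to_half:
  assumes "modular 0 F" "(1 / 2) ^ Suc n \<le> Im t"
  shows "\<exists>s. 1 / 2 \<le> Im s \<and> F (nome s) = F (nome t)"
  using assms(2)
proof (induction n arbitrary: t)
  case 0
  then show ?case by auto
next
  case (Suc n)
  show ?case
  proof (cases "1 / 2 \<le> Im t")
    case False
    have pos: "0 < Im t" using Suc.prems by (meson half_gt_zero_iff less_le_trans zero_less_one zero_less_power)
    define u where "u = t + of_int (- round (Re t))"
    have u: "nome u = nome t" unfolding u_def by (rule nome_add_of_int)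
    have iu: "Im u = Im t" by (simp add: u_def)
    have "\<bar>Re u\<bar> \<le> 1 / 2" using of_int_round_abs_le[of "Re t"] by (simp add: u_def abs_minus_commute)
    then have "(Re u)\<^sup>2 \<le> (1 / 2)\<^sup>2" by (metis abs_le_square_iff abs_of_pos half_gt_zero_iff zero_less_one)
    moreover have "(Im u)\<^sup>2 \<le> (1 / 2)\<^sup>2" using False pos iu by (intro power_mono) auto
    ultimately have n: "(Re u)\<^sup>2 + (Im u)\<^sup>2 \<le> 1 / 2" by (simp add: power2_eq_square)
    have n0: "0 < (Re u)\<^sup>2 + (Im u)\<^sup>2" using pos iu by (simp add: sum_power2_gt_zero_iff)
    have "Im (- 1 / u) = Im u / ((Re u)\<^sup>2 + (Im u)\<^sup>2)" by (simp add: Im_divide)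
    also have "\<dots> \<ge> Im u / (1 / 2)" using n n0 pos iu by (intro divide_left_mono) auto
    finally have "2 * Im t \<le> Im (- 1 / u)" using iu by simp
    then have "(1 / 2) ^ Suc n \<le> Im (- 1 / u)" using Suc.prems by simp
    from Suc.IH[OF this] obtain s where "1 / 2 \<le> Im s" "F (nome s) = F (nome (- 1 / u))" by auto
    moreover have "F (nome (- 1 / u)) = F (nome t)"
      using modularD(2)[OF assms(1), of u] pos iu u by simp
    ultimately show ?thesis by auto
  qed auto
qed

text \<open>The points of height at least 1/2 have nome in the closed disc of radius
  \<open>exp (- pi)\<close>, so every value of \<open>F\<close> already occurs in that compact disc.
  Hence \<open>norm (F q)\<close> has a maximum inside the open unit disc, and the maximum modulus
  principle applies.\<close>

lemma modular_0_constant: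
  assumes "modular 0 F" "norm q < 1"
  shows "F q = F 0"
proof -
  note hol = modularD(1)[OF assms(1)]
  let ?K = "cball (0::complex) (exp (- pi))"
  have "exp (- pi) < 1" by simp
  then have sub: "?K \<subseteq> ball 0 1" by (auto simp del: exp_less_one_iff)
  have "continuous_on ?K (\<lambda>q. norm (F q))"
    by (intro continuous_intros holomorphic_on_imp_continuous_on holomorphic_on_subset[OF hol sub])
  then obtain q0 where q0: "q0 \<in> ?K" "\<And>q. q \<in> ?K \<Longrightarrow> norm (F q) \<le> norm (F q0)"
    using continuous_attains_sup[of ?K "\<lambda>q. norm (F q)"] by fastforce
  have "norm (F p) \<le> norm (F q0)" if p: "p \<in> ball 0 1" for p
  proof (cases "p = 0")
    case True
    then show ?thesis using q0(2)[of 0] by simp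
  next
    case False
    then obtain t where t: "0 < Im t" "nome t = p" using nome_surj[of p] p by auto
    obtain n where "(1 / 2) ^ n < Im t" using real_arch_pow_inv[of "Im t" "1 / 2"] t(1) by auto
    then have "(1 / 2) ^ Suc n \<le> Im t" by (simp add: field_simps)
    from reduce_to_half[OF assms(1) this] obtain s where s: "1 / 2 \<le> Im s" "F (nome s) = F p"
      using t by auto
    have "nome s \<in> ?K" using s(1) by (simp add: norm_nome)
    then show ?thesis using q0(2) s(2) by metis
  qed
  then have "F constant_on ball 0 1"
    using maximum_modulus_principle[OF hol open_ball connected_ball open_ball order_refl, of q0] q0(1) sub by blast
  then show ?thesis using assms(2) unfolding constant_on_def by auto
qed

lemma holomorphic_factor_root:
  assumes "F holomorphic_on ball 0 r" "F 0 = 0"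
  obtains G :: "complex \<Rightarrow> complex" where "G holomorphic_on ball 0 r" "\<And>q. norm q < r \<Longrightarrow> F q = q * G q" "G 0 = deriv F 0"
proof
  let ?G = "\<lambda>q. if q = 0 then deriv F 0 else F q / q"
  show "?G holomorphic_on ball 0 r"
    by (rule pole_theorem_open_0[of F _ 0]) (use assms in auto)
qed (use assms in auto)

lemma modular_eq_0:
  assumes F: "modular k F" and G: "G holomorphic_on ball 0 1"
    and FG: "\<And>q. norm q < 1 \<Longrightarrow> F q = q ^ N * G q" and k: "k < 12 * N" and q: "norm q < 1"
  shows "F q = 0"
proof -
  \<comment> \<open>This is \<open>F ^ 12 / eta24 ^ k\<close> with the powers of \<open>q\<close>
    already cancelled, so the formula makes sense at 0 as well. The 12th power balances the weights,
    and \<open>k < 12 * N\<close> leaves a positive power of \<open>q\<close>; \<open>euler\<close>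
    has no zeros in the disc.\<close>
  define H where "H = (\<lambda>q. q ^ (12 * N - k) * G q ^ 12 / euler q ^ (24 * k))"
  have H: "H (nome t) = F (nome t) ^ 12 / eta24 (nome t) ^ k" if "0 < Im t" for t
  proof -
    have n: "norm (nome t) < 1" by (rule norm_nome_less[OF that])
    have "(nome t ^ N) ^ 12 = nome t ^ (12 * N - k) * nome t ^ k"
      using k by (simp add: power_add[symmetric] power_mult[symmetric] mult.commute)
    then show ?thesis
      unfolding H_def FG[OF n] eta24_conv_euler using euler_nonzero[OF n]
      by (simp add: power_mult_distrib power_mult)
  qed
  have "modular 0 H"
  proof (rule modularI)
    show "H holomorphic_on ball 0 1"
      unfolding H_def by (intro holomorphic_intros G holomorphic_euler) (use euler_nonzero in auto)
    fix t :: complex assume t: "0 < Im t"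
    have t0: "t \<noteq> 0" using t by auto
    show "H (nome (- 1 / t)) = t ^ 0 * H (nome t)"
      unfolding H[OF t] H[OF Im_minus_inverse[OF t]] modularD(2)[OF F t] eta24_inversion[OF t]
      using t0 by (simp add: power_mult_distrib power_mult[symmetric] mult.commute)
  qed
  then have "H q = H 0" using q by (rule modular_0_constant)
  also have "H 0 = 0" using k by (simp add: H_def)
  finally show ?thesis
    using q euler_nonzero[OF q] k FG[OF q] by (auto simp: H_def)
qed

lemma modular_eq_0_simple:
  assumes F: "modular k F" and "F 0 = 0" "k < 12" "norm q < 1"
  shows "F q = 0"
proof -
  obtain G where G: "G holomorphic_on ball 0 1" "\<And>q. norm q < 1 \<Longrightarrow> F q = q * G q"
    using holomorphic_factor_root[OF modularD(1)[OF F] assms(2)] by metis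
  show ?thesis
    by (rule modular_eq_0[OF F G(1), of 1]) (use G assms in auto)
qed

section \<open>The Serre derivative and Ramanujan's identities\<close>

lemma holomorphic_euler_operator: "F holomorphic_on ball 0 1 \<Longrightarrow> (\<lambda>q. q * deriv F q) holomorphic_on ball 0 1"
  by (intro holomorphic_intros) auto

text \<open>Differentiating the transformation law leaves an extra term proportional to
  \<open>of_nat k * t ^ (k + 1) * F (nome t)\<close>; the inhomogeneous term of
  \<open>e2_inversion\<close> cancels it.\<close>

lemma modular_serre_derivative:
  assumes F: "modular k F"
  shows "modular (k + 2) (\<lambda>q. 12 * (q * deriv F q) - of_nat k * e2 q * F q)"
proof (rule modularI)
  show "(\<lambda>q. 12 * (q * deriv F q) - of_nat k * e2 q * F q) holomorphic_on ball 0 1"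
    by (intro holomorphic_intros holomorphic_e holomorphic_euler_operator modularD(1)[OF F]) auto
  fix t :: complex assume t: "0 < Im t"
  have t0: "t \<noteq> 0" using t by auto
  let ?D = "\<lambda>t. nome t * deriv F (nome t)"
  have pow: "((\<lambda>t. t ^ k) has_field_derivative of_nat k * t ^ k / t) (at t)"
    using DERIV_power_Suc[OF DERIV_ident, of "k - 1" t UNIV] t0 by (cases k) auto
  have "((\<lambda>t. F (nome (- 1 / t))) has_field_derivative t ^ k * (tpi * ?D t) + of_nat k * t ^ k / t * F (nome t)) (at t)"
  proof (rule has_field_derivative_transform_within_open[OF _ open_upper])
    show "((\<lambda>t. t ^ k * F (nome t)) has_field_derivative t ^ k * (tpi * ?D t) + of_nat k * t ^ k / t * F (nome t)) (at t)"
      by (rule DERIV_mult'[OF pow has_field_derivative_nome_comp[OF modularD(1)[OF F] t]])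
  qed (use t modularD(2)[OF F] in auto)
  then have "tpi * ?D (- 1 / t) / t ^ 2 = t ^ k * (tpi * ?D t) + of_nat k * t ^ k / t * F (nome t)"
    by (rule DERIV_unique[OF has_field_derivative_nome_inversion[OF modularD(1)[OF F] t]])
  then have D': "?D (- 1 / t) = t ^ 2 / tpi * (t ^ k * (tpi * ?D t) + of_nat k * t ^ k / t * F (nome t))"
    using t0 by (simp add: field_simps)
  show "12 * ?D (- 1 / t) - of_nat k * e2 (nome (- 1 / t)) * F (nome (- 1 / t))
      = t ^ (k + 2) * (12 * ?D t - of_nat k * e2 (nome t) * F (nome t))"
    unfolding e2_inversion[OF t] modularD(2)[OF F t] D' using t0
    by (simp add: power_add power2_eq_square field_simps)
qed

text \<open>Squaring \<open>e2_inversion\<close> and twelve times its derivative produce the same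
  inhomogeneous terms,
  \<open>24 * t ^ 3 * e2 (nome t) / tpi + 144 * t ^ 2 / tpi ^ 2\<close>.\<close>

lemma modular_e2_derivative: "modular 4 (\<lambda>q. e2 q ^ 2 - 12 * (q * deriv e2 q))"
proof (rule modularI)
  show "(\<lambda>q. e2 q ^ 2 - 12 * (q * deriv e2 q)) holomorphic_on ball 0 1"
    by (intro holomorphic_intros holomorphic_e holomorphic_euler_operator) auto
  fix t :: complex assume t: "0 < Im t"
  have t0: "t \<noteq> 0" using t by auto
  let ?D = "\<lambda>t. nome t * deriv e2 (nome t)"
  have "((\<lambda>t. e2 (nome (- 1 / t))) has_field_derivative t ^ 2 * (tpi * ?D t) + 2 * t * e2 (nome t) + 12 / tpi) (at t)"
  proof (rule has_field_derivative_transform_within_open[OF _ open_upper])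
    show "((\<lambda>t. t ^ 2 * e2 (nome t) + 12 * t / tpi) has_field_derivative t ^ 2 * (tpi * ?D t) + 2 * t * e2 (nome t) + 12 / tpi) (at t)"
      by (rule DERIV_add[OF DERIV_mult'[OF _ has_field_derivative_nome_comp[OF holomorphic_e(1) t]]])
         (auto intro!: derivative_eq_intros)
  qed (use t e2_inversion in auto)
  then have "tpi * ?D (- 1 / t) / t ^ 2 = t ^ 2 * (tpi * ?D t) + 2 * t * e2 (nome t) + 12 / tpi"
    by (rule DERIV_unique[OF has_field_derivative_nome_inversion[OF holomorphic_e(1) t]])
  then have D': "?D (- 1 / t) = t ^ 2 / tpi * (t ^ 2 * (tpi * ?D t) + 2 * t * e2 (nome t) + 12 / tpi)"
    using t0 by (simp add: field_simps)
  show "e2 (nome (- 1 / t)) ^ 2 - 12 * ?D (- 1 / t) = t ^ 4 * (e2 (nome t) ^ 2 - 12 * ?D t)"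
    unfolding e2_inversion[OF t] D' using t0
    by (simp add: power2_eq_square eval_nat_numeral field_simps)
qed

text \<open>The constant term of the lattice sum is found by comparing the first two Taylor
  coefficients, so no value of the zeta function at 4 or 6 is needed.\<close>

lemma modular_eq_eisenstein:
  assumes F: "modular k F" "F 0 = 1" "deriv F 0 = c" "c \<noteq> 0" and k: "k = 4 \<or> k = 6" and q: "norm q < 1"
  shows "F q = 1 + c * (q * lambert (k - 1) q)"
proof -
  have k': "even k" "k \<ge> 4" "k < 12" using k by auto
  let ?Z = "zeta_sum k" and ?K = "eis_scale k"
  have "modular k (\<lambda>q. ?Z * F q - eis_lattice k q)"
    by (intro modular_diff modular_cmult F modular_eis_lattice k')
  then have "?Z * F p - eis_lattice k p = 0" if "norm p < 1" for p
    by (rule modular_eq_0_simple) (use F k' that in \<open>auto simp: eis_lattice_def\<close>)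
  then have eq: "?Z * F p = ?Z + ?K * (p * lambert (k - 1) p)" if "norm p < 1" for p
    using that by (auto simp: eis_lattice_def)
  have "((\<lambda>q. ?Z * F q) has_field_derivative ?Z * c) (at 0)"
    using holomorphic_derivI[OF modularD(1)[OF F(1)], of 0] F(3) by (intro DERIV_cmult) auto
  moreover have "((\<lambda>q. ?Z * F q) has_field_derivative ?K) (at 0)"
    by (rule has_field_derivative_transform_within_open[OF has_field_derivative_lambert_0[of ?Z ?K "k - 1"], of "ball 0 1"])
       (use eq in auto)
  ultimately have ZK: "?Z * c = ?K" by (rule DERIV_unique)
  have "?K \<noteq> 0" by (simp add: eis_scale_def)
  then have "?Z \<noteq> 0" using ZK by auto
  moreover have "?Z * F q = ?Z * (1 + c * (q * lambert (k - 1) q))"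
    using eq[OF q] unfolding ZK[symmetric] by (simp add: algebra_simps)
  ultimately show ?thesis by simp
qed

lemma DERIV_e: 
  assumes "norm q < 1"
  shows "(e2 has_field_derivative deriv e2 q) (at q)" "(e4 has_field_derivative deriv e4 q) (at q)"
    "(e6 has_field_derivative deriv e6 q) (at q)"
  using assms by (auto intro!: holomorphic_derivI[OF _ open_ball] holomorphic_e)

lemma DERIV_euler_operator:
  assumes "F holomorphic_on ball 0 1"
  shows "((\<lambda>q. q * deriv F q) has_field_derivative deriv F 0) (at 0)"
proof -
  have "deriv F holomorphic_on ball 0 1" using assms by (intro holomorphic_deriv) auto
  from holomorphic_derivI[OF this open_ball, of 0] show ?thesis
    by (auto intro!: derivative_eq_intros)
qed

text \<open>The weight-four form above starts with 1 + 240 q, which identifies it with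
  \<open>e4\<close> by \<open>modular_eq_eisenstein\<close>. Modularity of \<open>e4\<close> is thus
  a consequence of this identity.\<close>

lemma ramanujan_e2: assumes "norm q < 1" shows "12 * (q * deriv e2 q) = e2 q ^ 2 - e4 q"
proof -
  have "((\<lambda>q. e2 q ^ 2 - 12 * (q * deriv e2 q)) has_field_derivative
      of_nat 2 * (deriv e2 0 * e2 0 ^ (2 - Suc 0)) - 12 * deriv e2 0) (at 0)"
    by (intro DERIV_diff DERIV_power DERIV_cmult DERIV_e DERIV_euler_operator holomorphic_e) simp
  then have "deriv (\<lambda>q. e2 q ^ 2 - 12 * (q * deriv e2 q)) 0 = 240"
    by (subst DERIV_imp_deriv) (simp_all add: deriv_e_0)
  from modular_eq_eisenstein[OF modular_e2_derivative _ this _ _ assms]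
  have "e2 q ^ 2 - 12 * (q * deriv e2 q) = 1 + 240 * (q * lambert 3 q)" by simp
  then show ?thesis unfolding e_conv_lambert(2)[OF assms] by (simp add: algebra_simps)
qed

lemma modular_e4: "modular 4 e4"
  by (rule modular_cong[OF modular_e2_derivative]) (simp add: ramanujan_e2)

lemma ramanujan_e4: assumes "norm q < 1" shows "3 * (q * deriv e4 q) = e2 q * e4 q - e6 q"
proof -
  \<comment> \<open>The Serre derivative of \<open>e4\<close> takes the value -4 at 0; the factor
    normalises it to 1.\<close>
  let ?F = "\<lambda>q. (- 1 / 4) * (12 * (q * deriv e4 q) - of_nat 4 * e2 q * e4 q)"
  have F: "modular 6 ?F"
    using modular_cmult[OF modular_serre_derivative[OF modular_e4], where c = "- 1 / 4"] by simp
  have "(?F has_field_derivative (- 1 / 4) * (12 * deriv e4 0 - ((of_nat 4 * deriv e2 0) * e4 0 + deriv e4 0 * (of_nat 4 * e2 0)))) (at 0)"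
    by (intro DERIV_diff DERIV_mult DERIV_cmult DERIV_e DERIV_euler_operator holomorphic_e) simp_all
  from DERIV_imp_deriv[OF this] have "deriv ?F 0 = -504"
    by (simp only: deriv_e_0 e_0) simp
  from modular_eq_eisenstein[OF F _ this _ _ assms]
  have "?F q = 1 - 504 * (q * lambert 5 q)" by simp
  then show ?thesis unfolding e_conv_lambert(3)[OF assms] by (simp add: algebra_simps)
qed

lemma modular_e6: "modular 6 e6"
proof (rule modular_cong)
  show "modular 6 (\<lambda>q. (- 1 / 4) * (12 * (q * deriv e4 q) - of_nat 4 * e2 q * e4 q))"
    using modular_cmult[OF modular_serre_derivative[OF modular_e4], where c = "- 1 / 4"] by simp
  show "(- 1 / 4) * (12 * (q * deriv e4 q) - of_nat 4 * e2 q * e4 q) = e6 q" if "norm q < 1" for q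
    using ramanujan_e4[OF that] by (simp add: algebra_simps)
qed

text \<open>The Serre derivative of \<open>e6\<close> has value -6 at 0, so adding
  \<open>6 * e4 q ^ 2\<close> gives a form of weight 8 < 12 that vanishes at the cusp.\<close>

lemma ramanujan_e6: assumes "norm q < 1" shows "2 * (q * deriv e6 q) = e2 q * e6 q - e4 q ^ 2"
proof -
  have "modular 8 (\<lambda>q. (12 * (q * deriv e6 q) - of_nat 6 * e2 q * e6 q) + 6 * e4 q ^ 2)"
    using modular_add[OF modular_serre_derivative[OF modular_e6] modular_cmult[OF modular_power[OF modular_e4, of _ 2], where c = 6]] by simp
  then have "(12 * (q * deriv e6 q) - of_nat 6 * e2 q * e6 q) + 6 * e4 q ^ 2 = 0"
    by (rule modular_eq_0_simple) (use assms in auto)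
  then have "6 * (2 * (q * deriv e6 q)) = 6 * (e2 q * e6 q - e4 q ^ 2)" by (simp add: algebra_simps)
  then show ?thesis by (simp only: mult_cancel_left) simp
qed

text \<open>In weight 12 a simple zero at the cusp is not enough for \<open>modular_eq_0\<close>, so
  the coefficient of \<open>q\<close> is compared too: 1728 = 3 * 240 + 2 * 504. The resulting
  double zero gives 12 < 24.\<close>

lemma eta24_discriminant: assumes "norm q < 1" shows "e4 q ^ 3 - e6 q ^ 2 = 1728 * eta24 q"
proof -
  define F where "F = (\<lambda>q. e4 q ^ 3 - e6 q ^ 2 - 1728 * eta24 q)"
  have F: "modular 12 F"
    unfolding F_def
    by (intro modular_diff modular_cmult modular_eta24 modular_power[OF modular_e4] modular_power[OF modular_e6]) simp_all
  have F0: "F 0 = 0" by (simp add: F_def eta24_conv_euler)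
  have "(euler has_field_derivative deriv euler 0) (at 0)"
    by (rule holomorphic_derivI[OF holomorphic_euler]) auto
  then have "(eta24 has_field_derivative 1) (at 0)"
    unfolding eta24_conv_euler[abs_def] by (auto intro!: derivative_eq_intros)
  then have "(F has_field_derivative 0) (at 0)"
    unfolding F_def using DERIV_e[of 0] by (auto intro!: derivative_eq_intros simp: deriv_e_0)
  then have F1: "deriv F 0 = 0" by (rule DERIV_imp_deriv)
  obtain G where G: "G holomorphic_on ball 0 1" "\<And>q. norm q < 1 \<Longrightarrow> F q = q * G q" "G 0 = 0"
    using holomorphic_factor_root[OF modularD(1)[OF F] F0] F1 by metis
  obtain H where H: "H holomorphic_on ball 0 1" "\<And>q. norm q < 1 \<Longrightarrow> G q = q * H q"
    using holomorphic_factor_root[OF G(1,3)] by metis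
  have "F q = 0"
    by (rule modular_eq_0[OF F H(1), of 2]) (use G H assms in \<open>auto simp: power2_eq_square\<close>)
  then show ?thesis by (simp add: F_def)
qed

text \<open>There is no form of weight two: its square and cube would be multiples of \<open>e4\<close> and
  \<open>e6\<close>, and \<open>e4 ^ 3\<close>, \<open>e6 ^ 2\<close> are not proportional.\<close>

lemma modular_2_eq_0:
  assumes F: "modular 2 F" and q: "norm q < 1"
  shows "F q = 0"
proof -
  define a where "a = F 0"
  have 2: "F p ^ 2 = a ^ 2 * e4 p" if "norm p < 1" for p
  proof -
    have "modular 4 (\<lambda>p. F p ^ 2 - a ^ 2 * e4 p)"
      by (intro modular_diff modular_power[OF F] modular_cmult modular_e4) simp
    then have "F p ^ 2 - a ^ 2 * e4 p = 0"
      by (rule modular_eq_0_simple) (use that in \<open>auto simp: a_def\<close>)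
    then show ?thesis by simp
  qed
  have 3: "F p ^ 3 = a ^ 3 * e6 p" if "norm p < 1" for p
  proof -
    have "modular 6 (\<lambda>p. F p ^ 3 - a ^ 3 * e6 p)"
      by (intro modular_diff modular_power[OF F] modular_cmult modular_e6) simp
    then have "F p ^ 3 - a ^ 3 * e6 p = 0"
      by (rule modular_eq_0_simple) (use that in \<open>auto simp: a_def\<close>)
    then show ?thesis by simp
  qed
  have "a = 0"
  proof (rule ccontr)
    assume "a \<noteq> 0"
    have "e4 p ^ 3 = e6 p ^ 2" if "norm p < 1" for p
    proof -
      have "a ^ 6 * e4 p ^ 3 = (F p ^ 2) ^ 3" unfolding 2[OF that] by (simp add: power_mult_distrib flip: power_mult)
      also have "\<dots> = (F p ^ 3) ^ 2" by (simp flip: power_mult)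
      also have "\<dots> = a ^ 6 * e6 p ^ 2" unfolding 3[OF that] by (simp add: power_mult_distrib flip: power_mult)
      finally show ?thesis using \<open>a \<noteq> 0\<close> by simp
    qed
    from this[of "1 / 2"] eta24_discriminant[of "1 / 2"] eta24_nonzero[of "1 / 2"] show False by (simp add: norm_divide)
  qed
  then show ?thesis using 2[OF q] by simp
qed

text \<open>Here the order of vanishing falls just short of \<open>modular_eq_0\<close>. Dividing by
  \<open>eta24 ^ N\<close> uses up the zero and leaves a form of weight two.\<close>

lemma modular_eq_0':
  assumes F: "modular (12 * N + 2) F" and G: "G holomorphic_on ball 0 1"
    and FG: "\<And>q. norm q < 1 \<Longrightarrow> F q = q ^ N * G q" and q: "norm q < 1"
  shows "F q = 0"
proof -
  define H where "H = (\<lambda>q. G q / euler q ^ (24 * N))"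
  have H: "F q = eta24 q ^ N * H q" if "norm q < 1" for q
    unfolding H_def eta24_conv_euler FG[OF that] using euler_nonzero[OF that]
    by (simp add: power_mult_distrib power_mult)
  have "modular 2 H"
  proof (rule modularI)
    show "H holomorphic_on ball 0 1"
      unfolding H_def by (intro holomorphic_intros G holomorphic_euler) (use euler_nonzero in auto)
    fix t :: complex assume t: "0 < Im t"
    have t0: "t \<noteq> 0" using t by auto
    have n: "norm (nome t) < 1" "norm (nome (- 1 / t)) < 1"
      by (rule norm_nome_less[OF t] norm_nome_less[OF Im_minus_inverse[OF t]])+
    have "(t ^ 12 * eta24 (nome t)) ^ N * H (nome (- 1 / t)) = t ^ (12 * N + 2) * (eta24 (nome t) ^ N * H (nome t))"
      using modularD(2)[OF F t] unfolding H[OF n(1)] H[OF n(2)] eta24_inversion[OF t] .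
    then show "H (nome (- 1 / t)) = t ^ 2 * H (nome t)"
      using t0 eta24_nonzero[OF n(1)] by (simp add: power_mult_distrib power_mult power_add power2_eq_square)
  qed
  then show ?thesis using modular_2_eq_0[OF _ q] H[OF q] by simp
qed

section \<open>Quasimodular polynomials\<close>

definition qidx :: "nat \<Rightarrow> nat \<Rightarrow> (nat \<times> nat \<times> nat) set" where
  "qidx K m = {(a, b, k). 4 * a + 6 * b + 2 * k = K \<and> k \<le> m}"

definition eis_mono :: "nat \<times> nat \<times> nat \<Rightarrow> complex \<Rightarrow> complex" where
  "eis_mono = (\<lambda>(a, b, k) q. e4 q ^ a * e6 q ^ b * e2 q ^ k)"

text \<open>\<open>K\<close> is the weight, and \<open>m\<close> bounds the depth, that is, the
  degree in \<open>e2\<close>. For even weight, depth 0 gives exactly the functions satisfying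
  \<open>modular K\<close>, by \<open>modular_qm\<close> and \<open>modular_is_qm\<close>.\<close>

definition qm :: "nat \<Rightarrow> nat \<Rightarrow> (complex \<Rightarrow> complex) \<Rightarrow> bool" where
  "qm K m F \<longleftrightarrow> (\<exists>c. \<forall>q. norm q < 1 \<longrightarrow> F q = (\<Sum>x\<in>qidx K m. c x * eis_mono x q))"

lemma finite_qidx [simp]: "finite (qidx K m)"
proof (rule finite_subset)
  show "qidx K m \<subseteq> {..K} \<times> {..K} \<times> {..K}" by (auto simp: qidx_def)
qed simp

lemma holomorphic_eis_mono: "eis_mono x holomorphic_on ball 0 1"
  unfolding eis_mono_def by (cases x) (auto intro!: holomorphic_intros holomorphic_e)

lemma qm_cong: "qm K m F \<Longrightarrow> (\<And>q. norm q < 1 \<Longrightarrow> F q = G q) \<Longrightarrow> qm K m G"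
  unfolding qm_def by metis

lemma qm_0: "qm K m (\<lambda>q. 0)"
  unfolding qm_def by (rule exI[of _ "\<lambda>_. 0"]) simp

lemma qm_add: assumes "qm K m F" "qm K m G" shows "qm K m (\<lambda>q. F q + G q)"
proof -
  obtain c d where "\<And>q. norm q < 1 \<Longrightarrow> F q = (\<Sum>x\<in>qidx K m. c x * eis_mono x q)"
    "\<And>q. norm q < 1 \<Longrightarrow> G q = (\<Sum>x\<in>qidx K m. d x * eis_mono x q)"
    using assms unfolding qm_def by metis
  then show ?thesis unfolding qm_def
    by (intro exI[of _ "\<lambda>x. c x + d x"]) (simp add: sum.distrib distrib_right)
qed

lemma qm_cmult: assumes "qm K m F" shows "qm K m (\<lambda>q. c * F q)"
proof -
  obtain d where "\<And>q. norm q < 1 \<Longrightarrow> F q = (\<Sum>x\<in>qidx K m. d x * eis_mono x q)"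
    using assms unfolding qm_def by metis
  then show ?thesis unfolding qm_def
    by (intro exI[of _ "\<lambda>x. c * d x"]) (simp add: sum_distrib_left mult.assoc)
qed

lemma qm_diff: "qm K m F \<Longrightarrow> qm K m G \<Longrightarrow> qm K m (\<lambda>q. F q - G q)"
  using qm_add[of K m F "\<lambda>q. (- 1) * G q"] qm_cmult[of K m G "- 1"] by simp

lemma qm_sum: "(\<And>x. x \<in> A \<Longrightarrow> qm K m (F x)) \<Longrightarrow> qm K m (\<lambda>q. \<Sum>x\<in>A. F x q)"
  by (induction A rule: infinite_finite_induct) (auto intro: qm_0 qm_add)

lemma qm_eis_mono: "x \<in> qidx K m \<Longrightarrow> qm K m (eis_mono x)"
  unfolding qm_def
  by (rule exI[of _ "\<lambda>y. if y = x then 1 else 0"]) (simp add: if_distrib[of "\<lambda>z. z * _"] cong: if_cong)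

lemma qm_mult:
  assumes "qm K m F" "qm L n G" and [simp]: "M = K + L" "p = m + n"
  shows "qm M p (\<lambda>q. F q * G q)"
proof -
  obtain c d where F: "\<And>q. norm q < 1 \<Longrightarrow> F q = (\<Sum>x\<in>qidx K m. c x * eis_mono x q)"
    and G: "\<And>q. norm q < 1 \<Longrightarrow> G q = (\<Sum>x\<in>qidx L n. d x * eis_mono x q)"
    using assms unfolding qm_def by metis
  have "qm M p (\<lambda>q. \<Sum>x\<in>qidx K m. \<Sum>y\<in>qidx L n. (c x * d y) * (eis_mono x q * eis_mono y q))"
  proof (intro qm_sum qm_cmult)
    fix x y assume "x \<in> qidx K m" "y \<in> qidx L n"
    then obtain a b k a' b' k' where xy: "x = (a, b, k)" "y = (a', b', k')"
      "(a + a', b + b', k + k') \<in> qidx M p"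
      by (cases x; cases y) (auto simp: qidx_def)
    show "qm M p (\<lambda>q. eis_mono x q * eis_mono y q)"
      by (rule qm_cong[OF qm_eis_mono[OF xy(3)]]) (simp add: xy eis_mono_def power_add)
  qed
  then show ?thesis
    by (rule qm_cong) (simp add: F G sum_product mult_ac)
qed

lemma qm_1: "qm 0 0 (\<lambda>q. 1)"
  by (rule qm_cong[OF qm_eis_mono[of "(0, 0, 0)"]]) (auto simp: qidx_def eis_mono_def)

lemma qm_power: "qm K m F \<Longrightarrow> M = K * n \<Longrightarrow> p = m * n \<Longrightarrow> qm M p (\<lambda>q. F q ^ n)"
proof (induction n arbitrary: M p)
  case (Suc n)
  have "qm M p (\<lambda>q. F q * F q ^ n)"
    by (rule qm_mult[OF Suc.prems(1) Suc.IH[OF Suc.prems(1) refl refl]]) (use Suc.prems in auto)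
  then show ?case by simp
qed (auto intro: qm_1)

lemma qm_e: "qm 2 1 e2" "qm 4 0 e4" "qm 6 0 e6"
  by (rule qm_cong[OF qm_eis_mono[of "(0, 0, 1)"]], auto simp: qidx_def eis_mono_def)
     (rule qm_cong[OF qm_eis_mono[of "(1, 0, 0)"]], auto simp: qidx_def eis_mono_def,
      rule qm_cong[OF qm_eis_mono[of "(0, 1, 0)"]], auto simp: qidx_def eis_mono_def)

lemma qm_mono_le: assumes "qm K m F" "m \<le> n" shows "qm K n F"
proof -
  obtain c where F: "\<And>q. norm q < 1 \<Longrightarrow> F q = (\<Sum>x\<in>qidx K m. c x * eis_mono x q)"
    using assms unfolding qm_def by metis
  have "qm K n (\<lambda>q. \<Sum>x\<in>qidx K m. c x * eis_mono x q)"
    by (intro qm_sum qm_cmult qm_eis_mono) (use assms(2) in \<open>auto simp: qidx_def\<close>)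
  then show ?thesis by (rule qm_cong) (simp add: F)
qed

lemma qm_eta24: "qm 12 0 eta24"
proof (rule qm_cong)
  show "qm 12 0 (\<lambda>q. (1 / 1728) * (e4 q ^ 3 - e6 q ^ 2))"
    by (intro qm_cmult qm_diff qm_power[OF qm_e(2)] qm_power[OF qm_e(3)]) auto
qed (simp add: eta24_discriminant)

lemma holomorphic_qm: assumes "qm K m F" shows "F holomorphic_on ball 0 1"
proof -
  obtain c where F: "\<And>q. norm q < 1 \<Longrightarrow> F q = (\<Sum>x\<in>qidx K m. c x * eis_mono x q)"
    using assms unfolding qm_def by metis
  have "(\<lambda>q. \<Sum>x\<in>qidx K m. c x * eis_mono x q) holomorphic_on ball 0 1"
    by (intro holomorphic_intros holomorphic_eis_mono)
  then show ?thesis by (rule holomorphic_transform) (simp add: F)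
qed

lemma qm_euler_e:
  "qm 4 2 (\<lambda>q. q * deriv e2 q)" "qm 6 1 (\<lambda>q. q * deriv e4 q)" "qm 8 1 (\<lambda>q. q * deriv e6 q)"
proof -
  have "qm 4 2 (\<lambda>q. (1 / 12) * (e2 q ^ 2 - e4 q))"
    by (intro qm_cmult qm_diff qm_power[OF qm_e(1)] qm_mono_le[OF qm_e(2)]) auto
  then show "qm 4 2 (\<lambda>q. q * deriv e2 q)"
    by (rule qm_cong) (simp flip: ramanujan_e2)
  have "qm 6 1 (\<lambda>q. (1 / 3) * (e2 q * e4 q - e6 q))"
    by (intro qm_cmult qm_diff qm_mult[OF qm_e(1,2)] qm_mono_le[OF qm_e(3)]) auto
  then show "qm 6 1 (\<lambda>q. q * deriv e4 q)"
    by (rule qm_cong) (simp flip: ramanujan_e4)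
  have "qm 8 1 (\<lambda>q. (1 / 2) * (e2 q * e6 q - e4 q ^ 2))"
    by (intro qm_cmult qm_diff qm_mult[OF qm_e(1,3)] qm_mono_le[OF qm_power[OF qm_e(2)]]) auto
  then show "qm 8 1 (\<lambda>q. q * deriv e6 q)"
    by (rule qm_cong) (simp flip: ramanujan_e6)
qed

lemma qm_euler_power:
  assumes F: "qm K m F" "qm K' m' (\<lambda>q. q * deriv F q)" "K' = K + 2" "m' = m + 1"
  shows "qm (K * n + 2) (m * n + 1) (\<lambda>q. q * deriv (\<lambda>q. F q ^ n) q)"
proof (cases n)
  case 0
  then show ?thesis by (simp add: qm_0)
next
  case (Suc i)
  have "qm (K * n + 2) (m * n + 1) (\<lambda>q. of_nat n * ((q * deriv F q) * F q ^ i))"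
    by (intro qm_cmult qm_mult[OF F(2) qm_power[OF F(1)]]) (auto simp: Suc F(3,4))
  moreover have "deriv (\<lambda>q. F q ^ n) q = of_nat n * (deriv F q * F q ^ i)" if "norm q < 1" for q
    unfolding Suc
    using DERIV_power_Suc[OF holomorphic_derivI[OF holomorphic_qm[OF F(1)] open_ball, of q UNIV], of i] that
    by (intro DERIV_imp_deriv) simp
  ultimately show ?thesis
    by (elim qm_cong) (simp add: mult_ac)
qed

text \<open>Ramanujan's identities settle the three generators, and the product rule extends them to
  monomials; each summand differentiates a single factor, so the depth grows by at most one.\<close>

lemma qm_euler:
  assumes "qm K m F"
  shows "qm (K + 2) (m + 1) (\<lambda>q. q * deriv F q)"
proof -
  obtain c where F: "\<And>q. norm q < 1 \<Longrightarrow> F q = (\<Sum>x\<in>qidx K m. c x * eis_mono x q)"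
    using assms unfolding qm_def by metis
  have D: "qm (K + 2) (m + 1) (\<lambda>q. q * deriv (eis_mono x) q)" if "x \<in> qidx K m" for x
  proof -
    obtain a b k where x: "x = (a, b, k)" "4 * a + 6 * b + 2 * k = K" "k \<le> m"
      using \<open>x \<in> qidx K m\<close> by (auto simp: qidx_def)
    note p = qm_power[OF qm_e(2) refl refl, of a] qm_power[OF qm_e(3) refl refl, of b]
       qm_power[OF qm_e(1) refl refl, of k]
    have d: "qm (4 * a + 2) 1 (\<lambda>q. q * deriv (\<lambda>q. e4 q ^ a) q)"
         "qm (6 * b + 2) 1 (\<lambda>q. q * deriv (\<lambda>q. e6 q ^ b) q)"
         "qm (2 * k + 2) (k + 1) (\<lambda>q. q * deriv (\<lambda>q. e2 q ^ k) q)"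
      using qm_euler_power[OF qm_e(2) qm_euler_e(2), of a] qm_euler_power[OF qm_e(3) qm_euler_e(3), of b]
        qm_euler_power[OF qm_e(1) qm_euler_e(1), of k] by simp_all
    have "qm (K + 2) (k + 1) (\<lambda>q. (q * deriv (\<lambda>q. e4 q ^ a) q) * (e6 q ^ b * e2 q ^ k)
        + e4 q ^ a * ((q * deriv (\<lambda>q. e6 q ^ b) q) * e2 q ^ k)
        + e4 q ^ a * (e6 q ^ b * (q * deriv (\<lambda>q. e2 q ^ k) q)))"
      using x(2)
      by (intro qm_add qm_mult[OF d(1) qm_mult[OF p(2,3) refl refl]]
          qm_mult[OF p(1) qm_mult[OF d(2) p(3) refl refl]]
          qm_mult[OF p(1) qm_mult[OF p(2) d(3) refl refl]]) auto
    moreover have "deriv (eis_mono x) q = deriv (\<lambda>q. e4 q ^ a) q * (e6 q ^ b * e2 q ^ k)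
        + e4 q ^ a * (deriv (\<lambda>q. e6 q ^ b) q * e2 q ^ k + e6 q ^ b * deriv (\<lambda>q. e2 q ^ k) q)" if "norm q < 1" for q
    proof (rule DERIV_imp_deriv)
      have h: "(\<lambda>q. e4 q ^ a) holomorphic_on ball 0 1" "(\<lambda>q. e6 q ^ b) holomorphic_on ball 0 1"
        "(\<lambda>q. e2 q ^ k) holomorphic_on ball 0 1"
        by (intro holomorphic_intros holomorphic_e)+
      have q: "q \<in> ball 0 1" using that by simp
      show "(eis_mono x has_field_derivative deriv (\<lambda>q. e4 q ^ a) q * (e6 q ^ b * e2 q ^ k)
        + e4 q ^ a * (deriv (\<lambda>q. e6 q ^ b) q * e2 q ^ k + e6 q ^ b * deriv (\<lambda>q. e2 q ^ k) q)) (at q)"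
        unfolding x eis_mono_def case_prod_conv
        using DERIV_mult[OF holomorphic_derivI[OF h(1) open_ball q]
            DERIV_mult[OF holomorphic_derivI[OF h(2) open_ball q] holomorphic_derivI[OF h(3) open_ball q]]]
        by (simp add: mult_ac add_ac)
    qed
    ultimately have "qm (K + 2) (k + 1) (\<lambda>q. q * deriv (eis_mono x) q)"
      by (elim qm_cong) (simp add: algebra_simps)
    then show ?thesis by (rule qm_mono_le) (use x in auto)
  qed
  have "qm (K + 2) (m + 1) (\<lambda>q. \<Sum>x\<in>qidx K m. c x * (q * deriv (eis_mono x) q))"
    by (intro qm_sum qm_cmult D)
  moreover have "deriv F q = (\<Sum>x\<in>qidx K m. c x * deriv (eis_mono x) q)" if "norm q < 1" for q
  proof (rule DERIV_imp_deriv, rule has_field_derivative_transform_within_open[of _ _ _ "ball 0 1"])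
    show "((\<lambda>q. \<Sum>x\<in>qidx K m. c x * eis_mono x q) has_field_derivative (\<Sum>x\<in>qidx K m. c x * deriv (eis_mono x) q)) (at q)"
      by (intro DERIV_sum DERIV_cmult holomorphic_derivI[OF holomorphic_eis_mono open_ball]) (use that in auto)
  qed (use that F in auto)
  ultimately show ?thesis
    by (elim qm_cong) (simp add: sum_distrib_left mult_ac)
qed

section \<open>Algebraic independence of E2, E4 and E6\<close>

lemma poly_zero_if_infinite_roots:
  fixes p :: "complex poly"
  assumes "\<And>y. y \<in> S \<Longrightarrow> poly p y = 0" "infinite S"
  shows "p = 0"
  using poly_roots_finite[of p] assms finite_subset[of S "{y. poly p y = 0}"] by auto

lemma nonzero_disc:
  fixes f :: "complex \<Rightarrow> complex"
  assumes "f holomorphic_on ball 0 1" "f 0 \<noteq> 0"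
  obtains r where "0 < r" "r \<le> 1" "\<And>q. norm q < r \<Longrightarrow> f q \<noteq> 0"
proof -
  have "isCont f 0"
    using holomorphic_on_imp_continuous_on[OF assms(1)] by (simp add: continuous_on_eq_continuous_at)
  then have "\<forall>\<^sub>F q in nhds 0. f q \<noteq> 0"
    using assms(2) by (intro tendsto_imp_eventually_ne[of f "f 0"]) (auto simp: continuous_at tendsto_nhds_iff)
  then obtain \<epsilon> where "0 < \<epsilon>" "\<And>q. dist q 0 < \<epsilon> \<Longrightarrow> f q \<noteq> 0"
    unfolding eventually_nhds_metric by auto
  then show ?thesis by (intro that[of "min \<epsilon> 1"]) auto
qed

text \<open>Taking out a common monomial turns a relation of fixed weight into a polynomial
  \<open>p\<close> in \<open>r = e6 ^ 2 / e4 ^ 3\<close>. Near 0 the function \<open>r\<close> is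
  continuous and equals 1 only at 0, because the discriminant vanishes only there; by connectedness
  it takes infinitely many values, and \<open>p = 0\<close>.\<close>

lemma e4_e6_independent:
  assumes "\<And>q. norm q < 1 \<Longrightarrow> q \<noteq> 0 \<Longrightarrow> (\<Sum>x\<in>A. d x * (e4 q ^ fst x * e6 q ^ snd x)) = 0"
    and A: "A = {(a, b). 4 * a + 6 * b = L}" and x: "x \<in> A"
  shows "d x = (0 :: complex)"
proof -
  have fin: "finite A"
    by (rule finite_subset[of _ "{..L} \<times> {..L}"]) (auto simp: A)
  \<comment> \<open>The weight fixes the parity \<open>R\<close> of the exponent of
    \<open>e6\<close>, since \<open>L div 2 = 2 * a + 3 * b\<close>; \<open>M\<close> is the
    exponent of \<open>e4\<close> that accompanies \<open>b = R\<close>.\<close>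
  define R where "R = (L div 2) mod 2"
  define M where "M = (L - 6 * R) div 4"
  have ab: "b mod 2 = R" "a + 3 * (b div 2) = M" if "(a, b) \<in> A" for a b
  proof -
    have e: "4 * a + 6 * b = L" using that by (simp add: A)
    then have h: "L div 2 = 2 * a + 3 * b" by auto
    show R: "b mod 2 = R" unfolding R_def h by presburger
    have "b = 2 * (b div 2) + R" using R by auto
    then have "4 * (a + 3 * (b div 2)) + 6 * R = L" unfolding e[symmetric] by presburger
    then show "a + 3 * (b div 2) = M" unfolding M_def by auto
  qed
  define p :: "complex poly" where "p = (\<Sum>x\<in>A. monom (d x) (snd x div 2))"
  have "(\<lambda>q. e4 q * e6 q) holomorphic_on ball 0 1" by (intro holomorphic_intros holomorphic_e)
  then obtain \<delta> where \<delta>: "0 < \<delta>" "\<delta> \<le> 1" "\<And>q. norm q < \<delta> \<Longrightarrow> e4 q * e6 q \<noteq> 0"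
    by (rule nonzero_disc) auto
  define r where "r = (\<lambda>q. e6 q ^ 2 / e4 q ^ 3)"
  have p0: "poly p (r q) = 0" if q: "norm q < \<delta>" "q \<noteq> 0" for q
  proof -
    have nz: "e4 q \<noteq> 0" "e6 q \<noteq> 0" using \<delta>(3) q by auto
    have "e4 q ^ fst x * e6 q ^ snd x = e4 q ^ M * e6 q ^ R * r q ^ (snd x div 2)" if "x \<in> A" for x
    proof -
      obtain a b where x: "x = (a, b)" by (cases x)
      let ?j = "b div 2"
      have "e6 q ^ b = e6 q ^ R * (e6 q ^ 2) ^ ?j"
        using ab(1)[of a b] that x by (metis mod_mult_div_eq power_add power_mult)
      moreover have "e4 q ^ M = e4 q ^ a * (e4 q ^ 3) ^ ?j"
        using ab(2)[of a b] that x by (metis power_add power_mult)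
      ultimately show ?thesis using nz by (simp add: x r_def power_divide)
    qed
    then have "(\<Sum>x\<in>A. d x * (e4 q ^ fst x * e6 q ^ snd x)) = e4 q ^ M * e6 q ^ R * poly p (r q)"
      unfolding p_def by (simp add: poly_sum poly_monom sum_distrib_left mult_ac)
    moreover have "(\<Sum>x\<in>A. d x * (e4 q ^ fst x * e6 q ^ snd x)) = 0"
      using assms(1)[of q] q \<delta> by auto
    ultimately show ?thesis using nz by simp
  qed
  have r1: "r q \<noteq> 1" if "norm q < \<delta>" "q \<noteq> 0" for q
    using eta24_discriminant[of q] eta24_nonzero[of q] that \<delta>(2) \<delta>(3)[of q] by (auto simp: r_def)
  have inf: "infinite (r ` (ball 0 \<delta>))"
  proof
    assume "finite (r ` ball 0 \<delta>)"
    moreover have "continuous_on (ball 0 \<delta>) r"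
    proof -
      have "r holomorphic_on ball 0 \<delta>"
        unfolding r_def using \<delta>
        by (intro holomorphic_intros holomorphic_on_subset[OF holomorphic_e(2)] holomorphic_on_subset[OF holomorphic_e(3)]) auto
      then show ?thesis by (rule holomorphic_on_imp_continuous_on)
    qed
    then have "connected (r ` ball 0 \<delta>)" by (intro connected_continuous_image connected_ball)
    ultimately obtain c where c: "r ` ball 0 \<delta> \<subseteq> {c}"
      using connected_finite_iff_sing[of "r ` ball 0 \<delta>"] \<delta>(1) by auto
    have "r 0 = 1" by (simp add: r_def)
    moreover have "r (of_real (\<delta> / 2)) \<noteq> 1" using \<delta>(1) by (intro r1) auto
    moreover have "r p = c" if "norm p < \<delta>" for p
      using subsetD[OF c imageI[of p "ball 0 \<delta>" r]] that by (simp add: dist_norm)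
    ultimately show False using \<delta>(1) by (metis norm_of_real abs_of_pos half_gt_zero_iff field_sum_of_halves less_add_same_cancel1 norm_zero)
  qed
  have "p = 0"
  proof (rule poly_zero_if_infinite_roots)
    show "infinite (r ` (ball 0 \<delta> - {0}))"
    proof
      assume "finite (r ` (ball 0 \<delta> - {0}))"
      then have "finite (insert (r 0) (r ` (ball 0 \<delta> - {0})))" by simp
      moreover have "r ` ball 0 \<delta> \<subseteq> insert (r 0) (r ` (ball 0 \<delta> - {0}))" by blast
      ultimately show False using inf finite_subset by blast
    qed
  qed (auto intro!: p0)
  obtain a b where ab': "x = (a, b)" by (cases x)
  have "coeff p (b div 2) = (\<Sum>y\<in>A. if y = x then d y else 0)"
  proof -
    have "snd y div 2 = b div 2 \<longleftrightarrow> y = x" if "y \<in> A" for y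
    proof
      assume h: "snd y div 2 = b div 2"
      obtain a' b' where y: "y = (a', b')" by (cases y)
      have "b' = b" using ab(1)[of a' b'] ab(1)[of a b] that x y ab' h by (metis mod_mult_div_eq snd_conv)
      then show "y = x" using ab(2)[of a' b'] ab(2)[of a b] that x y ab' by auto
    qed (simp add: ab')
    then show ?thesis unfolding p_def by (simp add: coeff_sum coeff_monom cong: sum.cong)
  qed
  then show "d x = 0" using \<open>p = 0\<close> x fin by simp
qed

text \<open>The inhomogeneous term in the inversion formula for \<open>e2\<close>, evaluated at all translates
  \<open>t + n\<close>, yields infinitely many zeros of a relation viewed as a polynomial in \<open>e2\<close>.\<close>

lemma eis_mono_independent:
  assumes z: "\<And>q. norm q < 1 \<Longrightarrow> (\<Sum>x\<in>qidx K m. c x * eis_mono x q) = 0" and x: "x \<in> qidx K m"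
  shows "c x = 0"
proof -
  obtain a b k where abk: "x = (a, b, k)" "4 * a + 6 * b + 2 * k = K" "k \<le> m"
    using x by (auto simp: qidx_def)
  define A where A: "A = {(a, b). 4 * a + 6 * b = K - 2 * k}"
  have "(\<Sum>y\<in>A. c (fst y, snd y, k) * (e4 q ^ fst y * e6 q ^ snd y)) = 0" if q: "norm q < 1" "q \<noteq> 0" for q
  proof -
    obtain t where t: "0 < Im t" "nome t = q" using nome_surj[OF q] by auto
    define p :: "complex poly" where
      "p = (\<Sum>y\<in>qidx K m. case y of (a, b, k) \<Rightarrow> monom (c y * (e4 q ^ a * e6 q ^ b)) k)"
    define y where "y = (\<lambda>n. e2 q + 12 / (tpi * (t + of_int (int n))))"
    have "poly p (y n) = 0" for n
    proof -
      define s where "s = t + of_int (int n)"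
      have s: "0 < Im s" using t by (simp add: s_def)
      have s0: "s \<noteq> 0" using s by auto
      have ns: "nome s = q" unfolding s_def nome_add_of_int by (rule t)
      have "e2 (nome (- 1 / s)) = s ^ 2 * y n"
        unfolding e2_inversion[OF s] ns y_def s_def[symmetric] using s0 by (simp add: field_simps power2_eq_square)
      moreover have "e4 (nome (- 1 / s)) = s ^ 4 * e4 q" "e6 (nome (- 1 / s)) = s ^ 6 * e6 q"
        using modularD(2)[OF modular_e4 s] modularD(2)[OF modular_e6 s] ns by simp_all
      ultimately have "eis_mono x (nome (- 1 / s)) = s ^ K * (case x of (a, b, k) \<Rightarrow> e4 q ^ a * e6 q ^ b * y n ^ k)"
        if "x \<in> qidx K m" for x
        using that unfolding eis_mono_def qidx_def
        by (auto simp: power_mult_distrib power_add power_mult)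
      then have "(\<Sum>x\<in>qidx K m. c x * eis_mono x (nome (- 1 / s))) =
          s ^ K * (\<Sum>x\<in>qidx K m. c x * (case x of (a, b, k) \<Rightarrow> e4 q ^ a * e6 q ^ b * y n ^ k))"
        by (simp add: sum_distrib_left mult_ac)
      then have "(\<Sum>x\<in>qidx K m. c x * (case x of (a, b, k) \<Rightarrow> e4 q ^ a * e6 q ^ b * y n ^ k)) = 0"
        using z[OF norm_nome_less[OF Im_minus_inverse[OF s]]] s0 by simp
      then show ?thesis
        unfolding p_def poly_sum by (simp add: case_prod_unfold poly_monom mult_ac)
    qed
    moreover have "infinite (range y)"
    proof -
      have "inj y"
      proof (rule injI)
        fix i j assume "y i = y j"
        then have "12 / (tpi * (t + of_int (int i))) = 12 / (tpi * (t + of_int (int j)))" by (simp add: y_def)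
        moreover have "t + of_int (int i) \<noteq> 0" "t + of_int (int j) \<noteq> 0" using t(1) by (auto simp: complex_eq_iff)
        ultimately show "i = j" by (simp add: field_simps)
      qed
      then show ?thesis using finite_imageD by blast
    qed
    ultimately have "p = 0" using poly_zero_if_infinite_roots[of "range y" p] by auto
    \<comment> \<open>The coefficient of degree \<open>k\<close> is a relation between
      \<open>e4\<close> and \<open>e6\<close> alone, of weight \<open>K - 2 * k\<close>; it holds at
      every nonzero \<open>q\<close> of the disc.\<close>
    then have "(\<Sum>y\<in>qidx K m. coeff (case y of (a, b, k) \<Rightarrow> monom (c y * (e4 q ^ a * e6 q ^ b)) k) k) = 0"
      unfolding p_def coeff_sum[symmetric] by simp
    also have "(\<Sum>y\<in>qidx K m. coeff (case y of (a, b, k) \<Rightarrow> monom (c y * (e4 q ^ a * e6 q ^ b)) k) k)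
        = (\<Sum>y\<in>(\<lambda>(a, b). (a, b, k)) ` A. c y * (e4 q ^ fst y * e6 q ^ fst (snd y)))"
      by (rule sum.mono_neutral_cong_right[OF finite_qidx]) (use abk in \<open>auto simp: A qidx_def image_iff coeff_monom split: if_splits\<close>)
    also have "\<dots> = (\<Sum>y\<in>A. c (fst y, snd y, k) * (e4 q ^ fst y * e6 q ^ snd y))"
      by (subst sum.reindex) (auto simp: inj_on_def case_prod_unfold)
    finally show ?thesis .
  qed
  from e4_e6_independent[OF this A, of "(a, b)"] abk show ?thesis by (auto simp: A)
qed

section \<open>The dimension formula\<close>

text \<open>The orders of vanishing at the cusp of the forms \<open>eta24 ^ j * e4 ^ a * e6 ^ b\<close> of weight \<open>L\<close>.\<close>

definition orders :: "nat \<Rightarrow> nat set" where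
  "orders L = {j. \<exists>a b. 12 * j + 4 * a + 6 * b = L}"

text \<open>Sending a monomial to \<open>b div 2\<close> matches monomials with orders, injectively
  because the weight fixes the parity of \<open>b\<close>. The set of orders is closed downwards,
  since a factor \<open>eta24\<close> may be traded for \<open>e4 ^ 3\<close>, so it is an initial
  segment of its own cardinality.\<close>

lemma orders_eq: "orders L = {..<card (qidx L 0)}"
proof -
  let ?f = "\<lambda>(a, b, k). b div 2 :: nat"
  have "inj_on ?f (qidx L 0)"
  proof (rule inj_onI)
    fix x y assume xy: "x \<in> qidx L 0" "y \<in> qidx L 0" "?f x = ?f y"
    then obtain a b a' b' where e: "x = (a, b, 0)" "y = (a', b', 0)" "4 * a + 6 * b = L" "4 * a' + 6 * b' = L" "b div 2 = b' div 2"
      by (auto simp: qidx_def)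
    have "2 * a + 3 * b = 2 * a' + 3 * b'" using e(3,4) by simp
    then have "b mod 2 = b' mod 2" by presburger
    then have "b = b'" using e(5) by (metis div_mult_mod_eq)
    then show "x = y" using e by simp
  qed
  moreover have "?f ` qidx L 0 = orders L"
  proof (intro equalityI subsetI)
    fix j assume "j \<in> ?f ` qidx L 0"
    then obtain a b where "4 * a + 6 * b = L" "j = b div 2" by (auto simp: qidx_def)
    moreover have "12 * (b div 2) + 4 * a + 6 * (b mod 2) = 4 * a + 6 * b" by presburger
    ultimately show "j \<in> orders L" unfolding orders_def by blast
  next
    fix j assume "j \<in> orders L"
    then obtain a b where e: "12 * j + 4 * a + 6 * b = L" by (auto simp: orders_def)
    have "4 * (a + 3 * (b div 2)) + 6 * (2 * j + b mod 2) = 12 * j + 4 * a + 6 * b" by presburger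
    then have "(a + 3 * (b div 2), 2 * j + b mod 2, 0) \<in> qidx L 0" using e by (simp add: qidx_def)
    then show "j \<in> ?f ` qidx L 0" by (rule rev_image_eqI) simp
  qed
  ultimately have card: "card (orders L) = card (qidx L 0)" by (metis card_image)
  have fin: "finite (orders L)" by (rule finite_subset[of _ "{..L}"]) (auto simp: orders_def)
  have down: "i \<in> orders L" if "j \<in> orders L" "i \<le> j" for i j
  proof -
    obtain a b where "12 * j + 4 * a + 6 * b = L" using \<open>j \<in> orders L\<close> by (auto simp: orders_def)
    then have "12 * i + 4 * (a + 3 * (j - i)) + 6 * b = L" using that(2) by simp
    then show ?thesis unfolding orders_def by blast
  qed
  have "orders L = {..<card (orders L)}"
  proof (rule ccontr)
    assume ne: "orders L \<noteq> {..<card (orders L)}"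
    then obtain j where "j \<in> orders L" "card (orders L) \<le> j"
      by (metis card_lessThan card_subset_eq finite_lessThan lessThan_iff linorder_not_less subsetI)
    then have "{..card (orders L)} \<subseteq> orders L" using down by auto
    then have "card {..card (orders L)} \<le> card (orders L)" by (rule card_mono[OF fin])
    then show False by simp
  qed
  then show ?thesis by (simp add: card)
qed

text \<open>The only even natural number not of the form \<open>4 * a + 6 * b\<close> is 2. This is
  where the exceptional weights \<open>12 * N + 2\<close> enter.\<close>

lemma not_in_orders:
  assumes "N \<notin> orders L" "even L"
  shows "L < 12 * N \<or> L = 12 * N + 2"
proof (rule ccontr)
  assume "\<not> ?thesis"
  then obtain M where M: "L = 12 * N + M" "M \<noteq> 2" by (metis le_iff_add not_less)
  then have "even M" using assms(2) by auto
  then have "\<exists>a b. 4 * a + 6 * b = M" using M(2) by presburger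
  then obtain a b where "4 * a + 6 * b = M" by blast
  then have "N \<in> orders L" unfolding orders_def using M by (auto simp: add.assoc)
  then show False using assms by simp
qed

lemma modular_vanish:
  assumes F: "modular L F" and "even L" and G: "G holomorphic_on ball 0 1"
    and FG: "\<And>q. norm q < 1 \<Longrightarrow> F q = q ^ card (qidx L 0) * G q" and q: "norm q < 1"
  shows "F q = 0"
proof -
  let ?N = "card (qidx L 0)"
  have "?N \<notin> orders L" by (simp add: orders_eq)
  from not_in_orders[OF this assms(2)] show ?thesis
  proof
    assume "L < 12 * ?N"
    from modular_eq_0[OF F G FG this q] show ?thesis .
  next
    assume "L = 12 * ?N + 2"
    with F have "modular (12 * ?N + 2) F" by simp
    from modular_eq_0'[OF this G FG q] show ?thesis .
  qed
qed

text \<open>\<open>eta24 ^ n * e4 ^ a * e6 ^ b\<close> begins with \<open>q ^ n\<close>, so it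
  corrects the next Taylor coefficient without disturbing the earlier ones. The target
  \<open>V\<close> is an arbitrary holomorphic function, possibly on a smaller disc: it is a modular
  form in \<open>modular_is_qm\<close>, but a quotient by a power of \<open>Ufun\<close> in the
  construction of the solution.\<close>

lemma qm_interpolate:
  assumes "V holomorphic_on ball 0 r" "r \<le> 1" "n \<le> card (qidx L 0)"
  shows "\<exists>f G. qm L 0 f \<and> G holomorphic_on ball 0 r \<and> (\<forall>q. norm q < r \<longrightarrow> V q = f q + q ^ n * G q)"
  using assms(3)
proof (induction n)
  case 0
  show ?case using assms(1) qm_0 by (intro exI[of _ "\<lambda>q. 0"] exI[of _ V]) auto
next
  case (Suc n)
  then obtain f G where f: "qm L 0 f" "G holomorphic_on ball 0 r" "\<And>q. norm q < r \<Longrightarrow> V q = f q + q ^ n * G q"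
    by auto
  have "n \<in> orders L" using Suc.prems by (simp add: orders_eq)
  then obtain a b where ab: "12 * n + 4 * a + 6 * b = L" by (auto simp: orders_def)
  define u where "u = (\<lambda>q. euler q ^ (24 * n) * (e4 q ^ a * e6 q ^ b))"
  define h where "h = (\<lambda>q. eta24 q ^ n * (e4 q ^ a * e6 q ^ b))"
  have h: "qm L 0 h"
    unfolding h_def
    by (intro qm_mult[OF qm_power[OF qm_eta24 refl refl] qm_mult[OF qm_power[OF qm_e(2) refl refl] qm_power[OF qm_e(3) refl refl] refl refl]])
       (use ab in auto)
  have hu: "h q = q ^ n * u q" for q
    by (simp add: h_def u_def eta24_conv_euler power_mult_distrib power_mult)
  have "u holomorphic_on ball 0 1"
    unfolding u_def by (intro holomorphic_intros holomorphic_euler holomorphic_e)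
  then have "u holomorphic_on ball 0 r" by (rule holomorphic_on_subset) (use assms in auto)
  then have "(\<lambda>q. G q - G 0 * u q) holomorphic_on ball 0 r"
    by (intro holomorphic_intros f)
  moreover have "G 0 - G 0 * u 0 = 0" by (simp add: u_def)
  ultimately obtain H where H: "H holomorphic_on ball 0 r" "\<And>q. norm q < r \<Longrightarrow> G q - G 0 * u q = q * H q"
    by (rule holomorphic_factor_root) auto
  show ?case
  proof (intro exI conjI allI impI)
    show "qm L 0 (\<lambda>q. f q + G 0 * h q)" by (intro qm_add qm_cmult f h)
    show "H holomorphic_on ball 0 r" by (rule H)
    fix q :: complex assume q: "norm q < r"
    have "V q = f q + q ^ n * (G 0 * u q + (G q - G 0 * u q))" using f(3)[OF q] by simp
    also have "\<dots> = f q + G 0 * h q + q ^ Suc n * H q" unfolding H(2)[OF q] hu by (simp add: algebra_simps)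
    finally show "V q = f q + G 0 * h q + q ^ Suc n * H q" .
  qed
qed

lemma modular_qm:
  assumes "qm K 0 F" shows "modular K F"
proof -
  obtain c where F: "\<And>q. norm q < 1 \<Longrightarrow> F q = (\<Sum>x\<in>qidx K 0. c x * eis_mono x q)"
    using assms unfolding qm_def by metis
  have m: "modular K (\<lambda>q. c x * eis_mono x q)" if x: "x \<in> qidx K 0" for x
  proof -
    obtain a b where ab: "x = (a, b, 0)" "4 * a + 6 * b = K" using x by (auto simp: qidx_def)
    have "modular K (\<lambda>q. e4 q ^ a * e6 q ^ b)"
      by (rule modular_mult[OF modular_power[OF modular_e4 refl] modular_power[OF modular_e6 refl]]) (use ab in simp)
    then show ?thesis by (intro modular_cmult) (simp add: eis_mono_def ab)
  qed
  have z: "modular K (\<lambda>q. 0)" by (simp add: modular_def)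
  have "modular K (\<lambda>q. \<Sum>x\<in>A. c x * eis_mono x q)" if "A \<subseteq> qidx K 0" for A
    using finite_subset[OF that finite_qidx] that by (induction A rule: finite_induct) (auto intro: z modular_add m)
  from modular_cong[OF this[OF order_refl]] show ?thesis by (simp add: F)
qed

text \<open>After matching as many Taylor coefficients as there are monomials, the remainder is a
  form to which \<open>modular_vanish\<close> applies.\<close>

lemma modular_is_qm:
  assumes "modular K F" "even K" shows "qm K 0 F"
proof -
  obtain f G where f: "qm K 0 f" "G holomorphic_on ball 0 1"
    "\<And>q. norm q < 1 \<Longrightarrow> F q = f q + q ^ card (qidx K 0) * G q"
    using qm_interpolate[OF modularD(1)[OF assms(1)] order_refl order_refl, of K] by auto
  have "F q - f q = 0" if "norm q < 1" for q
    by (rule modular_vanish[OF modular_diff[OF assms(1) modular_qm[OF f(1)]] assms(2) f(2)]) (use f(3) that in auto)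
  then show ?thesis using f(1) by (auto intro: qm_cong)
qed

text \<open>Euclid's algorithm on the bottom row: a translation by \<open>d div c\<close> followed
  by the inversion replaces \<open>c\<close> by \<open>d mod c\<close>. It ends at
  \<open>c = 0\<close>, a translation up to a common sign of the entries, which an even weight does
  not see.\<close>

lemma modular_SL2:
  assumes F: "modular k F" and k: "even k" and det: "a * d - b * c = (1::int)" and z: "0 < Im z"
  shows "F (nome ((of_int a * z + of_int b) / (of_int c * z + of_int d))) = (of_int c * z + of_int d) ^ k * F (nome z)"
  using det z
proof (induction "nat \<bar>c\<bar>" arbitrary: a b c d z rule: less_induct)
  case less
  show ?case
  proof (cases "c = 0")
    case True
    then have "a * d = 1" using less.prems by simp
    then have ad: "a = 1 \<and> d = 1 \<or> a = -1 \<and> d = -1" by (simp add: zmult_eq_1_iff)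
    then show ?thesis
    proof
      assume "a = 1 \<and> d = 1"
      then show ?thesis using True nome_add_of_int[of z b] by simp
    next
      assume "a = -1 \<and> d = -1"
      then show ?thesis using True nome_add_of_int[of z "- b"] k by simp
    qed
  next
    case False
    define n where "n = d div c"
    define d' where "d' = d mod c"
    define b' where "b' = b - a * n"
    define w where "w = z + of_int n"
    have d: "d = c * n + d'" by (simp add: n_def d'_def)
    have lt: "nat \<bar>d'\<bar> < nat \<bar>c\<bar>" using False abs_mod_less[of c d] by (simp add: d'_def)
    have det': "b' * (- c) - (- a) * d' = 1" using less.prems(1) by (simp add: b'_def d algebra_simps)
    have w: "0 < Im w" using less.prems(2) by (simp add: w_def)
    have w0: "w \<noteq> 0" using w by auto
    have fw: "F (nome w) = F (nome z)" unfolding w_def nome_add_of_int ..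
    have num: "of_int a * z + of_int b = of_int a * w + of_int b'" by (simp add: w_def b'_def algebra_simps)
    have den: "of_int c * z + of_int d = of_int c * w + of_int d'" by (simp add: w_def d algebra_simps)
    have IH: "F (nome ((of_int b' * (- 1 / w) + of_int (- a)) / (of_int d' * (- 1 / w) + of_int (- c))))
        = (of_int d' * (- 1 / w) + of_int (- c)) ^ k * F (nome (- 1 / w))"
      by (rule less.hyps[OF lt det' Im_minus_inverse[OF w]])
    have e1: "of_int b' * (- 1 / w) + of_int (- a) = - ((of_int a * w + of_int b') / w)"
      and e2: "of_int d' * (- 1 / w) + of_int (- c) = - ((of_int c * w + of_int d') / w)"
      using w0 by (simp_all add: field_simps)
    have "(of_int b' * (- 1 / w) + of_int (- a)) / (of_int d' * (- 1 / w) + of_int (- c))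
        = (of_int a * z + of_int b) / (of_int c * z + of_int d)"
    proof -
      have "- (x / w) / - (y / w) = x / y" for x y using w0 by simp
      then show ?thesis unfolding e1 e2 num den .
    qed
    moreover have "(of_int d' * (- 1 / w) + of_int (- c)) ^ k * F (nome (- 1 / w)) = (of_int c * z + of_int d) ^ k * F (nome z)"
      unfolding e2 den modularD(2)[OF F w] fw using w0 k by (simp add: power_divide)
    ultimately show ?thesis using IH by simp
  qed
qed

section \<open>Classical modular forms as functions of the nome, and their dimension\<close>

lemma nome_eq_iff: "nome s = nome t \<Longrightarrow> \<exists>n. s = t + of_int n"
proof -
  assume "nome s = nome t"
  then obtain n :: int where "tpi * s = tpi * t + (of_int (2 * n) * pi) * \<i>"
    unfolding nome_def exp_eq by auto
  then have "tpi * s = tpi * (t + of_int n)" by (simp add: tpi_def algebra_simps)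
  then show ?thesis by auto
qed

text \<open>Periodicity lets \<open>f\<close> descend to the punctured disc, and boundedness for
  \<open>1 \<le> Im z\<close> makes the singularity at 0 removable.\<close>

lemma modforms_nome:
  assumes f: "f \<in> modforms k"
  obtains F where "modular k F" "\<And>t. 0 < Im t \<Longrightarrow> f t = F (nome t)"
proof -
  have hol: "f holomorphic_on {z. 0 < Im z}" using f by (simp add: modforms_def)
  have tr: "f ((of_int a * z + of_int b) / (of_int c * z + of_int d)) = (of_int c * z + of_int d) ^ k * f z"
    if "a * d - b * c = 1" "0 < Im z" for a b c d :: int and z
    using f that by (simp add: modforms_def)
  obtain B where B: "\<And>z. 1 \<le> Im z \<Longrightarrow> norm (f z) \<le> B" using f by (auto simp: modforms_def)
  have per: "f s = f t" if st: "nome s = nome t" "0 < Im t" for s t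
  proof -
    obtain n where "s = t + of_int n" using nome_eq_iff[OF st(1)] by auto
    then show ?thesis using tr[of 1 1 n 0 t] st by simp
  qed
  have inv: "f (- 1 / t) = t ^ k * f t" if "0 < Im t" for t
    using tr[of 0 0 "-1" 1 t] that by simp
  define F0 where "F0 = (\<lambda>q. f (Ln q / tpi))"
  have F0: "F0 q = f s" if "nome s = q" "0 < Im s" for q s
    unfolding F0_def by (rule per) (use that in \<open>auto simp: nome_def\<close>)
  have "F0 holomorphic_on ball 0 1 - {0}"
    unfolding holomorphic_on_open[OF open_Diff[OF open_ball finite_imp_closed[OF finite.insertI[OF finite.emptyI]]]]
  proof
    fix q :: complex assume q: "q \<in> ball 0 1 - {0}"
    then obtain t where t: "0 < Im t" "nome t = q" using nome_surj[of q] by auto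
    \<comment> \<open>\<open>F0\<close> is written with the principal logarithm, which jumps on the
      negative axis. By periodicity \<open>F0\<close> agrees with \<open>g\<close>, whose logarithm
      is evaluated near 1 when \<open>p\<close> is near \<open>q\<close>.\<close>
    define g where "g = (\<lambda>p. f (t + Ln (p / q) / tpi))"
    define S where "S = {p. p \<in> ball 0 1 - {0} \<and> p / q \<in> - \<real>\<^sub>\<le>\<^sub>0}"
    have nome_g: "nome (t + Ln (p / q) / tpi) = p" if "p \<noteq> 0" for p
      using that q t(2) by (simp add: nome_def distrib_left exp_add)
    have pos: "0 < Im (t + Ln (p / q) / tpi)" if "p \<in> ball 0 1 - {0}" for p
    proof -
      have "exp (- 2 * pi * Im (t + Ln (p / q) / tpi)) < 1"
        using norm_nome[of "t + Ln (p / q) / tpi"] nome_g[of p] that by simp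
      then have "pi * Im (t + Ln (p / q) / tpi) > 0" by simp
      then show ?thesis by (simp add: zero_less_mult_iff)
    qed
    have "(Ln has_field_derivative inverse 1) (at 1)" by (rule has_field_derivative_Ln) auto
    then have L: "((\<lambda>p. t + Ln (p / q) / tpi) has_field_derivative (1 / q) / tpi) (at q)"
      using q by (auto intro!: derivative_eq_intros)
    have ft: "(f has_field_derivative deriv f t) (at t)"
      by (rule holomorphic_derivI[OF hol open_upper]) (use t in auto)
    have "(g has_field_derivative deriv f t * ((1 / q) / tpi)) (at q)"
      unfolding g_def by (rule DERIV_chain2[OF _ L]) (use ft q in simp)
    then have "(F0 has_field_derivative deriv f t * ((1 / q) / tpi)) (at q)"
      by (rule has_field_derivative_transform_within_open[of _ _ _ "ball 0 1 - {0}"])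
         (use q in \<open>auto simp: g_def intro!: F0[symmetric] nome_g pos\<close>)
    then show "\<exists>f'. (F0 has_field_derivative f') (at q)" by blast
  qed
  moreover have "\<exists>B. \<forall>\<^sub>F q in at 0. norm (F0 q) \<le> B"
  proof (intro exI)
    have "\<forall>\<^sub>F q in at 0. q \<in> ball (0::complex) (exp (- 2 * pi)) - {0}"
      by (rule eventually_at_in_open) auto
    then show "\<forall>\<^sub>F q in at 0. norm (F0 q) \<le> B"
    proof eventually_elim
      case (elim q)
      then have "norm q < exp (- 2 * pi)" "q \<noteq> 0" by auto
      moreover have "exp (- 2 * pi) < (1::real)" by simp
      ultimately have "norm q < 1" "q \<noteq> 0" by linarith+
      then obtain t where t: "0 < Im t" "nome t = q" using nome_surj[of q] by auto
      have "exp (- 2 * pi * Im t) < exp (- 2 * pi)" using norm_nome[of t] t \<open>norm q < exp (- 2 * pi)\<close> by simp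
      then have "2 * pi * Im t > 2 * pi * 1" by simp
      then have "1 \<le> Im t" by (simp add: mult_less_cancel_left)
      then show ?case using B F0[OF t(2,1)] by simp
    qed
  qed
  ultimately obtain F where F: "F holomorphic_on ball 0 1" "\<And>q. q \<in> ball 0 1 - {0} \<Longrightarrow> F q = F0 q"
    using holomorphic_on_extend_bounded[of F0 "ball 0 1" 0] by auto
  have Ff: "f t = F (nome t)" if "0 < Im t" for t
    using F(2)[of "nome t"] F0[OF refl that] norm_nome_less[OF that] by simp
  have "modular k F"
    by (rule modularI[OF F(1)]) (use inv Ff Im_minus_inverse in metis)
  then show ?thesis using Ff by (rule that)
qed

text \<open>The value 0 off the half plane is the one \<open>modforms\<close> prescribes, so a
  function of the nome determines a unique element of that space.\<close>

definition upper_fun :: "(complex \<Rightarrow> complex) \<Rightarrow> complex \<Rightarrow> complex" where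
  "upper_fun F z = (if 0 < Im z then F (nome z) else 0)"

lemma upper_fun_modforms:
  assumes F: "modular k F" and k: "even k"
  shows "upper_fun F \<in> modforms k"
  unfolding modforms_def
proof (intro CollectI conjI allI impI)
  show "upper_fun F holomorphic_on {z. 0 < Im z}"
    unfolding holomorphic_on_open[OF open_upper]
  proof
    fix z :: complex assume z: "z \<in> {z. 0 < Im z}"
    have "(upper_fun F has_field_derivative tpi * (nome z * deriv F (nome z))) (at z)"
      by (rule has_field_derivative_transform_within_open[OF has_field_derivative_nome_comp[OF modularD(1)[OF F]] open_upper])
         (use z in \<open>auto simp: upper_fun_def\<close>)
    then show "\<exists>f'. (upper_fun F has_field_derivative f') (at z)" by blast
  qed
  show "upper_fun F z = 0" if "Im z \<le> 0" for z using that by (simp add: upper_fun_def)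
  fix a b c d :: int and z :: complex assume det: "a * d - b * c = 1" and z: "0 < Im z"
  let ?w = "(of_int a * z + of_int b) / (of_int c * z + of_int d)"
  have "0 < Im ?w"
  proof -
    have nz: "of_int c * z + of_int d \<noteq> 0"
    proof
      assume h: "of_int c * z + of_int d = 0"
      then have "Im (of_int c * z + of_int d) = 0" by simp
      then have "c = 0" using z by simp
      then show False using h det by simp
    qed
    have "Im ?w = Im ((of_int a * z + of_int b) * cnj (of_int c * z + of_int d)) / (norm (of_int c * z + of_int d))\<^sup>2"
      by (subst complex_div_cnj) (simp only: of_real_power[symmetric] Im_divide_of_real)
    then have "Im ?w * (norm (of_int c * z + of_int d))\<^sup>2 = Im ((of_int a * z + of_int b) * cnj (of_int c * z + of_int d))"
      using nz by (simp only: nonzero_divide_eq_eq[symmetric] norm_eq_zero power_eq_0_iff) simp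
    also have "\<dots> = Im z * of_int (a * d - b * c)" by (simp add: algebra_simps)
    also have "\<dots> > 0" using z det by simp
    finally show ?thesis by (simp add: zero_less_mult_iff)
  qed
  then show "upper_fun F ?w = (of_int c * z + of_int d) ^ k * upper_fun F z"
    using modular_SL2[OF F k det z] z by (simp add: upper_fun_def)
next
  have "exp (- 2 * pi) < (1::real)" by simp
  then have sub: "cball (0::complex) (exp (- 2 * pi)) \<subseteq> ball 0 1" by (auto simp del: exp_less_one_iff)
  have "compact (F ` cball 0 (exp (- 2 * pi)))"
    by (intro compact_continuous_image holomorphic_on_imp_continuous_on holomorphic_on_subset[OF modularD(1)[OF F] sub]) simp
  then obtain B where "\<And>q. q \<in> cball 0 (exp (- 2 * pi)) \<Longrightarrow> norm (F q) \<le> B"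
    by (meson compact_imp_bounded bounded_iff image_eqI)
  then have "\<forall>z. 1 \<le> Im z \<longrightarrow> norm (upper_fun F z) \<le> B"
    by (auto simp: upper_fun_def norm_nome)
  then show "\<exists>B. \<forall>z. 1 \<le> Im z \<longrightarrow> norm (upper_fun F z) \<le> B" by blast
qed

text \<open>The monomials in \<open>e4\<close> and \<open>e6\<close> are a basis: they are
  independent by \<open>eis_mono_independent\<close> at depth 0 and span by
  \<open>modular_is_qm\<close>.\<close>

lemma dimM_eq: 
  assumes k: "even k" shows "dimM k = card (qidx k 0)"
proof -
  interpret V: vector_space "\<lambda>(c::complex) (f::complex \<Rightarrow> complex). (\<lambda>z. c * f z)"
    by unfold_locales (auto simp: fun_eq_iff algebra_simps)
  let ?b = "\<lambda>x. upper_fun (eis_mono x)"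
  let ?B = "?b ` qidx k 0"
  have ind: "u x = 0" if "(\<lambda>z. \<Sum>x\<in>qidx k 0. u x * ?b x z) = (\<lambda>z. 0)" "x \<in> qidx k 0" for u x
  proof (rule eis_mono_independent[OF _ that(2)])
    fix q :: complex assume q: "norm q < 1"
    have hol: "(\<lambda>q. \<Sum>x\<in>qidx k 0. u x * eis_mono x q) holomorphic_on ball 0 1"
      by (intro holomorphic_intros holomorphic_eis_mono)
    have *: "(\<Sum>x\<in>qidx k 0. u x * eis_mono x q) = 0" if q: "q \<noteq> 0" "norm q < 1" for q
    proof -
      obtain t where "0 < Im t" "nome t = q" using nome_surj[OF q(2,1)] by auto
      then show ?thesis using fun_cong[OF \<open>(\<lambda>z. \<Sum>x\<in>qidx k 0. u x * ?b x z) = (\<lambda>z. 0)\<close>, of t]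
        by (simp add: upper_fun_def)
    qed
    \<comment> \<open>The nome never takes the value 0, so the half plane yields the relation only
      on the punctured disc; continuity supplies \<open>q = 0\<close>.\<close>
    show "(\<Sum>x\<in>qidx k 0. u x * eis_mono x q) = 0"
    proof (cases "q = 0")
      case True
      have cont: "isCont (\<lambda>q. \<Sum>x\<in>qidx k 0. u x * eis_mono x q) 0"
        using holomorphic_on_imp_continuous_on[OF hol] by (simp add: continuous_on_eq_continuous_at)
      have "\<forall>\<^sub>F q in at 0. (\<Sum>x\<in>qidx k 0. u x * eis_mono x q) = 0"
        using eventually_at_in_open[of "ball 0 1" "0::complex"] by (auto elim!: eventually_mono intro!: *)
      then have "(\<lambda>q. \<Sum>x\<in>qidx k 0. u x * eis_mono x q) \<midarrow>0\<rightarrow> 0" by (rule tendsto_eventually)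
      then show ?thesis unfolding True by (rule LIM_unique[OF cont[unfolded isCont_def]])
    qed (use * q in auto)
  qed
  have inj: "inj_on ?b (qidx k 0)"
  proof (rule inj_onI, rule ccontr)
    fix x y assume xy: "x \<in> qidx k 0" "y \<in> qidx k 0" "?b x = ?b y" "x \<noteq> y"
    define u where "u = (\<lambda>z. if z = x then 1 else if z = y then - 1 else 0 :: complex)"
    have "(\<Sum>v\<in>qidx k 0. u v * ?b v z) = (\<Sum>v\<in>{x, y}. u v * ?b v z)" for z
      by (rule sum.mono_neutral_right) (use xy in \<open>auto simp: u_def\<close>)
    then have "(\<lambda>z. \<Sum>v\<in>qidx k 0. u v * ?b v z) = (\<lambda>z. 0)"
      using xy by (simp add: u_def fun_eq_iff)
    from ind[OF this xy(1)] show False by (simp add: u_def)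
  qed
  have sum_apply: "(\<Sum>v\<in>A. (\<lambda>z. u v * v z)) = (\<lambda>z. \<Sum>v\<in>A. u v * v z)" for A and u :: "(complex \<Rightarrow> complex) \<Rightarrow> complex"
    by (induction A rule: infinite_finite_induct) (auto simp: fun_eq_iff)
  have "V.independent ?B"
  proof
    assume "V.dependent ?B"
    then obtain u v where uv: "v \<in> ?B" "u v \<noteq> 0" "(\<Sum>v\<in>?B. (\<lambda>z. u v * v z)) = 0"
      using V.dependent_finite[of ?B] by auto
    obtain x where x: "x \<in> qidx k 0" "v = ?b x" using uv(1) by auto
    have "(\<lambda>z. \<Sum>x\<in>qidx k 0. u (?b x) * ?b x z) = (\<lambda>z. 0)"
      using uv(3) unfolding sum_apply by (simp add: sum.reindex[OF inj] fun_eq_iff)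
    from ind[OF this x(1)] uv(2) x(2) show False by simp
  qed
  moreover have "?B \<subseteq> modforms k"
    by (auto intro!: upper_fun_modforms[OF modular_qm k] qm_eis_mono)
  moreover have "modforms k \<subseteq> V.span ?B"
  proof
    fix f assume f: "f \<in> modforms k"
    obtain F where F: "modular k F" "\<And>t. 0 < Im t \<Longrightarrow> f t = F (nome t)" by (rule modforms_nome[OF f]) blast
    obtain c where c: "\<And>q. norm q < 1 \<Longrightarrow> F q = (\<Sum>x\<in>qidx k 0. c x * eis_mono x q)"
      using modular_is_qm[OF F(1) k] unfolding qm_def by metis
    have f0: "Im z \<le> 0 \<Longrightarrow> f z = 0" for z using f by (simp add: modforms_def)
    have sum_apply': "(\<Sum>x\<in>A. (\<lambda>z. c x * ?b x z)) = (\<lambda>z. \<Sum>x\<in>A. c x * ?b x z)" for A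
      by (induction A rule: infinite_finite_induct) (auto simp: fun_eq_iff)
    have "f = (\<Sum>x\<in>qidx k 0. (\<lambda>z. c x * ?b x z))"
      unfolding sum_apply'
    proof
      fix z
      show "f z = (\<Sum>x\<in>qidx k 0. c x * ?b x z)"
        using F(2)[of z] f0[of z] c[OF norm_nome_less[of z]] by (cases "0 < Im z") (simp_all add: upper_fun_def)
    qed
    also have "\<dots> \<in> V.span ?B"
      by (intro V.span_sum V.span_scale V.span_base) auto
    finally show "f \<in> V.span ?B" .
  qed
  ultimately have "V.dim (modforms k) = card ?B"
    by (intro V.dim_unique) auto
  then show ?thesis unfolding dimM_def by (simp add: card_image[OF inj])
qed

section \<open>The derivative in nu\<close>

lemmas eis_fold = e2_def[symmetric] e4_def[symmetric] e6_def[symmetric]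

text \<open>This is \<open>\<xi>/E4\<close> without the junk value of that quotient at the zeros of \<open>E4\<close>.\<close>

definition xi0 :: "complex \<Rightarrow> complex \<Rightarrow> complex" where
  "xi0 w q = - (1 / 2) * (w / tpi) ^ 5 / eta24 q"

lemma xi0_eq: "e4 q \<noteq> 0 \<Longrightarrow> xi w q / e4 q = xi0 w q"
  unfolding xi_def xi0_def eis_fold by simp

lemma xi0_nonzero: "w \<noteq> 0 \<Longrightarrow> 0 < norm q \<Longrightarrow> norm q < 1 \<Longrightarrow> xi0 w q \<noteq> 0"
  using eta24_nonzero[of q] by (auto simp: xi0_def)

lemma tt_eq: "tt w q = - (2 / 3) * of_real pi ^ 4 * inverse w ^ 4 * e4 q"
  unfolding tt_def g2_def eis_fold by (simp add: field_simps)

lemma nu_eq: "nu w q = tpi ^ 5 / 360 * inverse w ^ 5 * (e6 q - e2 q * e4 q)"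
  unfolding nu_def eis_fold by (simp add: field_simps)

lemma DERIV_inverse_power:
  fixes w :: complex
  assumes "w \<noteq> 0"
  shows "((\<lambda>v. inverse v ^ Suc n) has_field_derivative - of_nat (Suc n) * inverse w ^ Suc n / w) (at w)"
proof -
  have "(1 + of_nat n) * (- (inverse w ^ Suc (Suc 0)) * inverse w ^ n) = - of_nat (Suc n) * inverse w ^ Suc n / w"
    by (simp add: divide_inverse algebra_simps)
  then show ?thesis
    using DERIV_power_Suc[OF DERIV_inverse[OF assms], of n] by (simp only:)
qed

lemma coordinate_derivatives:
  assumes w: "w \<noteq> 0" and q: "norm q < 1"
  shows "Dw tt w q = - (2 / 3) * of_real pi ^ 4 * (- 4 * inverse w ^ 4 / w) * e4 q"
    and "Dq tt w q = - (2 / 3) * of_real pi ^ 4 * inverse w ^ 4 * deriv e4 q"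
    and "Dw nu w q = tpi ^ 5 / 360 * (- 5 * inverse w ^ 5 / w) * (e6 q - e2 q * e4 q)"
    and "Dq nu w q = tpi ^ 5 / 360 * inverse w ^ 5 * (deriv e6 q - (deriv e2 q * e4 q + deriv e4 q * e2 q))"
proof -
  have p: "((\<lambda>v. inverse v ^ 4) has_field_derivative - 4 * inverse w ^ 4 / w) (at w)"
    "((\<lambda>v. inverse v ^ 5) has_field_derivative - 5 * inverse w ^ 5 / w) (at w)"
    using DERIV_inverse_power[OF w, of 3] DERIV_inverse_power[OF w, of 4] by simp_all
  show "Dw tt w q = - (2 / 3) * of_real pi ^ 4 * (- 4 * inverse w ^ 4 / w) * e4 q"
    unfolding Dw_def tt_eq by (intro DERIV_imp_deriv DERIV_cmult_right DERIV_cmult p)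
  show "Dq tt w q = - (2 / 3) * of_real pi ^ 4 * inverse w ^ 4 * deriv e4 q"
    unfolding Dq_def tt_eq by (intro DERIV_imp_deriv DERIV_cmult DERIV_e q)
  show "Dw nu w q = tpi ^ 5 / 360 * (- 5 * inverse w ^ 5 / w) * (e6 q - e2 q * e4 q)"
    unfolding Dw_def nu_eq by (intro DERIV_imp_deriv DERIV_cmult_right DERIV_cmult p)
  show "Dq nu w q = tpi ^ 5 / 360 * inverse w ^ 5 * (deriv e6 q - (deriv e2 q * e4 q + deriv e4 q * e2 q))"
    unfolding Dq_def nu_eq by (intro DERIV_imp_deriv DERIV_cmult DERIV_diff DERIV_mult DERIV_e q)
qed

text \<open>Ramanujan's identities turn the determinant into a multiple of
  \<open>e4 ^ 3 - e6 ^ 2\<close>. The discriminant has no zero for \<open>0 < norm q < 1\<close>, so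
  \<open>(t, \<nu>)\<close> are local coordinates there.\<close>

lemma jac_eq:
  assumes w: "w \<noteq> 0" and q: "norm q < 1"
  shows "q * jac w q = 16 / 3 * (of_real pi ^ 4 * tpi ^ 5 * inverse w ^ 10) * eta24 q"
proof -
  define T W where "T = - (2 / 3) * of_real pi ^ 4 * inverse w ^ 4" and "W = tpi ^ 5 / 360 * inverse w ^ 5"
  let ?a = "q * deriv e2 q" and ?b = "q * deriv e4 q" and ?c = "q * deriv e6 q"
  have d: "Dw tt w q = - 4 * T * e4 q / w" "Dq tt w q = T * deriv e4 q"
    "Dw nu w q = - 5 * W * (e6 q - e2 q * e4 q) / w"
    "Dq nu w q = W * (deriv e6 q - (deriv e2 q * e4 q + deriv e4 q * e2 q))"
    unfolding coordinate_derivatives[OF w q] T_def W_def by simp_all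
  have "q * jac w q = T * W / w * (- 5 * (e6 q - e2 q * e4 q) * ?b + 4 * e4 q * (?c - (?a * e4 q + ?b * e2 q)))"
    unfolding jac_def d using w by (simp add: field_simps)
  also have "- 5 * (e6 q - e2 q * e4 q) * ?b + 4 * e4 q * (?c - (?a * e4 q + ?b * e2 q)) = - (5 / 3) * (e4 q ^ 3 - e6 q ^ 2)"
  proof -
    have "?a = (e2 q ^ 2 - e4 q) / 12" "?b = (e2 q * e4 q - e6 q) / 3" "?c = (e2 q * e6 q - e4 q ^ 2) / 2"
      using ramanujan_e2[OF q] ramanujan_e4[OF q] ramanujan_e6[OF q] by (simp_all add: field_simps)
    then show ?thesis by (simp only:) (simp add: field_simps power2_eq_square power3_eq_cube)
  qed
  finally have "q * jac w q = T * W * inverse w * (- (5 / 3) * (1728 * eta24 q))"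
    unfolding eta24_discriminant[OF q] divide_inverse[of _ w] .
  moreover have "inverse w ^ 10 = inverse w ^ 4 * inverse w ^ 5 * inverse w"
    by (simp only: power_add[symmetric] power_Suc2[symmetric]) simp
  moreover have "(- (2 / 3) * p * a) * (t / 360 * b) * i * (- (5 / 3) * (1728 * h)) = 16 / 3 * (p * t * (a * b * i)) * h"
    for p a t b i h :: complex by simp
  ultimately show ?thesis unfolding T_def W_def by (simp only:)
qed

lemma jac_nonzero:
  assumes "w \<noteq> 0" "0 < norm q" "norm q < 1"
  shows "jac w q \<noteq> 0"
  using jac_eq[OF assms(1,3)] assms eta24_nonzero[of q] by auto

text \<open>Up to the factor \<open>xi0\<close>, the vector field is fixed by annihilating
  \<open>tt\<close>, which is proportional to \<open>e4 q / w ^ 4\<close>: \<open>q d/dq\<close>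
  turns \<open>e4\<close> into \<open>(e2 * e4 - e6) / 3\<close>, and \<open>w d/dw\<close>
  multiplies \<open>tt\<close> by -4. With \<open>xi0\<close> in front, no division by
  \<open>e4\<close> remains.\<close>

lemma dnu_eq:
  assumes w: "w \<noteq> 0" and q: "0 < norm q" "norm q < 1"
    and Gw: "((\<lambda>v. G v q) has_field_derivative Gw) (at w)"
    and Gq: "((\<lambda>z. G w z) has_field_derivative Gq) (at q)"
  shows "dnu G w q = xi0 w q * (e4 q * (q * Gq) + w * Gw * (e2 q * e4 q - e6 q) / 12)"
proof -
  have q0: "q \<noteq> 0" using q by auto
  have b: "q * deriv e4 q = (e2 q * e4 q - e6 q) / 3" using ramanujan_e4[OF q(2)] by (simp add: field_simps)
  have D: "Dw G w q = Gw" "Dq G w q = Gq"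
    unfolding Dw_def Dq_def by (intro DERIV_imp_deriv Gw Gq)+
  let ?c = "of_real pi ^ 4 * inverse w ^ 4"
  have "q * (Dw G w q * Dq tt w q - Dq G w q * Dw tt w q)
      = - (2 / 3) * ?c * (Gw * (q * deriv e4 q) + 4 * e4 q * (q * Gq) / w)"
    unfolding D coordinate_derivatives[OF w q(2)] by (simp add: algebra_simps)
  also have "\<dots> = - (8 / 3) * (?c / w) * (e4 q * (q * Gq) + w * Gw * (e2 q * e4 q - e6 q) / 12)"
    unfolding b using w by (simp add: field_simps)
  finally have num: "q * (Dw G w q * Dq tt w q - Dq G w q * Dw tt w q)
      = - (8 / 3) * (?c / w) * (e4 q * (q * Gq) + w * Gw * (e2 q * e4 q - e6 q) / 12)" .
  have "dnu G w q = (q * (Dw G w q * Dq tt w q - Dq G w q * Dw tt w q)) / (q * jac w q)"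
    unfolding dnu_def using q0 by simp
  also have "\<dots> = (- (8 / 3) * (?c / w)) / (16 / 3 * (of_real pi ^ 4 * tpi ^ 5 * inverse w ^ 10) * eta24 q)
      * (e4 q * (q * Gq) + w * Gw * (e2 q * e4 q - e6 q) / 12)"
    unfolding num jac_eq[OF w q(2)] by simp
  also have "(- (8 / 3) * (?c / w)) / (16 / 3 * (of_real pi ^ 4 * tpi ^ 5 * inverse w ^ 10) * eta24 q) = xi0 w q"
  proof -
    define i where "i = inverse w"
    have i: "i \<noteq> 0" using w by (simp add: i_def)
    have e: "eta24 q \<noteq> 0" using eta24_nonzero q q0 by auto
    have i4: "i ^ 4 / w = i ^ 5" by (simp add: i_def divide_inverse eval_nat_numeral)
    have i10: "i ^ 10 = i ^ 5 * i ^ 5" by (simp flip: power_add)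
    have x: "xi0 w q = - (1 / 2) * (1 / (tpi ^ 5 * i ^ 5)) / eta24 q"
      unfolding xi0_def i_def by (simp add: power_divide power_inverse field_simps)
    have "- (8 / 3) * (p * a) / (16 / 3 * (p * t * (a * a)) * h) = - (1 / 2) * (1 / (t * a)) / h"
      if "p \<noteq> 0" "a \<noteq> 0" "t \<noteq> 0" "h \<noteq> 0" for p a t h :: complex
      using that by (simp add: field_simps)
    from this[of "of_real pi ^ 4" "i ^ 5" "tpi ^ 5" "eta24 q"] show ?thesis
      unfolding x i_def[symmetric] times_divide_eq_right[symmetric] i4 i10 using i e by simp
  qed
  finally show ?thesis .
qed

section \<open>The region of definition and derivatives along it\<close>

lemma w6_Delta: 
  assumes w: "w \<noteq> 0" and q: "norm q < 1"
  shows "w ^ 6 * Delta w q = tpi ^ 12 * eta24 q * inverse w ^ 6"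
proof -
  have i: "\<i> ^ 12 = (1 :: complex)" by (simp add: eval_nat_numeral)
  have "Delta w q = 64 / 27 * of_real pi ^ 12 * inverse w ^ 12 * (e4 q ^ 3 - e6 q ^ 2)"
    unfolding Delta_def g2_def g3_def eis_fold using w
    by (simp add: power_mult_distrib power_divide field_simps flip: power_mult)
  \<comment> \<open>Here \<open>64 / 27 * 1728 = 2 ^ 12\<close>, and \<open>\<i> ^ 12 = 1\<close>,
    so the constant is exactly \<open>tpi ^ 12\<close>.\<close>
  also have "\<dots> = tpi ^ 12 * eta24 q * inverse w ^ 12"
    unfolding eta24_discriminant[OF q] tpi_def power_mult_distrib i by simp
  finally show ?thesis using w by (simp add: field_simps flip: power_add)
qed

lemma region_iff:
  "(w, q) \<in> region \<longleftrightarrow> w \<noteq> 0 \<and> q \<in> ball 0 1 - {0} \<and> e4 q \<noteq> 0 \<and> tpi ^ 12 * eta24 q * inverse w ^ 6 \<in> - \<real>\<^sub>\<le>\<^sub>0"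
proof -
  have n: "complex_of_real ` {..0} = \<real>\<^sub>\<le>\<^sub>0" by (auto simp: nonpos_Reals_def)
  show ?thesis
    unfolding region_def n eis_fold using jac_nonzero[of w q] w6_Delta[of w q] by auto
qed

lemma open_region_slices: "open {v. (v, q) \<in> region}" "open {z. (w, z) \<in> region}"
proof -
  have "open {v. (v, q) \<in> region}" if "q \<in> ball 0 1 - {0}" "e4 q \<noteq> 0"
  proof -
    have "open ((- {0}) \<inter> (\<lambda>v. tpi ^ 12 * eta24 q * inverse v ^ 6) -` (- \<real>\<^sub>\<le>\<^sub>0))"
      by (intro continuous_open_preimage open_Compl closed_nonpos_Reals_complex continuous_intros) auto
    also have "\<dots> = {v. (v, q) \<in> region}" using that by (auto simp: region_iff)
    finally show ?thesis .
  qed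
  then show "open {v. (v, q) \<in> region}"
    by (cases "q \<in> ball 0 1 - {0} \<and> e4 q \<noteq> 0") (auto simp: region_iff)
  have "open {z. (w, z) \<in> region}" if "w \<noteq> 0"
  proof -
    have "open ((ball 0 1 - {0}) \<inter> e4 -` (- {0}))"
      by (intro continuous_open_preimage open_Compl open_Diff holomorphic_on_imp_continuous_on
          holomorphic_on_subset[OF holomorphic_e(2)]) auto
    moreover have "open ((ball 0 1 - {0}) \<inter> (\<lambda>z. tpi ^ 12 * eta24 z * inverse w ^ 6) -` (- \<real>\<^sub>\<le>\<^sub>0))"
      by (intro continuous_open_preimage open_Compl closed_nonpos_Reals_complex open_Diff continuous_intros
          holomorphic_on_imp_continuous_on holomorphic_on_subset[OF holomorphic_eta24]) auto
    ultimately have "open (((ball 0 1 - {0}) \<inter> e4 -` (- {0})) \<inter> ((ball 0 1 - {0}) \<inter> (\<lambda>z. tpi ^ 12 * eta24 z * inverse w ^ 6) -` (- \<real>\<^sub>\<le>\<^sub>0)))"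
      by (rule open_Int)
    also have "\<dots> = {z. (w, z) \<in> region}" using that by (auto simp: region_iff)
    finally show ?thesis .
  qed
  then show "open {z. (w, z) \<in> region}"
    by (cases "w = 0") (auto simp: region_iff)
qed

text \<open>\<open>dnu\<close> takes one-variable derivatives, so agreement on the open slices of
  the region is enough. This lets closed forms that are established only on the region be
  differentiated, and differentiated again.\<close>

lemma dnu_cong:
  assumes wq: "(w, q) \<in> region" and eq: "\<And>v z. (v, z) \<in> region \<Longrightarrow> G v z = H v z"
    and Hw: "((\<lambda>v. H v q) has_field_derivative Hw) (at w)"
    and Hq: "((\<lambda>z. H w z) has_field_derivative Hq) (at q)"
  shows "dnu G w q = xi0 w q * (e4 q * (q * Hq) + w * Hw * (e2 q * e4 q - e6 q) / 12)"
proof (rule dnu_eq)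
  show "((\<lambda>v. G v q) has_field_derivative Hw) (at w)"
    by (rule has_field_derivative_transform_within_open[OF Hw open_region_slices(1)[of q]]) (use wq eq in auto)
  show "((\<lambda>z. G w z) has_field_derivative Hq) (at q)"
    by (rule has_field_derivative_transform_within_open[OF Hq open_region_slices(2)[of w]]) (use wq eq in auto)
qed (use wq in \<open>auto simp: region_iff\<close>)

lemma DERIV_eta24:
  assumes "norm q < 1" "q \<noteq> 0"
  shows "(eta24 has_field_derivative e2 q * eta24 q / q) (at q)"
proof -
  have "(eta24 has_field_derivative deriv eta24 q) (at q)"
    by (rule holomorphic_derivI[OF holomorphic_eta24]) (use assms in auto)
  moreover have "deriv eta24 q = e2 q * eta24 q / q"
    using deriv_eta24[OF assms(1)] assms(2) by (simp add: field_simps)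
  ultimately show ?thesis by simp
qed

lemma dnu_F1:
  assumes wq: "(w, q) \<in> region"
  shows "dnu F1 w q = xi0 w q * (- (1 / 24) * (e2 q * e4 q + e6 q))"
proof -
  have w: "w \<noteq> 0" and q: "norm q < 1" "q \<noteq> 0" "e4 q \<noteq> 0"
    and np: "tpi ^ 12 * eta24 q * inverse w ^ 6 \<notin> \<real>\<^sub>\<le>\<^sub>0"
    using wq by (auto simp: region_iff)
  have e: "eta24 q \<noteq> 0" using eta24_nonzero q by auto
  let ?H = "\<lambda>w q. - (1 / 12) * Ln (tpi ^ 12 * eta24 q * inverse w ^ 6)"
  have L: "(Ln has_field_derivative inverse (tpi ^ 12 * eta24 q * inverse w ^ 6)) (at (tpi ^ 12 * eta24 q * inverse w ^ 6))"
    by (rule has_field_derivative_Ln[OF np])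
  have "((\<lambda>v. tpi ^ 12 * eta24 q * inverse v ^ 6) has_field_derivative tpi ^ 12 * eta24 q * (- 6 * inverse w ^ 6 / w)) (at w)"
    using DERIV_inverse_power[OF w, of 5] by (intro DERIV_cmult) simp
  from DERIV_cmult[OF DERIV_chain2[OF L this], of "- (1 / 12)"]
  have Hw: "((\<lambda>v. ?H v q) has_field_derivative 1 / (2 * w)) (at w)"
    using w e by (simp add: field_simps)
  have "((\<lambda>z. tpi ^ 12 * eta24 z * inverse w ^ 6) has_field_derivative tpi ^ 12 * (e2 q * eta24 q / q) * inverse w ^ 6) (at q)"
    by (intro DERIV_cmult DERIV_cmult_right DERIV_eta24 q)
  from DERIV_cmult[OF DERIV_chain2[OF L this], of "- (1 / 12)"]
  have Hq: "((\<lambda>z. ?H w z) has_field_derivative - (1 / 12) * (e2 q / q)) (at q)"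
    using w e q by (simp add: field_simps)
  have "dnu F1 w q = xi0 w q * (e4 q * (q * (- (1 / 12) * (e2 q / q))) + w * (1 / (2 * w)) * (e2 q * e4 q - e6 q) / 12)"
    by (rule dnu_cong[OF wq _ Hw Hq]) (auto simp: F1_def region_iff w6_Delta)
  also have "e4 q * (q * (- (1 / 12) * (e2 q / q))) + w * (1 / (2 * w)) * (e2 q * e4 q - e6 q) / 12 = - (1 / 24) * (e2 q * e4 q + e6 q)"
    using w q by (simp add: field_simps)
  finally show ?thesis .
qed

text \<open>The factor \<open>xi0 ^ n\<close> is proportional to
  \<open>w ^ (5 * n) / eta24 ^ n\<close>, so \<open>q d/dq\<close> multiplies it by
  \<open>- n * e2\<close> and \<open>w d/dw\<close> by \<open>5 * n\<close>. The coefficients 7 and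
  5 come from \<open>- e2 * e4 + 5 / 12 * (e2 * e4 - e6) = - (7 * e2 * e4 + 5 * e6) /
  12\<close>.\<close>

definition nuderiv :: "nat \<Rightarrow> (complex \<Rightarrow> complex) \<Rightarrow> complex \<Rightarrow> complex" where
  "nuderiv n R q = e4 q * (q * deriv R q) - of_nat n / 12 * ((7 * (e2 q * e4 q) + 5 * e6 q) * R q)"

lemma dnu_xi0_power:
  assumes wq: "(w, q) \<in> region" and G: "\<And>v z. (v, z) \<in> region \<Longrightarrow> G v z = xi0 v z ^ n * R z"
    and R: "R holomorphic_on ball 0 1"
  shows "dnu G w q = xi0 w q ^ Suc n * nuderiv n R q"
proof -
  have w: "w \<noteq> 0" and q: "norm q < 1" "q \<noteq> 0"
    using wq by (auto simp: region_iff)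
  have e: "eta24 q \<noteq> 0" using eta24_nonzero q by auto
  have xw: "((\<lambda>v. xi0 v q) has_field_derivative 5 * xi0 w q / w) (at w)"
    unfolding xi0_def using w e by (auto intro!: derivative_eq_intros simp: field_simps eval_nat_numeral)
  have xq: "((\<lambda>z. xi0 w z) has_field_derivative - e2 q * xi0 w q / q) (at q)"
    unfolding xi0_def using DERIV_divide[OF DERIV_const DERIV_eta24[OF q] e, of "- (1 / 2) * (w / tpi) ^ 5"] e q
    by (simp add: field_simps)
  have pow: "((\<lambda>v. f v ^ n) has_field_derivative of_nat n * d * f x ^ n) (at x)"
    if "(f has_field_derivative d * f x) (at x)" for f :: "complex \<Rightarrow> complex" and d x
    using DERIV_power_Suc[OF that, of "n - 1"] by (cases n) (simp_all add: algebra_simps)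
  have Hw: "((\<lambda>v. xi0 v q ^ n * R q) has_field_derivative of_nat n * (5 / w) * xi0 w q ^ n * R q) (at w)"
    by (intro DERIV_cmult_right pow) (use xw in simp)
  have Rq: "(R has_field_derivative deriv R q) (at q)"
    by (rule holomorphic_derivI[OF R open_ball]) (use q in auto)
  have "((\<lambda>z. xi0 w z ^ n) has_field_derivative of_nat n * (- e2 q / q) * xi0 w q ^ n) (at q)"
    by (intro pow) (use xq in simp)
  from DERIV_mult[OF this Rq]
  have Hq: "((\<lambda>z. xi0 w z ^ n * R z) has_field_derivative
      of_nat n * (- e2 q / q) * xi0 w q ^ n * R q + deriv R q * xi0 w q ^ n) (at q)" .
  have "dnu G w q = xi0 w q * (e4 q * (q * (of_nat n * (- e2 q / q) * xi0 w q ^ n * R q + deriv R q * xi0 w q ^ n))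
      + w * (of_nat n * (5 / w) * xi0 w q ^ n * R q) * (e2 q * e4 q - e6 q) / 12)"
    by (rule dnu_cong[OF wq G Hw Hq])
  also have "\<dots> = xi0 w q ^ Suc n * nuderiv n R q"
    unfolding nuderiv_def using w q by (simp add: field_simps)
  finally show ?thesis .
qed

section \<open>The recursion\<close>

definition Pfun :: "(nat \<Rightarrow> nat \<Rightarrow> nat \<Rightarrow> nat \<Rightarrow> complex) \<Rightarrow> nat \<Rightarrow> complex \<Rightarrow> complex" where
  "Pfun C g q = Ppoly (C g) g (e2 q) (e4 q) (e6 q)"

text \<open>The polynomial factor of the first \<nu>-derivative of \<open>F_h\<close>, whose other
  factor is \<open>xi0 ^ (2 * h - 1)\<close>. \<open>F_1\<close> is a logarithm and has no such
  polynomial, but its derivative has one, of weight 6.\<close>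

definition Qfun :: "(nat \<Rightarrow> nat \<Rightarrow> nat \<Rightarrow> nat \<Rightarrow> complex) \<Rightarrow> nat \<Rightarrow> complex \<Rightarrow> complex" where
  "Qfun C h = (if h = 1 then (\<lambda>q. - (1 / 24) * (e2 q * e4 q + e6 q)) else nuderiv (2 * h - 2) (Pfun C h))"

text \<open>The right-hand side of the anomaly equation without its factor
  \<open>xi0 ^ (2 * g - 2)\<close>; the index \<open>2 * g - 3\<close> is the power of
  \<open>xi0\<close> carried by \<open>Fnu C (g - 1)\<close>.\<close>

definition anomaly :: "(nat \<Rightarrow> nat \<Rightarrow> nat \<Rightarrow> nat \<Rightarrow> complex) \<Rightarrow> nat \<Rightarrow> complex \<Rightarrow> complex" where
  "anomaly C g q = - (1 / 24) * (nuderiv (2 * g - 3) (Qfun C (g - 1)) q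
     + (\<Sum>h = 1..g - 1. Qfun C h q * Qfun C (g - h) q))"

lemma idx_eq: "idx g = qidx (14 * (g - 1)) (3 * (g - 1))"
  by (simp add: idx_def qidx_def)

lemma Pfun_eq: "Pfun C g q = (\<Sum>x\<in>idx g. (case x of (a, b, k) \<Rightarrow> C g a b k) * eis_mono x q)"
  unfolding Pfun_def Ppoly_def eis_mono_def by (rule sum.cong) (auto simp: mult.assoc)

lemma qm_Pfun: "qm (14 * (g - 1)) (3 * (g - 1)) (Pfun C g)"
  unfolding qm_def Pfun_eq idx_eq by blast

lemma qm_nuderiv:
  assumes "qm K m R"
  shows "qm (K + 6) (m + 1) (nuderiv n R)"
proof -
  have "qm 6 1 (\<lambda>q. 7 * (e2 q * e4 q) + 5 * e6 q)"
    by (intro qm_add qm_cmult qm_mult[OF qm_e(1,2)] qm_mono_le[OF qm_e(3)]) auto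
  then show ?thesis
    unfolding nuderiv_def[abs_def]
    by (intro qm_diff qm_cmult qm_mult[OF qm_e(2) qm_euler[OF assms]] qm_mult[OF _ assms]) auto
qed

lemma qm_Qfun:
  assumes "h \<ge> 1"
  shows "qm (14 * (h - 1) + 6) (3 * (h - 1) + 1) (Qfun C h)"
proof (cases "h = 1")
  case True
  have "qm 6 1 (\<lambda>q. - (1 / 24) * (e2 q * e4 q + e6 q))"
    by (intro qm_cmult qm_add qm_mult[OF qm_e(1,2)] qm_mono_le[OF qm_e(3)]) auto
  then show ?thesis using True by (simp add: Qfun_def)
next
  case False
  then show ?thesis unfolding Qfun_def using qm_nuderiv[OF qm_Pfun[of h C]] by simp
qed

text \<open>These are the weight \<open>14 * (g - 1) - 2\<close> and the depth
  \<open>3 * (g - 1) - 1\<close> of an E2-derivative of \<open>P_g\<close>, which is what makes the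
  equation solvable by integrating monomials in \<open>e2\<close>.\<close>

lemma qm_anomaly:
  assumes "g \<ge> 2"
  shows "qm (14 * (g - 2) + 12) (3 * (g - 2) + 2) (anomaly C g)"
  unfolding anomaly_def[abs_def]
proof (intro qm_cmult qm_add qm_sum)
  have "qm (14 * (g - 1 - 1) + 6 + 6) (3 * (g - 1 - 1) + 1 + 1) (nuderiv (2 * g - 3) (Qfun C (g - 1)))"
    by (rule qm_nuderiv[OF qm_Qfun]) (use assms in simp)
  moreover have "14 * (g - 1 - 1) + 6 + 6 = 14 * (g - 2) + 12" "3 * (g - 1 - 1) + 1 + 1 = 3 * (g - 2) + 2"
    using assms by simp_all
  ultimately show "qm (14 * (g - 2) + 12) (3 * (g - 2) + 2) (nuderiv (2 * g - 3) (Qfun C (g - 1)))"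
    by (simp only:)
  fix h assume h: "h \<in> {1..g - 1}"
  then show "qm (14 * (g - 2) + 12) (3 * (g - 2) + 2) (\<lambda>q. Qfun C h q * Qfun C (g - h) q)"
    by (intro qm_mult[OF qm_Qfun qm_Qfun]) auto
qed

lemma Fg_eq:
  assumes "e4 q \<noteq> 0"
  shows "Fg C g w q = xi0 w q ^ (2 * g - 2) * Pfun C g q"
  unfolding Fg_def Pfun_def eis_fold xi0_eq[OF assms] ..

lemma Fnu_eq:
  assumes wq: "(w, q) \<in> region" and h: "h \<ge> 1"
  shows "Fnu C h w q = xi0 w q ^ (2 * h - 1) * Qfun C h q"
proof (cases "h = 1")
  case True
  then show ?thesis by (simp add: Fnu_def Qfun_def dnu_F1[OF wq])
next
  case False
  have "dnu (Fg C h) w q = xi0 w q ^ Suc (2 * h - 2) * nuderiv (2 * h - 2) (Pfun C h) q"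
    by (rule dnu_xi0_power[OF wq Fg_eq holomorphic_qm[OF qm_Pfun]]) (simp add: region_iff)
  moreover have "Suc (2 * h - 2) = 2 * h - 1" using h by simp
  ultimately show ?thesis using False by (simp add: Fnu_def Qfun_def)
qed

lemma HAE_rhs:
  assumes wq: "(w, q) \<in> region" and g: "g \<ge> 2"
  shows "- (1 / 24) * (dnu (Fnu C (g - 1)) w q + (\<Sum>h = 1..g - 1. Fnu C h w q * Fnu C (g - h) w q))
    = xi0 w q ^ (2 * g - 2) * anomaly C g q"
proof -
  have "dnu (Fnu C (g - 1)) w q = xi0 w q ^ Suc (2 * (g - 1) - 1) * nuderiv (2 * (g - 1) - 1) (Qfun C (g - 1)) q"
    by (rule dnu_xi0_power[OF wq Fnu_eq holomorphic_qm[OF qm_Qfun]]) (use g in auto)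
  moreover have "Suc (2 * (g - 1) - 1) = 2 * g - 2" "2 * (g - 1) - 1 = 2 * g - 3" using g by auto
  ultimately have 1: "dnu (Fnu C (g - 1)) w q = xi0 w q ^ (2 * g - 2) * nuderiv (2 * g - 3) (Qfun C (g - 1)) q"
    by (simp only:)
  have 2: "Fnu C h w q * Fnu C (g - h) w q = xi0 w q ^ (2 * g - 2) * (Qfun C h q * Qfun C (g - h) q)"
    if h: "h \<in> {1..g - 1}" for h
  proof -
    have "2 * g - 2 = (2 * h - 1) + (2 * (g - h) - 1)" using h by auto
    then have "xi0 w q ^ (2 * g - 2) = xi0 w q ^ (2 * h - 1) * xi0 w q ^ (2 * (g - h) - 1)"
      by (simp only: power_add)
    moreover have "h \<ge> 1" "g - h \<ge> 1" using h by auto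
    ultimately show ?thesis using Fnu_eq[OF wq] by (simp add: mult_ac)
  qed
  have 3: "(\<Sum>h = 1..g - 1. Fnu C h w q * Fnu C (g - h) w q) = xi0 w q ^ (2 * g - 2) * (\<Sum>h = 1..g - 1. Qfun C h q * Qfun C (g - h) q)"
    unfolding sum_distrib_left by (rule sum.cong[OF refl 2])
  show ?thesis
    unfolding 1 3 anomaly_def by (simp only: distrib_left mult_ac)
qed

text \<open>Choosing \<open>w\<close> as a sixth root of \<open>c\<close> makes the argument of the
  logarithm in \<open>F_1\<close> equal to 1, away from the branch cut. Hence conditions over the
  region reach every such \<open>q\<close>.\<close>

lemma region_fibre:
  assumes "norm q < 1" "q \<noteq> 0" "e4 q \<noteq> 0"
  obtains w where "(w, q) \<in> region"
proof
  define c where "c = tpi ^ 12 * eta24 q"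
  have c: "c \<noteq> 0" using eta24_nonzero assms by (simp add: c_def)
  define w where "w = exp (Ln c / 6)"
  have "w ^ 6 = exp (6 * (Ln c / 6))" unfolding w_def by (simp flip: exp_of_nat_mult)
  then have "w ^ 6 = c" using c by simp
  then have "c * inverse w ^ 6 = 1" using c by (simp add: power_inverse)
  then show "(w, q) \<in> region" using assms by (simp add: region_iff c_def w_def)
qed

definition dPfun :: "(nat \<Rightarrow> nat \<Rightarrow> nat \<Rightarrow> nat \<Rightarrow> complex) \<Rightarrow> nat \<Rightarrow> complex \<Rightarrow> complex" where
  "dPfun C g q = dPoly (C g) g (e2 q) (e4 q) (e6 q)"

lemma dPfun_eq:
  assumes "g \<ge> 2"
  shows "dPfun C g q = (\<Sum>x\<in>qidx (14 * (g - 2) + 12) (3 * (g - 2) + 2).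
      (case x of (a, b, k) \<Rightarrow> of_nat (Suc k) * C g a b (Suc k)) * eis_mono x q)"
proof -
  let ?J = "qidx (14 * (g - 2) + 12) (3 * (g - 2) + 2)"
  have "dPfun C g q = (\<Sum>(a, b, k)\<in>(\<lambda>(a, b, k). (a, b, Suc k)) ` ?J. of_nat k * C g a b k * e4 q ^ a * e6 q ^ b * e2 q ^ (k - 1))"
    unfolding dPfun_def dPoly_def
  proof (rule sum.mono_neutral_right)
    show "finite (idx g)" by (simp add: idx_eq)
    show "(\<lambda>(a, b, k). (a, b, Suc k)) ` ?J \<subseteq> idx g"
      using assms by (auto simp: idx_eq qidx_def)
    \<comment> \<open>Terms with \<open>k = 0\<close> carry the factor \<open>of_nat 0\<close>, so
      the truncated exponent \<open>k - 1\<close> is harmless there.\<close>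
    show "\<forall>x\<in>idx g - (\<lambda>(a, b, k). (a, b, Suc k)) ` ?J.
        (case x of (a, b, k) \<Rightarrow> of_nat k * C g a b k * e4 q ^ a * e6 q ^ b * e2 q ^ (k - 1)) = 0"
    proof
      fix x assume x: "x \<in> idx g - (\<lambda>(a, b, k). (a, b, Suc k)) ` ?J"
      obtain a b k where abk: "x = (a, b, k)" by (cases x)
      have "k = 0"
      proof (cases k)
        case (Suc j)
        then have "(a, b, j) \<in> ?J" using x assms by (auto simp: idx_eq qidx_def abk)
        then have "x \<in> (\<lambda>(a, b, k). (a, b, Suc k)) ` ?J" unfolding abk Suc by force
        then show ?thesis using x by simp
      qed
      then show "(case x of (a, b, k) \<Rightarrow> of_nat k * C g a b k * e4 q ^ a * e6 q ^ b * e2 q ^ (k - 1)) = 0"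
        by (simp add: abk)
    qed
  qed
  also have "\<dots> = (\<Sum>x\<in>?J. (case x of (a, b, k) \<Rightarrow> of_nat (Suc k) * C g a b (Suc k)) * eis_mono x q)"
    by (subst sum.reindex) (auto simp: inj_on_def eis_mono_def mult.assoc intro!: sum.cong)
  finally show ?thesis .
qed

lemma qm_dPfun: "g \<ge> 2 \<Longrightarrow> qm (14 * (g - 2) + 12) (3 * (g - 2) + 2) (dPfun C g)"
  unfolding qm_def by (intro exI allI impI) (rule dPfun_eq)

text \<open>Both sides carry the same nonzero power of \<open>xi0\<close>, and with it
  \<open>w\<close> drops out. The region omits \<open>q = 0\<close> and the zeros of
  \<open>e4\<close>; the identity theorem restores these points.\<close>

lemma HAE_iff:
  assumes g: "g \<ge> 2"
  shows "HAE C g \<longleftrightarrow> (\<forall>q. norm q < 1 \<longrightarrow> dPfun C g q = anomaly C g q)"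
proof -
  have lhs: "dFg_dE2 C g w q = xi0 w q ^ (2 * g - 2) * dPfun C g q" if "(w, q) \<in> region" for w q
  proof -
    have "e4 q \<noteq> 0" using that by (simp add: region_iff)
    then show ?thesis unfolding dFg_dE2_def dPfun_def eis_fold by (simp only: xi0_eq[OF \<open>e4 q \<noteq> 0\<close>])
  qed
  have nz: "xi0 w q \<noteq> 0" if "(w, q) \<in> region" for w q
    using that xi0_nonzero[of w q] by (auto simp: region_iff)
  have H: "HAE C g \<longleftrightarrow> (\<forall>(w, q)\<in>region. dPfun C g q = anomaly C g q)"
    unfolding HAE_def
  proof (rule ball_cong[OF refl], clarify)
    fix w q assume wq: "(w, q) \<in> region"
    show "(dFg_dE2 C g w q = - (1 / 24) * (dnu (Fnu C (g - 1)) w q + (\<Sum>h = 1..g - 1. Fnu C h w q * Fnu C (g - h) w q)))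
        = (dPfun C g q = anomaly C g q)"
      unfolding HAE_rhs[OF wq g] lhs[OF wq] using nz[OF wq] by simp
  qed
  show ?thesis
  proof
    assume hae: "HAE C g"
    obtain r where r: "0 < r" "r \<le> 1" "\<And>q. norm q < r \<Longrightarrow> e4 q \<noteq> 0" using nonzero_disc[OF holomorphic_e(2)] by auto
    have eq: "dPfun C g q = anomaly C g q" if qr: "q \<in> ball 0 r - {0}" for q
    proof -
      have "norm q < 1" "q \<noteq> 0" "e4 q \<noteq> 0" using r qr by auto
      then obtain w where "(w, q) \<in> region" by (rule region_fibre)
      then show ?thesis using hae H by auto
    qed
    show "\<forall>q. norm q < 1 \<longrightarrow> dPfun C g q = anomaly C g q"
    proof (intro allI impI)
      fix q :: complex assume q: "norm q < 1"
      have "of_real (r / 2) \<in> ball (0::complex) r - {0}" using r by auto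
      then have ne: "ball (0::complex) r - {0} \<noteq> {}" by blast
      show "dPfun C g q = anomaly C g q"
      proof (rule analytic_continuation_open[OF _ open_ball ne connected_ball _
            holomorphic_qm[OF qm_dPfun[OF g]] holomorphic_qm[OF qm_anomaly[OF g]] eq])
        show "open (ball (0::complex) r - {0})" by (intro open_Diff) auto
        show "ball (0::complex) r - {0} \<subseteq> ball 0 1" using r by auto
        show "q \<in> ball 0 1" using q by simp
      qed
    qed
  next
    assume "\<forall>q. norm q < 1 \<longrightarrow> dPfun C g q = anomaly C g q"
    then show "HAE C g" unfolding H by (auto simp: region_iff)
  qed
qed

text \<open>The power series \<open>\<nu> \<xi>/E4\<close>, with its removable singularity at \<open>q = 0\<close> filled in.\<close>

definition Ufun :: "complex \<Rightarrow> complex" where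
  "Ufun q = deriv e4 q / (240 * euler q ^ 24)"

lemma holomorphic_Ufun: "Ufun holomorphic_on ball 0 1"
  unfolding Ufun_def[abs_def]
  by (intro holomorphic_intros holomorphic_euler holomorphic_deriv holomorphic_e) (auto simp: euler_nonzero)

lemma Ufun_0: "Ufun 0 = 1"
  by (simp add: Ufun_def deriv_e_0)

text \<open>Ramanujan's identity for \<open>e4\<close> exhibits the zero of \<open>nu\<close> at the
  cusp as a factor \<open>q\<close>, which cancels the one in \<open>eta24\<close>; the constant is
  \<open>(- 3 / 360) * (- 1 / 2) = 1 / 240\<close>.\<close>

lemma nu_xi0:
  assumes "w \<noteq> 0" "norm q < 1" "q \<noteq> 0"
  shows "nu w q * xi0 w q = Ufun q"
proof -
  have b: "e6 q - e2 q * e4 q = - 3 * (q * deriv e4 q)" using ramanujan_e4[OF assms(2)] by simp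
  have "nu w q * xi0 w q = (tpi ^ 5 * inverse w ^ 5 * (w / tpi) ^ 5) * ((q * deriv e4 q) / (240 * eta24 q))"
    unfolding nu_eq xi0_def b by simp
  also have "tpi ^ 5 * inverse w ^ 5 * (w / tpi) ^ 5 = 1"
    using assms by (simp add: power_divide power_inverse)
  finally show ?thesis using assms(3) by (simp add: eta24_conv_euler Ufun_def)
qed

text \<open>Near \<open>q = 0\<close> the series \<open>e4\<close> does not vanish, so
  \<open>Fg\<close> has its closed form there, and the product \<open>nu * xi0\<close> no longer
  involves \<open>w\<close>.\<close>

lemma gap_iff:
  "gap C g \<longleftrightarrow> (\<lambda>q. Ufun q ^ (2 * g - 2) * Pfun C g q - kappa g) \<in> O[at 0](\<lambda>q. q ^ card (qidx (14 * (g - 1)) 0))"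
proof -
  have ev: "\<forall>\<^sub>F q in at 0. nu w q ^ (2 * g - 2) * Fg C g w q - kappa g = Ufun q ^ (2 * g - 2) * Pfun C g q - kappa g"
    if "w \<noteq> 0" for w
  proof -
    obtain r where r: "0 < r" "r \<le> 1" "\<And>q. norm q < r \<Longrightarrow> e4 q \<noteq> 0" using nonzero_disc[OF holomorphic_e(2)] by auto
    have "\<forall>\<^sub>F q in at 0. q \<in> ball 0 r - {0::complex}" by (rule eventually_at_in_open) (use r in auto)
    then show ?thesis
    proof eventually_elim
      case (elim q)
      then have "norm q < 1" "q \<noteq> 0" "e4 q \<noteq> 0" using r by auto
      then show ?case
        unfolding Fg_eq[OF \<open>e4 q \<noteq> 0\<close>] using nu_xi0[OF that, of q] by (simp add: power_mult_distrib[symmetric] mult.assoc[symmetric])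
    qed
  qed
  have d: "dimM (14 * (g - 1)) = card (qidx (14 * (g - 1)) 0)" by (rule dimM_eq) simp
  have "gap C g \<longleftrightarrow> (\<forall>w. w \<noteq> (0::complex) \<longrightarrow> (\<lambda>q. Ufun q ^ (2 * g - 2) * Pfun C g q - kappa g) \<in> O[at 0](\<lambda>q. q ^ card (qidx (14 * (g - 1)) 0)))"
    unfolding gap_def d using landau_o.big.in_cong[OF ev] by blast
  then show ?thesis using zero_neq_one by blast
qed

section \<open>Landau bounds at 0 as orders of vanishing\<close>

lemma bigo_powerI:
  fixes H B :: "complex \<Rightarrow> complex"
  assumes "B holomorphic_on ball 0 r" "0 < r" "\<And>q. norm q < r \<Longrightarrow> q \<noteq> 0 \<Longrightarrow> H q = q ^ N * B q"
  shows "H \<in> O[at 0](\<lambda>q. q ^ N)"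
proof (rule bigoI_tendsto)
  have ev: "\<forall>\<^sub>F q in at 0. q \<in> ball 0 r - {0::complex}" by (rule eventually_at_in_open) (use assms in auto)
  then show "\<forall>\<^sub>F q in at 0. q ^ N \<noteq> (0 :: complex)" by eventually_elim auto
  have "isCont B 0"
    using holomorphic_on_imp_continuous_on[OF assms(1)] assms(2) by (simp add: continuous_on_eq_continuous_at)
  then have "B \<midarrow>0\<rightarrow> B 0" by (simp add: isCont_def)
  moreover have "\<forall>\<^sub>F q in at 0. H q / q ^ N = B q"
    using ev by eventually_elim (use assms(3) in auto)
  ultimately show "((\<lambda>q. H q / q ^ N) \<longlongrightarrow> B 0) (at 0)"
    by (simp add: tendsto_cong)
qed

text \<open>A bound by a positive power of \<open>q\<close> forces the limit 0, hence
  \<open>H 0 = 0\<close> by continuity; a factor \<open>q\<close> is split off and the bound passes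
  to the quotient.\<close>

lemma bigo_powerD:
  fixes H :: "complex \<Rightarrow> complex"
  assumes "H holomorphic_on ball 0 1" "H \<in> O[at 0](\<lambda>q. q ^ N)"
  shows "\<exists>G. G holomorphic_on ball 0 1 \<and> (\<forall>q. norm q < 1 \<longrightarrow> H q = q ^ N * G q)"
  using assms
proof (induction N arbitrary: H)
  case 0
  then show ?case by auto
next
  case (Suc N)
  obtain c where "\<forall>\<^sub>F q in at 0. norm (H q) \<le> c * norm (q ^ Suc N)"
    using Suc.prems(2) by (elim landau_o.bigE)
  then have c: "\<forall>\<^sub>F q in at 0. norm (H q) \<le> c * norm q ^ Suc N" by (simp only: norm_power)
  have "((\<lambda>q::complex. norm q) \<longlongrightarrow> norm (0::complex)) (at 0)"
    by (rule tendsto_norm[OF tendsto_ident_at])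
  then have "((\<lambda>q::complex. c * norm q ^ Suc N) \<longlongrightarrow> c * norm (0::complex) ^ Suc N) (at 0)"
    by (intro tendsto_mult tendsto_const tendsto_power)
  then have "(H \<longlongrightarrow> 0) (at 0)" by (intro Lim_null_comparison[OF c]) simp
  moreover have "isCont H 0"
    using holomorphic_on_imp_continuous_on[OF Suc.prems(1)] by (simp add: continuous_on_eq_continuous_at)
  then have "H \<midarrow>0\<rightarrow> H 0" by (simp add: isCont_def)
  ultimately have "H 0 = 0" by (rule LIM_unique[rotated])
  then obtain G where G: "G holomorphic_on ball 0 1" "\<And>q. norm q < 1 \<Longrightarrow> H q = q * G q"
    using holomorphic_factor_root[OF Suc.prems(1)] by metis
  have "\<forall>\<^sub>F q in at 0. q \<in> ball 0 1 - {0::complex}" by (rule eventually_at_in_open) auto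
  then have "\<forall>\<^sub>F q in at 0. norm (G q) \<le> c * norm (q ^ N)"
    using c
  proof eventually_elim
    case (elim q)
    then have "norm q * norm (G q) \<le> norm q * (c * norm (q ^ N))" "0 < norm q"
      using G(2)[of q] by (simp_all add: norm_mult norm_power mult_ac)
    then show ?case by (simp only: mult_le_cancel_left_pos)
  qed
  then have "G \<in> O[at 0](\<lambda>q. q ^ N)" by (rule bigoI)
  from Suc.IH[OF G(1) this] G(2) show ?case by (metis mult.assoc power_Suc)
qed

section \<open>Solving one level of the recursion\<close>

lemma anomaly_cong:
  assumes eq: "\<And>h a b k. 2 \<le> h \<Longrightarrow> h < g \<Longrightarrow> (a, b, k) \<in> idx h \<Longrightarrow> C h a b k = C' h a b k" and g: "g \<ge> 2"
  shows "anomaly C g = anomaly C' g"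
proof -
  have P: "Pfun C h = Pfun C' h" if "2 \<le> h" "h < g" for h
    unfolding fun_eq_iff Pfun_eq using eq[OF that] by (auto intro!: sum.cong)
  have Q: "Qfun C h = Qfun C' h" if "1 \<le> h" "h < g" for h
    using P[of h] that by (cases "h = 1") (auto simp: Qfun_def)
  have "Qfun C (g - 1) = Qfun C' (g - 1)" using Q[of "g - 1"] g by simp
  moreover have "(\<Sum>h = 1..g - 1. Qfun C h q * Qfun C (g - h) q) = (\<Sum>h = 1..g - 1. Qfun C' h q * Qfun C' (g - h) q)" for q
    by (rule sum.cong[OF refl]) (use Q in auto)
  ultimately show ?thesis by (intro ext) (simp only: anomaly_def)
qed

lemma solution_unique:
  assumes g: "g \<ge> 2" and C: "HAE C g" "gap C g" and C': "HAE C' g" "gap C' g"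
    and eq: "\<And>h a b k. 2 \<le> h \<Longrightarrow> h < g \<Longrightarrow> (a, b, k) \<in> idx h \<Longrightarrow> C h a b k = C' h a b k"
    and x: "x \<in> idx g"
  shows "(case x of (a, b, k) \<Rightarrow> C g a b k) = (case x of (a, b, k) \<Rightarrow> C' g a b k)"
proof -
  let ?K = "14 * (g - 1)" and ?J = "qidx (14 * (g - 2) + 12) (3 * (g - 2) + 2)"
  let ?N = "card (qidx ?K 0)"
  define d where "d = (\<lambda>(a, b, k). C g a b k - C' g a b k)"
  have "dPfun C g q = dPfun C' g q" if "norm q < 1" for q
    using C(1) C'(1) that anomaly_cong[of g C C', OF eq g] unfolding HAE_iff[OF g] by simp
  then have "(\<Sum>y\<in>?J. (case y of (a, b, k) \<Rightarrow> of_nat (Suc k) * d (a, b, Suc k)) * eis_mono y q) = 0" if "norm q < 1" for q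
    using that unfolding dPfun_eq[OF g]
    by (simp add: d_def case_prod_unfold algebra_simps sum_subtractf sum.distrib del: of_nat_Suc)
  \<comment> \<open>Independence of the monomials turns the identity of functions into one of
    coefficients and so removes every coefficient with a positive power of
    \<open>e2\<close>.\<close>
  then have z: "(case y of (a, b, k) \<Rightarrow> of_nat (Suc k) * d (a, b, Suc k)) = 0" if "y \<in> ?J" for y
    by (rule eis_mono_independent[OF _ that])
  have pos: "d y = 0" if y: "y \<in> idx g" "y \<notin> qidx ?K 0" for y
  proof -
    obtain a b k where abk: "y = (a, b, k)" by (cases y)
    then obtain j where j: "k = Suc j" using y by (cases k) (auto simp: idx_eq qidx_def)
    then have "(a, b, j) \<in> ?J" using y(1) g by (auto simp: abk idx_eq qidx_def)
    from z[OF this] show ?thesis by (simp add: abk j del: of_nat_Suc)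
  qed
  have sub: "qidx ?K 0 \<subseteq> idx g" by (auto simp: idx_eq qidx_def)
  define D where "D = (\<lambda>q. Pfun C g q - Pfun C' g q)"
  have D: "D q = (\<Sum>y\<in>qidx ?K 0. d y * eis_mono y q)" for q
  proof -
    have "D q = (\<Sum>y\<in>idx g. d y * eis_mono y q)"
      unfolding D_def Pfun_eq sum_subtractf[symmetric]
      by (rule sum.cong) (auto simp: d_def algebra_simps)
    also have "\<dots> = (\<Sum>y\<in>qidx ?K 0. d y * eis_mono y q)"
      by (rule sum.mono_neutral_right) (use sub pos in \<open>auto simp: idx_eq\<close>)
    finally show ?thesis .
  qed
  have qmD: "qm ?K 0 D" unfolding qm_def using D by blast
  have "(\<lambda>q. (Ufun q ^ (2 * g - 2) * Pfun C g q - kappa g) - (Ufun q ^ (2 * g - 2) * Pfun C' g q - kappa g)) \<in> O[at 0](\<lambda>q. q ^ ?N)"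
    by (rule sum_in_bigo(2)) (use C(2) C'(2) in \<open>simp_all only: gap_iff\<close>)
  then have UD: "(\<lambda>q. Ufun q ^ (2 * g - 2) * D q) \<in> O[at 0](\<lambda>q. q ^ ?N)"
    by (simp add: D_def algebra_simps)
  have hUD: "(\<lambda>q. Ufun q ^ (2 * g - 2) * D q) holomorphic_on ball 0 1"
    by (intro holomorphic_intros holomorphic_Ufun holomorphic_qm[OF qmD])
  obtain G where G: "G holomorphic_on ball 0 1" "\<And>q. norm q < 1 \<Longrightarrow> Ufun q ^ (2 * g - 2) * D q = q ^ ?N * G q"
    using bigo_powerD[OF hUD UD] by blast
  obtain r where r: "0 < r" "r \<le> 1" "\<And>q. norm q < r \<Longrightarrow> Ufun q \<noteq> 0"
    using nonzero_disc[OF holomorphic_Ufun] Ufun_0 by auto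
  \<comment> \<open>\<open>Ufun\<close> does not vanish near 0, so the order of vanishing passes
    from the product to \<open>D\<close>. The quotient exists only on a small disc, but the Landau
    bound is local and then gives a factorisation of \<open>D\<close> on the whole unit
    disc.\<close>
  have "D \<in> O[at 0](\<lambda>q. q ^ ?N)"
  proof (rule bigo_powerI)
    show "(\<lambda>q. G q / Ufun q ^ (2 * g - 2)) holomorphic_on ball 0 r"
      by (intro holomorphic_intros holomorphic_on_subset[OF G(1)] holomorphic_on_subset[OF holomorphic_Ufun])
         (use r in auto)
    show "D q = q ^ ?N * (G q / Ufun q ^ (2 * g - 2))" if "norm q < r" for q
      using G(2)[of q] r(2) r(3)[OF that] that by (simp add: field_simps)
  qed (rule r)
  then obtain H where H: "H holomorphic_on ball 0 1" "\<And>q. norm q < 1 \<Longrightarrow> D q = q ^ ?N * H q"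
    using bigo_powerD[OF holomorphic_qm[OF qmD]] by blast
  have D0: "D q = 0" if "norm q < 1" for q
    by (rule modular_vanish[OF modular_qm[OF qmD] _ H that]) simp
  have "d y = 0" if "y \<in> qidx ?K 0" for y
    by (rule eis_mono_independent[OF _ that]) (rule D0[unfolded D])
  then have "d x = 0" using pos[OF x] by blast
  then show ?thesis by (auto simp: d_def split: prod.splits)
qed

text \<open>The part of positive degree in \<open>e2\<close> integrates the anomaly; the part of
  degree 0 is interpolated to meet the gap condition. Any choice of \<open>C\<close> at the lower
  levels can be continued, as the recursion requires.\<close>

lemma solution_exists:
  assumes g: "g \<ge> 2"
  shows "\<exists>c. (\<forall>q. norm q < 1 \<longrightarrow> dPfun (C(g := c)) g q = anomaly C g q) \<and> gap (C(g := c)) g"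
proof -
  let ?K = "14 * (g - 1)" and ?J = "qidx (14 * (g - 2) + 12) (3 * (g - 2) + 2)"
  let ?N = "card (qidx ?K 0)"
  obtain a where a: "\<And>q. norm q < 1 \<Longrightarrow> anomaly C g q = (\<Sum>x\<in>?J. a x * eis_mono x q)"
    using qm_anomaly[OF g, of C] unfolding qm_def by metis
  \<comment> \<open>Antiderivative in \<open>e2\<close>: a monomial of degree \<open>k - 1\<close>
    becomes one of degree \<open>k\<close>, divided by \<open>k\<close>. The coefficients for
    \<open>k = 0\<close> are supplied by \<open>c0\<close> instead.\<close>
  define c1 where "c1 = (\<lambda>(i, j, k). a (i, j, k - 1) / of_nat k)"
  define P1 where "P1 = (\<lambda>q. \<Sum>x\<in>idx g - qidx ?K 0. c1 x * eis_mono x q)"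
  have hP1: "P1 holomorphic_on ball 0 1"
    unfolding P1_def by (intro holomorphic_intros holomorphic_eis_mono)
  obtain r where r: "0 < r" "r \<le> 1" "\<And>q. norm q < r \<Longrightarrow> Ufun q \<noteq> 0"
    using nonzero_disc[OF holomorphic_Ufun] Ufun_0 by auto
  have hU: "Ufun holomorphic_on ball 0 r"
    by (rule holomorphic_on_subset[OF holomorphic_Ufun]) (use r in auto)
  \<comment> \<open>Dividing the gap condition by \<open>Ufun ^ (2 * g - 2)\<close> shows which
    Taylor polynomial the degree-zero part of \<open>P_g\<close> must have.\<close>
  have "(\<lambda>q. kappa g / Ufun q ^ (2 * g - 2) - P1 q) holomorphic_on ball 0 r"
    by (intro holomorphic_intros hU holomorphic_on_subset[OF hP1]) (use r in auto)
  from qm_interpolate[OF this r(2) order_refl, of ?K]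
  obtain f G where f: "qm ?K 0 f" "G holomorphic_on ball 0 r"
    "\<And>q. norm q < r \<Longrightarrow> kappa g / Ufun q ^ (2 * g - 2) - P1 q = f q + q ^ ?N * G q" by blast
  obtain c0 where c0: "\<And>q. norm q < 1 \<Longrightarrow> f q = (\<Sum>x\<in>qidx ?K 0. c0 x * eis_mono x q)"
    using f(1) unfolding qm_def by metis
  define c where "c = (\<lambda>i j k. if k = 0 then c0 (i, j, k) else c1 (i, j, k))"
  define C1 where "C1 = C(g := c)"
  have "dPfun C1 g q = anomaly C g q" if "norm q < 1" for q
    unfolding dPfun_eq[OF g] a[OF that]
    by (rule sum.cong) (auto simp: C1_def c_def c1_def simp del: of_nat_Suc)
  moreover have "gap C1 g"
    unfolding gap_iff
  proof (rule bigo_powerI)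
    have sub: "qidx ?K 0 \<subseteq> idx g" by (auto simp: idx_eq qidx_def)
    show "(\<lambda>q. - (Ufun q ^ (2 * g - 2) * G q)) holomorphic_on ball 0 r"
      by (intro holomorphic_intros hU f)
    fix q :: complex assume q: "norm q < r"
    have "Pfun C1 g q = (\<Sum>x\<in>idx g - qidx ?K 0. (case x of (a, b, k) \<Rightarrow> C1 g a b k) * eis_mono x q)
        + (\<Sum>x\<in>qidx ?K 0. (case x of (a, b, k) \<Rightarrow> C1 g a b k) * eis_mono x q)"
      unfolding Pfun_eq by (rule sum.subset_diff[OF sub]) (simp add: idx_eq)
    also have "(\<Sum>x\<in>idx g - qidx ?K 0. (case x of (a, b, k) \<Rightarrow> C1 g a b k) * eis_mono x q) = P1 q"
      unfolding P1_def by (rule sum.cong) (auto simp: C1_def c_def idx_eq qidx_def split: if_splits)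
    also have "(\<Sum>x\<in>qidx ?K 0. (case x of (a, b, k) \<Rightarrow> C1 g a b k) * eis_mono x q) = (\<Sum>x\<in>qidx ?K 0. c0 x * eis_mono x q)"
      by (rule sum.cong) (auto simp: C1_def c_def qidx_def)
    also have "\<dots> = f q" using c0[of q] q r(2) by simp
    finally have "Pfun C1 g q = kappa g / Ufun q ^ (2 * g - 2) - q ^ ?N * G q"
      using f(3)[OF q] by (simp add: algebra_simps)
    then show "Ufun q ^ (2 * g - 2) * Pfun C1 g q - kappa g = q ^ ?N * - (Ufun q ^ (2 * g - 2) * G q)"
      using r(3)[OF q] by (simp add: field_simps)
  qed (rule r)
  ultimately show ?thesis unfolding C1_def by blast
qed

theorem theorem5p2:
  shows "\<exists>C. (\<forall>g\<ge>2. HAE C g \<and> gap C g) \<and>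
           (\<forall>C'. (\<forall>g\<ge>2. HAE C' g \<and> gap C' g) \<longrightarrow>
              (\<forall>g\<ge>2. \<forall>(a, b, k)\<in>idx g. C' g a b k = C g a b k))"
proof -
  \<comment> \<open>The anomaly is formed with \<open>C\<close>, the unknown level with
    \<open>C(g := c)\<close>: the value of \<open>S C g c\<close> then depends only on
    \<open>C\<close> below \<open>g\<close> and on \<open>c\<close>. For \<open>g < 2\<close>
    nothing is demanded, so a choice exists at every index.\<close>
  define S where "S = (\<lambda>C g c. g \<ge> 2 \<longrightarrow>
    (\<forall>q. norm q < 1 \<longrightarrow> dPfun (C(g := c)) g q = anomaly C g q) \<and> gap (C(g := c)) g)"
  have "\<exists>C. \<forall>g. S C g (C g)"
  \<comment> \<open>Well-founded dependent choice requires that \<open>S\<close> see only the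
    earlier values of \<open>C\<close>; \<open>anomaly_cong\<close> provides this.\<close>
  proof (rule dependent_wf_choice[of "{(h, g :: nat). h < g}"])
    show "wf {(h, g :: nat). h < g}" by (rule wf_less)
    show "\<exists>c. S C g c" for C g
      unfolding S_def using solution_exists[of g C] by blast
    fix C C' :: "nat \<Rightarrow> nat \<Rightarrow> nat \<Rightarrow> nat \<Rightarrow> complex" and g c
    assume eq: "\<And>h. (h, g) \<in> {(h, g). h < g} \<Longrightarrow> C h = C' h"
    have "dPfun (C(g := c)) g = dPfun (C'(g := c)) g" "Pfun (C(g := c)) g = Pfun (C'(g := c)) g"
      by (simp_all add: fun_eq_iff dPfun_def Pfun_def)
    moreover have "anomaly C g = anomaly C' g" if "g \<ge> 2"
      by (rule anomaly_cong) (use eq that in auto)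
    ultimately show "S C g c = S C' g c" unfolding S_def gap_iff by auto
  qed
  then obtain C where "\<And>g. S C g (C g)" by blast
  then have sol: "HAE C g \<and> gap C g" if "g \<ge> 2" for g
    unfolding HAE_iff[OF that] using that by (simp add: S_def)
  have uniq: "\<forall>(a, b, k)\<in>idx g. C' g a b k = C g a b k"
    if C': "\<forall>g\<ge>2. HAE C' g \<and> gap C' g" and "g \<ge> 2" for C' g
    using that(2)
  proof (induction g rule: less_induct)
    case (less g)
    have IH: "C' h a b k = C h a b k" if "2 \<le> h" "h < g" "(a, b, k) \<in> idx h" for h a b k
      using less.IH[OF that(2,1)] that(3) by fast
    show ?case
    proof
      fix x assume x: "x \<in> idx g"
      have "(case x of (a, b, k) \<Rightarrow> C' g a b k) = (case x of (a, b, k) \<Rightarrow> C g a b k)"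
        by (rule solution_unique[OF less.prems _ _ _ _ IH x]) (use C' sol less.prems in auto)
      then show "case x of (a, b, k) \<Rightarrow> C' g a b k = C g a b k" by (auto split: prod.splits)
    qed
  qed
  show ?thesis
  proof (intro exI[of _ C] conjI allI impI)
    show "HAE C g" "gap C g" if "g \<ge> 2" for g using sol[OF that] by auto
    show "\<forall>(a, b, k)\<in>idx g. C' g a b k = C g a b k"
      if "\<forall>g\<ge>2. HAE C' g \<and> gap C' g" "g \<ge> 2" for C' g
      by (rule uniq[OF that])
  qed
qed

end
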